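(* Let $\omega\in\mathbb{C}$, $\omega\neq 0$. The Hopf algebras $U_q(h)$ and $\widetilde{H_q(1)}$ (defined in the context) are paired: there is a bilinear pairing $\langle\ ,\ \rangle: U_q(h)\times \widetilde{H_q(1)}\to\mathbb{C}$, given on generators by $$\langle X, t^i{}_j\rangle=\rho(X)^i{}_j,\qquad X=A,A^\dagger,H,N,$$ such that for all $\phi,\psi\in U_q(h)$ and $a,b\in\widetilde{H_q(1)}$ $$\langle \phi\psi,a\rangle=\langle\phi\otimes\psi,\Delta a\rangle,\quad \langle 1,a\rangle=\varepsilon(a),\quad \langle\Delta\phi,a\otimes b\rangle=\langle\phi,ab\rangle,\quad \langle\phi,1\rangle=\varepsilon(\phi),\quad \langle S\phi,a\rangle=\langle\phi,Sa\rangle .$$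
   Context: **$U_q(h)$.** Unital algebra generated by $A,A^\dagger,N$ and a central element $H$ with its exponentials, with relations $[A,A^\dagger]=\frac1\omega(e^{\omega H/2}-e^{-\omega H/2})$, $[N,A]=-A$, $[N,A^\dagger]=A^\dagger$. Convention on exponentials: besides $H$, a central invertible element $g=e^{\omega H/4}$ is adjoined, and $e^{k\omega H/4}$ means $g^k$ ($k\in\mathbb{Z}$). Hopf structure: $\Delta A=e^{-\omega H/4}\otimes A+A\otimes e^{\omega H/4}$, $\Delta A^\dagger=e^{-\omega H/4}\otimes A^\dagger+A^\dagger\otimes e^{\omega H/4}$, $\Delta N=N\otimes1+1\otimes N$, $\Delta H=H\otimes 1+1\otimes H$, $\Delta g=g\otimes g$; $\varepsilon(X)=0$, $S(X)=-X$ for $X=A,A^\dagger,N,H$; $\varepsilon(g)=1$, $S(g)=g^{-1}$. **Representation $\rho$.** $\rho: U_q(h)\to M_3(\mathbb{C})$, $\rho(A)=e_{12}$, $\rho(A^\dagger)=e_{23}$, $\rho(H)=e_{13}$, $\rho(N)=e_{22}$ (matrix units), and $\rho(e^{k\omega H/4})=\exp(\tfrac{k\omega}{4}e_{13})=1+\frac{k\omega}{4}e_{13}$. **$\widetilde{H_q(1)}$ (extended quantum Heisenberg group).** Unital algebra generated by the entries of $$(t^i{}_j)=\begin{pmatrix}1&\alpha&\beta\\0&\gamma&\delta\\0&0&1\end{pmatrix}$$ and $\gamma^{-1}$, with $\gamma\gamma^{-1}=1=\gamma^{-1}\gamma$, $\gamma$ central, and $\alpha\beta-\beta\alpha=\frac\omega2\alpha$,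 $\alpha\delta-\delta\alpha=0$, $\beta\delta-\delta\beta=-\frac\omega2\delta$. Hopf structure: $\Delta t^i{}_j=\sum_k t^i{}_k\otimes t^k{}_j$, $\varepsilon(t^i{}_j)=\delta^i{}_j$, $S(\alpha)=-\gamma^{-1}\alpha$, $S(\beta)=-\beta+\gamma^{-1}\alpha\delta$, $S(\delta)=-\gamma^{-1}\delta$, $S(\gamma)=\gamma^{-1}$. The pairing of tensor products is $\langle\phi\otimes\psi,a\otimes b\rangle=\langle\phi,a\rangle\langle\psi,b\rangle$. *)

theory Defs
  imports
    "HOL-Library.Poly_Mapping"
    "HOL-Analysis.Analysis"
    "HOL-Algebra.Algebra"
begin

section \<open>Complex algebras, presentations and tensor products\<close>

text \<open>
  A complex algebra is a record \<^typ>\<open>(complex, 'a) module\<close>: its ring fields together with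
  the scalar multiplication.  The locale \<^locale>\<open>algebra\<close> of the library is not used, since it
  only covers commutative algebras.
\<close>

definition alg_hom ::
  "(complex, 'a, 'c) module_scheme \<Rightarrow> (complex, 'b, 'd) module_scheme \<Rightarrow> ('a \<Rightarrow> 'b) set"
  where "alg_hom A B =
    {h \<in> ring_hom A B. \<forall>c. \<forall>x \<in> carrier A. h (c \<odot>\<^bsub>A\<^esub> x) = c \<odot>\<^bsub>B\<^esub> h x}"

definition opposite :: "(complex, 'a) module \<Rightarrow> (complex, 'a) module"
  where "opposite A = A\<lparr>monoid.mult := \<lambda>x y. y \<otimes>\<^bsub>A\<^esub> x\<rparr>"

definition complex_alg :: "(complex, complex) module"
  where "complex_alg =
    \<lparr>carrier = UNIV, monoid.mult = (*), monoid.one = 1, ring.zero = 0, ring.add = (+), smult = (*)\<rparr>"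

definition mat3_alg :: "(complex, complex ^ 3 ^ 3) module"
  where "mat3_alg =
    \<lparr>carrier = UNIV, monoid.mult = (**), monoid.one = mat 1, ring.zero = 0, ring.add = (+),
     smult = (\<lambda>c M. \<chi> i j. c * M $ i $ j)\<rparr>"

definition pm_scale :: "complex \<Rightarrow> ('m \<Rightarrow>\<^sub>0 complex) \<Rightarrow> ('m \<Rightarrow>\<^sub>0 complex)"
  where "pm_scale c = Poly_Mapping.map ((*) c)"

text \<open>The monoid algebra: finite formal linear combinations of elements of a monoid.\<close>

definition monoid_alg :: "('m, 'c) monoid_scheme \<Rightarrow> (complex, 'm \<Rightarrow>\<^sub>0 complex) module"
  where "monoid_alg M =
    \<lparr>carrier = {p. Poly_Mapping.keys p \<subseteq> carrier M},
     monoid.mult = (\<lambda>p q. \<Sum>a \<in> Poly_Mapping.keys p. \<Sum>b \<in> Poly_Mapping.keys q.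
        Poly_Mapping.single (a \<otimes>\<^bsub>M\<^esub> b) (Poly_Mapping.lookup p a * Poly_Mapping.lookup q b)),
     monoid.one = Poly_Mapping.single \<one>\<^bsub>M\<^esub> 1,
     ring.zero = 0,
     ring.add = (+),
     smult = pm_scale\<rparr>"

definition quot_alg ::
  "(complex, 'a) module \<Rightarrow> 'a set \<Rightarrow> (complex, 'a set) module"
  where "quot_alg A I =
    \<lparr>carrier = carrier (A Quot I), monoid.mult = monoid.mult (A Quot I),
     monoid.one = monoid.one (A Quot I), ring.zero = ring.zero (A Quot I), ring.add = ring.add (A Quot I),
     smult = (\<lambda>c C. \<Union>x \<in> C. I +>\<^bsub>A\<^esub> (c \<odot>\<^bsub>A\<^esub> x))\<rparr>"

definition free_alg :: "(complex, 'x list \<Rightarrow>\<^sub>0 complex) module"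
  where "free_alg = monoid_alg \<lparr>carrier = UNIV, monoid.mult = (@), monoid.one = []\<rparr>"

text \<open>
  Generators and relations: each element of \<open>R\<close> is set to zero.  Note that a ring ideal of a
  unital algebra is automatically closed under scalar multiplication.
\<close>

definition presented_alg ::
  "('x list \<Rightarrow>\<^sub>0 complex) set \<Rightarrow> (complex, ('x list \<Rightarrow>\<^sub>0 complex) set) module"
  where "presented_alg R = quot_alg free_alg (Idl\<^bsub>free_alg\<^esub> R)"

definition generator ::
  "('x list \<Rightarrow>\<^sub>0 complex) set \<Rightarrow> 'x \<Rightarrow> ('x list \<Rightarrow>\<^sub>0 complex) set"
  where "generator R x =
    (Idl\<^bsub>free_alg\<^esub> R) +>\<^bsub>free_alg\<^esub> Poly_Mapping.single [x] 1"

text \<open>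
  The tensor product of two algebras is the free vector space on \<open>carrier A \<times> carrier B\<close> modulo
  the span of the bilinearity relators.  That vector space is the underlying space of the monoid
  algebra of the product of the multiplicative monoids, whose multiplication therefore induces
  \<open>(a \<otimes> b)(a' \<otimes> b') = aa' \<otimes> bb'\<close> on the quotient.
\<close>

definition tensor_relators ::
  "(complex, 'a) module \<Rightarrow> (complex, 'b) module \<Rightarrow> ('a \<times> 'b \<Rightarrow>\<^sub>0 complex) set"
  where "tensor_relators A B =
    {Poly_Mapping.single (a \<oplus>\<^bsub>A\<^esub> a', b) 1 - Poly_Mapping.single (a, b) 1
        - Poly_Mapping.single (a', b) 1
      | a a' b. a \<in> carrier A \<and> a' \<in> carrier A \<and> b \<in> carrier B} \<union>
    {Poly_Mapping.single (a, b \<oplus>\<^bsub>B\<^esub> b') 1 - Poly_Mapping.single (a, b) 1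
        - Poly_Mapping.single (a, b') 1
      | a b b'. a \<in> carrier A \<and> b \<in> carrier B \<and> b' \<in> carrier B} \<union>
    {Poly_Mapping.single (c \<odot>\<^bsub>A\<^esub> a, b) 1 - Poly_Mapping.single (a, b) c
      | c a b. a \<in> carrier A \<and> b \<in> carrier B} \<union>
    {Poly_Mapping.single (a, c \<odot>\<^bsub>B\<^esub> b) 1 - Poly_Mapping.single (a, b) c
      | c a b. a \<in> carrier A \<and> b \<in> carrier B}"

definition tensor_null ::
  "(complex, 'a) module \<Rightarrow> (complex, 'b) module \<Rightarrow> ('a \<times> 'b \<Rightarrow>\<^sub>0 complex) set"
  where "tensor_null A B = Modules.module.span pm_scale (tensor_relators A B)"

definition tensor_alg ::
  "(complex, 'a) module \<Rightarrow> (complex, 'b) module \<Rightarrow>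
   (complex, ('a \<times> 'b \<Rightarrow>\<^sub>0 complex) set) module"
  where "tensor_alg A B = quot_alg (monoid_alg (A \<times>\<times> B)) (tensor_null A B)"

definition pure_tensor ::
  "(complex, 'a) module \<Rightarrow> (complex, 'b) module \<Rightarrow> 'a \<Rightarrow> 'b \<Rightarrow> ('a \<times> 'b \<Rightarrow>\<^sub>0 complex) set"
  where "pure_tensor A B a b =
    tensor_null A B +>\<^bsub>monoid_alg (A \<times>\<times> B)\<^esub> Poly_Mapping.single (a, b) 1"

definition bilinear_form ::
  "(complex, 'a) module \<Rightarrow> (complex, 'b) module \<Rightarrow> ('a \<Rightarrow> 'b \<Rightarrow> complex) \<Rightarrow> bool"
  where "bilinear_form A B P \<longleftrightarrow>
    (\<forall>a \<in> carrier A. \<forall>a' \<in> carrier A. \<forall>b \<in> carrier B. P (a \<oplus>\<^bsub>A\<^esub> a') b = P a b + P a' b) \<and>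
    (\<forall>a \<in> carrier A. \<forall>b \<in> carrier B. \<forall>b' \<in> carrier B. P a (b \<oplus>\<^bsub>B\<^esub> b') = P a b + P a b') \<and>
    (\<forall>c. \<forall>a \<in> carrier A. \<forall>b \<in> carrier B. P (c \<odot>\<^bsub>A\<^esub> a) b = c * P a b) \<and>
    (\<forall>c. \<forall>a \<in> carrier A. \<forall>b \<in> carrier B. P a (c \<odot>\<^bsub>B\<^esub> b) = c * P a b)"

text \<open>
  The form on \<open>(A \<otimes> A) \<times> (B \<otimes> B)\<close> with \<open>\<langle>\<phi> \<otimes> \<psi>, a \<otimes> b\<rangle> = \<langle>\<phi>, a\<rangle>\<langle>\<psi>, b\<rangle>\<close>.  Here, and for the
  structure maps below, the map described by \<open>SOME\<close> exists and is determined on the carriers by its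
  values on pure tensors (on generators, respectively); outside the carriers it is never used.
\<close>

definition tensor_form ::
  "(complex, 'a) module \<Rightarrow> (complex, 'b) module \<Rightarrow> ('a \<Rightarrow> 'b \<Rightarrow> complex) \<Rightarrow>
   ('a \<times> 'a \<Rightarrow>\<^sub>0 complex) set \<Rightarrow> ('b \<times> 'b \<Rightarrow>\<^sub>0 complex) set \<Rightarrow> complex"
  where "tensor_form A B P = (SOME Q.
    bilinear_form (tensor_alg A A) (tensor_alg B B) Q \<and>
    (\<forall>\<phi> \<in> carrier A. \<forall>\<psi> \<in> carrier A. \<forall>a \<in> carrier B. \<forall>b \<in> carrier B.
      Q (pure_tensor A A \<phi> \<psi>) (pure_tensor B B a b) = P \<phi> a * P \<psi> b))"


section \<open>The quantum Heisenberg algebra\<close>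

text \<open>
  \<open>U_g\<close> is the adjoined central invertible element \<open>g = exp (\<omega>H/4)\<close> and \<open>U_ginv\<close> its inverse, so
  that \<open>exp (\<omega>H/2) = g\<^sup>2\<close>.  A word \<open>[x, y]\<close> stands for the product \<open>xy\<close>.
\<close>

datatype uq_gen = U_A | U_Adag | U_N | U_H | U_g | U_ginv

abbreviation word :: "'x list \<Rightarrow> ('x list \<Rightarrow>\<^sub>0 complex)"
  where "word w \<equiv> Poly_Mapping.single w 1"

definition uq_relations :: "complex \<Rightarrow> (uq_gen list \<Rightarrow>\<^sub>0 complex) set"
  where "uq_relations \<omega> =
    {word [U_A, U_Adag] - word [U_Adag, U_A]
       - pm_scale (1 / \<omega>) (word [U_g, U_g] - word [U_ginv, U_ginv]),
     word [U_N, U_A] - word [U_A, U_N] + word [U_A],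
     word [U_N, U_Adag] - word [U_Adag, U_N] - word [U_Adag],
     word [U_g, U_ginv] - word [],
     word [U_ginv, U_g] - word []} \<union>
    {word [U_H, x] - word [x, U_H] | x. True} \<union>
    {word [U_g, x] - word [x, U_g] | x. True}"

definition Uq :: "complex \<Rightarrow> (complex, (uq_gen list \<Rightarrow>\<^sub>0 complex) set) module"
  where "Uq \<omega> = presented_alg (uq_relations \<omega>)"

definition ugen :: "complex \<Rightarrow> uq_gen \<Rightarrow> (uq_gen list \<Rightarrow>\<^sub>0 complex) set"
  where "ugen \<omega> = generator (uq_relations \<omega>)"

definition Uq_comult ::
  "complex \<Rightarrow> (uq_gen list \<Rightarrow>\<^sub>0 complex) set \<Rightarrow>
   ((uq_gen list \<Rightarrow>\<^sub>0 complex) set \<times> (uq_gen list \<Rightarrow>\<^sub>0 complex) set \<Rightarrow>\<^sub>0 complex) set"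
  where "Uq_comult \<omega> =
    (let T = tensor_alg (Uq \<omega>) (Uq \<omega>);
         tens = pure_tensor (Uq \<omega>) (Uq \<omega>);
         x = ugen \<omega>;
         e = \<one>\<^bsub>Uq \<omega>\<^esub>
     in SOME D. D \<in> alg_hom (Uq \<omega>) T \<and>
       D (x U_A) = tens (x U_ginv) (x U_A) \<oplus>\<^bsub>T\<^esub> tens (x U_A) (x U_g) \<and>
       D (x U_Adag) = tens (x U_ginv) (x U_Adag) \<oplus>\<^bsub>T\<^esub> tens (x U_Adag) (x U_g) \<and>
       D (x U_N) = tens (x U_N) e \<oplus>\<^bsub>T\<^esub> tens e (x U_N) \<and>
       D (x U_H) = tens (x U_H) e \<oplus>\<^bsub>T\<^esub> tens e (x U_H) \<and>
       D (x U_g) = tens (x U_g) (x U_g))"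

definition Uq_counit :: "complex \<Rightarrow> (uq_gen list \<Rightarrow>\<^sub>0 complex) set \<Rightarrow> complex"
  where "Uq_counit \<omega> = (SOME E. E \<in> alg_hom (Uq \<omega>) complex_alg \<and>
    (\<forall>y \<in> {U_A, U_Adag, U_N, U_H}. E (ugen \<omega> y) = 0) \<and>
    E (ugen \<omega> U_g) = 1)"

text \<open>The antipode is an anti-homomorphism.\<close>

definition Uq_antipode ::
  "complex \<Rightarrow> (uq_gen list \<Rightarrow>\<^sub>0 complex) set \<Rightarrow> (uq_gen list \<Rightarrow>\<^sub>0 complex) set"
  where "Uq_antipode \<omega> = (SOME S. S \<in> alg_hom (Uq \<omega>) (opposite (Uq \<omega>)) \<and>
    (\<forall>y \<in> {U_A, U_Adag, U_N, U_H}. S (ugen \<omega> y) = \<ominus>\<^bsub>Uq \<omega>\<^esub> ugen \<omega> y) \<and>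
    S (ugen \<omega> U_g) = ugen \<omega> U_ginv)"

definition mat_unit :: "3 \<Rightarrow> 3 \<Rightarrow> complex ^ 3 ^ 3"
  where "mat_unit k l = (\<chi> i j. if i = k \<and> j = l then 1 else 0)"

definition rho :: "complex \<Rightarrow> (uq_gen list \<Rightarrow>\<^sub>0 complex) set \<Rightarrow> complex ^ 3 ^ 3"
  where "rho \<omega> = (SOME r. r \<in> alg_hom (Uq \<omega>) mat3_alg \<and>
    r (ugen \<omega> U_A) = mat_unit 1 2 \<and>
    r (ugen \<omega> U_Adag) = mat_unit 2 3 \<and>
    r (ugen \<omega> U_H) = mat_unit 1 3 \<and>
    r (ugen \<omega> U_N) = mat_unit 2 2 \<and>
    r (ugen \<omega> U_g) = mat 1 \<oplus>\<^bsub>mat3_alg\<^esub> (\<omega> / 4) \<odot>\<^bsub>mat3_alg\<^esub> mat_unit 1 3)"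


section \<open>The extended quantum Heisenberg group\<close>

datatype hq_gen = H_alpha | H_beta | H_gamma | H_gammainv | H_delta

definition hq_relations :: "complex \<Rightarrow> (hq_gen list \<Rightarrow>\<^sub>0 complex) set"
  where "hq_relations \<omega> =
    {word [H_gamma, H_gammainv] - word [],
     word [H_gammainv, H_gamma] - word [],
     word [H_alpha, H_beta] - word [H_beta, H_alpha] - pm_scale (\<omega> / 2) (word [H_alpha]),
     word [H_alpha, H_delta] - word [H_delta, H_alpha],
     word [H_beta, H_delta] - word [H_delta, H_beta] + pm_scale (\<omega> / 2) (word [H_delta])} \<union>
    {word [H_gamma, x] - word [x, H_gamma] | x. True}"

definition Hq :: "complex \<Rightarrow> (complex, (hq_gen list \<Rightarrow>\<^sub>0 complex) set) module"
  where "Hq \<omega> = presented_alg (hq_relations \<omega>)"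

definition hgen :: "complex \<Rightarrow> hq_gen \<Rightarrow> (hq_gen list \<Rightarrow>\<^sub>0 complex) set"
  where "hgen \<omega> = generator (hq_relations \<omega>)"

definition tmat :: "complex \<Rightarrow> 3 \<Rightarrow> 3 \<Rightarrow> (hq_gen list \<Rightarrow>\<^sub>0 complex) set"
  where "tmat \<omega> i j =
    (if i = 1 \<and> j = 1 \<or> i = 3 \<and> j = 3 then \<one>\<^bsub>Hq \<omega>\<^esub>
     else if i = 1 \<and> j = 2 then hgen \<omega> H_alpha
     else if i = 1 \<and> j = 3 then hgen \<omega> H_beta
     else if i = 2 \<and> j = 2 then hgen \<omega> H_gamma
     else if i = 2 \<and> j = 3 then hgen \<omega> H_delta
     else \<zero>\<^bsub>Hq \<omega>\<^esub>)"

definition Hq_comult ::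
  "complex \<Rightarrow> (hq_gen list \<Rightarrow>\<^sub>0 complex) set \<Rightarrow>
   ((hq_gen list \<Rightarrow>\<^sub>0 complex) set \<times> (hq_gen list \<Rightarrow>\<^sub>0 complex) set \<Rightarrow>\<^sub>0 complex) set"
  where "Hq_comult \<omega> =
    (let T = tensor_alg (Hq \<omega>) (Hq \<omega>)
     in SOME D. D \<in> alg_hom (Hq \<omega>) T \<and>
       (\<forall>i j. D (tmat \<omega> i j) =
         (\<Oplus>\<^bsub>T\<^esub> k \<in> UNIV. pure_tensor (Hq \<omega>) (Hq \<omega>) (tmat \<omega> i k) (tmat \<omega> k j))))"

definition Hq_counit :: "complex \<Rightarrow> (hq_gen list \<Rightarrow>\<^sub>0 complex) set \<Rightarrow> complex"
  where "Hq_counit \<omega> = (SOME E. E \<in> alg_hom (Hq \<omega>) complex_alg \<and>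
    (\<forall>i j. E (tmat \<omega> i j) = (if i = j then 1 else 0)))"

definition Hq_antipode ::
  "complex \<Rightarrow> (hq_gen list \<Rightarrow>\<^sub>0 complex) set \<Rightarrow> (hq_gen list \<Rightarrow>\<^sub>0 complex) set"
  where "Hq_antipode \<omega> =
    (let A = Hq \<omega>; x = hgen \<omega>
     in SOME S. S \<in> alg_hom A (opposite A) \<and>
       S (x H_alpha) = \<ominus>\<^bsub>A\<^esub> (x H_gammainv \<otimes>\<^bsub>A\<^esub> x H_alpha) \<and>
       S (x H_beta) = (\<ominus>\<^bsub>A\<^esub> x H_beta) \<oplus>\<^bsub>A\<^esub> x H_gammainv \<otimes>\<^bsub>A\<^esub> x H_alpha \<otimes>\<^bsub>A\<^esub> x H_delta \<and>
       S (x H_delta) = \<ominus>\<^bsub>A\<^esub> (x H_gammainv \<otimes>\<^bsub>A\<^esub> x H_delta) \<and>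
       S (x H_gamma) = x H_gammainv)"

end

theory Submission
  imports Defs
begin

text \<open>
  A pairing of the free algebras on the generators is determined by its values on pairs of
  generators and by the coproducts of the generators: writing every coproduct as a list of pairs of
  words, the value on two words is computed by splitting one word along the letters of the other,
  and coassociativity makes the result symmetric in the two sides.  This word pairing satisfies all
  the Hopf axioms by induction, except that it has to be shown to vanish on the two ideals of
  relations.  Since both families of relations span coideals (up to the relations themselves), this
  only has to be checked for words of length at most one on the other side, where it is a finite
  calculation.

  An identity in a quotient of a space of formal combinations, in particular in the tensor square of
  a presented algebra, holds as soon as it holds under every linear form.  The existence of the
  structure maps thereby reduces to scalar identities between functions on words that vanish on the
  relations.
\<close>

section \<open>Formal linear combinations and complex algebras\<close>

text \<open>Neither algebra is ever given a basis of ordered monomials. A function on words descends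
  as soon as it kills every relation in every context \<open>u @ w @ v\<close>, and a linear form on
  a tensor square restricts, with one factor fixed, to such a function. Normal forms are thereby
  replaced by a few rewriting rules inside scalar identities. The representation \<open>rho\<close>
  prescribes the pairing with the entries of \<open>tmat\<close> only. The values at
  \<open>H_gammainv\<close> are forced by \<gamma>\<gamma>^(-1) = 1: they are 1 on g and its
  inverse, -1 on N, and 0 on A, A^dagger and H. The hypothesis \<omega> \<noteq> 0 enters through
  [A, A^dagger] paired with \<beta>, where the value 1 has to equal (\<omega>/2 +
  \<omega>/2)/\<omega>. The two antipodes are not on the same footing. That of \<open>Uq\<close>
  sends letters to signed letters, exchanging g and its inverse, and reverses coproducts already on
  words; that of \<open>Hq\<close> does so only modulo \<gamma>\<gamma>^(-1) = 1. The antipode axiom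
  is therefore proved by induction on the \<open>Hq\<close>-word, and the relations are confined to
  the case of a single letter.\<close>

definition lin :: "('k \<Rightarrow> complex) \<Rightarrow> ('k \<Rightarrow>\<^sub>0 complex) \<Rightarrow> complex"
  where "lin f p = (\<Sum>k \<in> Poly_Mapping.keys p. Poly_Mapping.lookup p k * f k)"

lemma lin_superset:
  assumes "finite S" "Poly_Mapping.keys p \<subseteq> S"
  shows "lin f p = (\<Sum>k \<in> S. Poly_Mapping.lookup p k * f k)"
  unfolding lin_def using assms
  by (intro sum.mono_neutral_left) (auto simp: in_keys_iff)

lemma lin_zero [simp]: "lin f 0 = 0"
  by (simp add: lin_def)

lemma lin_single [simp]: "lin f (Poly_Mapping.single k c) = c * f k"
  by (simp add: lin_def)

lemma lin_add [simp]: "lin f (p + q) = lin f p + lin f q"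
proof -
  let ?S = "Poly_Mapping.keys p \<union> Poly_Mapping.keys q"
  have "lin f (p + q) = (\<Sum>k \<in> ?S. Poly_Mapping.lookup (p + q) k * f k)"
    by (rule lin_superset) (auto simp: keys_add)
  also have "\<dots> = (\<Sum>k \<in> ?S. Poly_Mapping.lookup p k * f k) + (\<Sum>k \<in> ?S. Poly_Mapping.lookup q k * f k)"
    by (simp add: lookup_add algebra_simps sum.distrib)
  also have "\<dots> = lin f p + lin f q"
    by (simp add: lin_superset[of ?S])
  finally show ?thesis .
qed

lemma lin_uminus [simp]: "lin f (- p) = - lin f p"
  by (simp add: lin_def sum_negf)

lemma lin_diff [simp]: "lin f (p - q) = lin f p - lin f q"
  using lin_add[of f p "- q"] by simp

lemma lookup_pm_scale [simp]:
  "Poly_Mapping.lookup (pm_scale c p) k = c * Poly_Mapping.lookup p k"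
  by (simp add: pm_scale_def Poly_Mapping.map.rep_eq when_def)

lemma keys_pm_scale: "Poly_Mapping.keys (pm_scale c p) \<subseteq> Poly_Mapping.keys p"
  by (auto simp: in_keys_iff)

lemma lin_scale [simp]: "lin f (pm_scale c p) = c * lin f p"
proof -
  have "lin f (pm_scale c p) = (\<Sum>k \<in> Poly_Mapping.keys p. c * (Poly_Mapping.lookup p k * f k))"
    by (subst lin_superset[of "Poly_Mapping.keys p"]) (auto simp: keys_pm_scale mult.assoc)
  then show ?thesis
    by (simp add: lin_def sum_distrib_left)
qed

lemma lin_sum [simp]: "lin f (sum p A) = (\<Sum>x \<in> A. lin f (p x))"
  by (induction A rule: infinite_finite_induct) auto

lemma lin_cong:
  assumes "\<And>k. k \<in> Poly_Mapping.keys p \<Longrightarrow> f k = g k"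
  shows "lin f p = lin g p"
  using assms by (simp add: lin_def)

lemma lin_add_fun: "lin (\<lambda>k. f k + g k) p = lin f p + lin g p"
  by (simp add: lin_def algebra_simps sum.distrib)

lemma lin_mult_fun: "lin (\<lambda>k. c * f k) p = c * lin f p"
  by (simp add: lin_def algebra_simps sum_distrib_left)

lemma lin_zero_fun [simp]: "lin (\<lambda>k. 0) p = 0"
  by (simp add: lin_def)

lemma lin_swap: "lin (\<lambda>a. lin (F a) q) p = lin (\<lambda>b. lin (\<lambda>a. F a b) p) q"
  unfolding lin_def sum_distrib_left
  by (subst sum.swap) (simp add: algebra_simps)

text \<open>Indicator functions of single keys already recover every coefficient. Vector identities
  thus become scalar identities for \<open>lin\<close>.\<close>

lemma pm_eqI:
  assumes "\<And>f. lin f p = lin f q"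
  shows "p = q"
proof (rule poly_mapping_eqI)
  fix k
  have "lin (\<lambda>j. if j = k then 1 else 0) r = Poly_Mapping.lookup r k" for r :: "'a \<Rightarrow>\<^sub>0 complex"
    by (auto simp: lin_def in_keys_iff if_distrib[of "(*) _"] sum.delta cong: if_cong)
  with assms show "Poly_Mapping.lookup p k = Poly_Mapping.lookup q k"
    by metis
qed

lemma pm_sum_singles:
  "(\<Sum>k \<in> Poly_Mapping.keys p. Poly_Mapping.single k (Poly_Mapping.lookup p k)) = p"
  for p :: "'k \<Rightarrow>\<^sub>0 complex"
  by (rule pm_eqI) (simp, simp add: lin_def)

text \<open>The added keys are restricted to those of \<open>p\<close>, so that a carrier condition
  on the keys of \<open>p\<close> stays available in the induction step.\<close>

lemma pm_single_induct [case_names zero add]: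
  fixes p :: "'k \<Rightarrow>\<^sub>0 complex"
  assumes zero: "P 0"
    and add: "\<And>k c q. k \<in> Poly_Mapping.keys p \<Longrightarrow> P q \<Longrightarrow> P (Poly_Mapping.single k c + q)"
  shows "P p"
proof -
  have "finite S \<Longrightarrow> S \<subseteq> Poly_Mapping.keys p \<Longrightarrow>
      P (\<Sum>k \<in> S. Poly_Mapping.single k (Poly_Mapping.lookup p k))" for S
    by (induction S rule: finite_induct) (auto simp: zero add)
  from this[of "Poly_Mapping.keys p"] show ?thesis
    by (simp add: pm_sum_singles)
qed

interpretation pm: vector_space "pm_scale :: complex \<Rightarrow> ('k \<Rightarrow>\<^sub>0 complex) \<Rightarrow> _"
  by unfold_locales (auto intro!: pm_eqI simp: algebra_simps)

interpretation pmc: vector_space_pair "pm_scale :: complex \<Rightarrow> ('k \<Rightarrow>\<^sub>0 complex) \<Rightarrow> _"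
    "(*) :: complex \<Rightarrow> complex \<Rightarrow> complex"
  by unfold_locales (auto simp: algebra_simps)

lemma additive_pm_eq_lin:
  assumes "Vector_Spaces.linear pm_scale ((*) :: complex \<Rightarrow> _) g"
  shows "g p = lin (\<lambda>k. g (Poly_Mapping.single k 1)) p"
proof (induction p rule: pm_single_induct)
  case zero
  show ?case using assms by (simp add: pmc.linear_0)
next
  case (add k c q)
  have "Poly_Mapping.single k c = pm_scale c (Poly_Mapping.single k 1)"
    by (rule pm_eqI) simp
  then have "g (Poly_Mapping.single k c) = c * g (Poly_Mapping.single k 1)"
    using assms by (metis pmc.linear_scale)
  with add assms show ?case
    by (simp add: pmc.linear_add)
qed

text \<open>Adjoining \<open>z\<close> to a basis of \<open>W\<close> keeps it independent, so some
  linear map is 1 at \<open>z\<close> and 0 on that basis. All later separation statements rest on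
  this.\<close>

lemma pm_subspace_separation:
  fixes z :: "'k \<Rightarrow>\<^sub>0 complex"
  assumes "pm.subspace W" "z \<notin> W"
  obtains f where "\<And>w. w \<in> W \<Longrightarrow> lin f w = 0" "lin f z \<noteq> 0"
proof -
  obtain B where B: "B \<subseteq> W" "pm.independent B" "W \<subseteq> pm.span B"
    using pm.maximal_independent_subset .
  then have span: "pm.span B = W"
    using assms(1) pm.span_minimal by blast
  with B assms(2) have "pm.independent (insert z B)"
    by (intro pm.independent_insertI) auto
  then obtain g where g: "Vector_Spaces.linear pm_scale ((*) :: complex \<Rightarrow> _) g"
    and gB: "\<forall>x \<in> insert z B. g x = (if x = z then 1 else 0)"
    using pmc.linear_independent_extend[of _ "\<lambda>x. if x = z then 1 else 0"] by blast
  have "g w = 0" if wW: "w \<in> W" for w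
  proof -
    have "x \<noteq> z" if "x \<in> B" for x
      using that assms(2) B(1) by blast
    then have "g x = 0" if "x \<in> B" for x
      using that bspec[OF gB, of x] by simp
    then show ?thesis
      using pmc.linear_eq_0_on_span[OF g, of B w] wW unfolding span[symmetric] by blast
  qed
  then have "lin (\<lambda>k. g (Poly_Mapping.single k 1)) w = 0" if "w \<in> W" for w
    using that additive_pm_eq_lin[OF g, of w] by metis
  moreover have "lin (\<lambda>k. g (Poly_Mapping.single k 1)) z \<noteq> 0"
    using gB additive_pm_eq_lin[OF g, of z] by (metis insertI1 zero_neq_one)
  ultimately show ?thesis
    using that by blast
qed

section \<open>Unital complex algebras and their linear forms\<close>

locale complex_algebra = ring A for A :: "(complex, 'a) module" (structure) +
  assumes smult_closed [simp, intro]: "x \<in> carrier A \<Longrightarrow> c \<odot> x \<in> carrier A"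
    and smult_l_distr: "x \<in> carrier A \<Longrightarrow> (c + d) \<odot> x = c \<odot> x \<oplus> d \<odot> x"
    and smult_r_distr: "x \<in> carrier A \<Longrightarrow> y \<in> carrier A \<Longrightarrow> c \<odot> (x \<oplus> y) = c \<odot> x \<oplus> c \<odot> y"
    and smult_assoc1: "x \<in> carrier A \<Longrightarrow> (c * d) \<odot> x = c \<odot> (d \<odot> x)"
    and smult_one [simp]: "x \<in> carrier A \<Longrightarrow> 1 \<odot> x = x"
    and smult_mult_l: "x \<in> carrier A \<Longrightarrow> y \<in> carrier A \<Longrightarrow> (c \<odot> x) \<otimes> y = c \<odot> (x \<otimes> y)"
    and smult_mult_r: "x \<in> carrier A \<Longrightarrow> y \<in> carrier A \<Longrightarrow> x \<otimes> (c \<odot> y) = c \<odot> (x \<otimes> y)"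
begin

lemma smult_zero [simp]: "c \<odot> \<zero> = \<zero>"
proof -
  have "c \<odot> \<zero> \<oplus> c \<odot> \<zero> = c \<odot> \<zero>"
    using smult_r_distr[of \<zero> \<zero> c] by simp
  then show ?thesis
    by (metis add.r_cancel_one' smult_closed zero_closed)
qed

lemma zero_smult [simp]: "x \<in> carrier A \<Longrightarrow> 0 \<odot> x = \<zero>"
  using smult_l_distr[of x 0 0] by (metis add.r_cancel_one' add_0 smult_closed)

lemma minus_one_smult: "x \<in> carrier A \<Longrightarrow> (- 1) \<odot> x = \<ominus> x"
  using smult_l_distr[of x "-1" 1]
  by (metis (no_types, lifting) add.l_inv_ex add.inv_unique' ab_left_minus minus_equality smult_closed smult_one zero_smult)

lemma smult_eq_mult_one: "x \<in> carrier A \<Longrightarrow> c \<odot> x = (c \<odot> \<one>) \<otimes> x"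
  by (simp add: smult_mult_l)

lemma ideal_smult_closed:
  assumes "ideal I A" "x \<in> I"
  shows "c \<odot> x \<in> I"
proof -
  interpret ideal I A by fact
  show ?thesis
    using assms(2) smult_eq_mult_one[of x c] I_l_closed by auto
qed

end

definition linear_forms :: "(complex, 'a) module \<Rightarrow> ('a \<Rightarrow> complex) set"
  where "linear_forms A =
    {f. (\<forall>x \<in> carrier A. \<forall>y \<in> carrier A. f (x \<oplus>\<^bsub>A\<^esub> y) = f x + f y) \<and>
        (\<forall>c. \<forall>x \<in> carrier A. f (c \<odot>\<^bsub>A\<^esub> x) = c * f x)}"

lemma linear_forms_add:
  "f \<in> linear_forms A \<Longrightarrow> x \<in> carrier A \<Longrightarrow> y \<in> carrier A \<Longrightarrow> f (x \<oplus>\<^bsub>A\<^esub> y) = f x + f y"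
  by (simp add: linear_forms_def)

lemma linear_forms_smult:
  "f \<in> linear_forms A \<Longrightarrow> x \<in> carrier A \<Longrightarrow> f (c \<odot>\<^bsub>A\<^esub> x) = c * f x"
  by (simp add: linear_forms_def)

context complex_algebra
begin

lemma linear_forms_zero: "f \<in> linear_forms A \<Longrightarrow> f \<zero> = 0"
  using linear_forms_add[of f A \<zero> \<zero>] by simp

lemma linear_forms_minus:
  assumes "f \<in> linear_forms A" "x \<in> carrier A"
  shows "f (\<ominus> x) = - f x"
  using linear_forms_smult[OF assms, of "- 1"] assms by (simp add: minus_one_smult)

lemma linear_forms_diff:
  assumes "f \<in> linear_forms A" "x \<in> carrier A" "y \<in> carrier A"
  shows "f (x \<ominus> y) = f x - f y"
  using assms by (simp add: minus_eq linear_forms_add linear_forms_minus)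

lemma linear_forms_mult_left:
  "f \<in> linear_forms A \<Longrightarrow> y \<in> carrier A \<Longrightarrow> (\<lambda>x. f (y \<otimes> x)) \<in> linear_forms A"
  by (simp add: linear_forms_def r_distr smult_mult_r)

lemma linear_forms_mult_right:
  "f \<in> linear_forms A \<Longrightarrow> y \<in> carrier A \<Longrightarrow> (\<lambda>x. f (x \<otimes> y)) \<in> linear_forms A"
  by (simp add: linear_forms_def l_distr smult_mult_l)

end

text \<open>The algebraic dual separates points. This is shown below for every quotient of a monoid
  algebra by an ideal, which covers presented algebras and tensor products alike.\<close>

definition separated :: "(complex, 'a) module \<Rightarrow> bool"
  where "separated A \<longleftrightarrow>
    (\<forall>z \<in> carrier A. (\<forall>f \<in> linear_forms A. f z = 0) \<longrightarrow> z = \<zero>\<^bsub>A\<^esub>)"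

lemma alg_homD:
  assumes "h \<in> alg_hom A B"
  shows "x \<in> carrier A \<Longrightarrow> h x \<in> carrier B"
    and "x \<in> carrier A \<Longrightarrow> y \<in> carrier A \<Longrightarrow> h (x \<otimes>\<^bsub>A\<^esub> y) = h x \<otimes>\<^bsub>B\<^esub> h y"
    and "x \<in> carrier A \<Longrightarrow> y \<in> carrier A \<Longrightarrow> h (x \<oplus>\<^bsub>A\<^esub> y) = h x \<oplus>\<^bsub>B\<^esub> h y"
    and "h \<one>\<^bsub>A\<^esub> = \<one>\<^bsub>B\<^esub>"
    and "x \<in> carrier A \<Longrightarrow> h (c \<odot>\<^bsub>A\<^esub> x) = c \<odot>\<^bsub>B\<^esub> h x"
  using assms by (auto simp: alg_hom_def ring_hom_def)

lemma linear_forms_alg_hom: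
  "h \<in> alg_hom A B \<Longrightarrow> f \<in> linear_forms B \<Longrightarrow> (\<lambda>x. f (h x)) \<in> linear_forms A"
  by (simp add: linear_forms_def alg_homD)

section \<open>Monoid algebras\<close>

lemma monoid_alg_simps [simp]:
  "carrier (monoid_alg M) = {p. Poly_Mapping.keys p \<subseteq> carrier M}"
  "\<one>\<^bsub>monoid_alg M\<^esub> = Poly_Mapping.single \<one>\<^bsub>M\<^esub> 1"
  "\<zero>\<^bsub>monoid_alg M\<^esub> = 0"
  "p \<oplus>\<^bsub>monoid_alg M\<^esub> q = p + q"
  "c \<odot>\<^bsub>monoid_alg M\<^esub> p = pm_scale c p"
  by (simp_all add: monoid_alg_def)

lemma lin_monoid_alg_mult [simp]:
  "lin f (p \<otimes>\<^bsub>monoid_alg M\<^esub> q) = lin (\<lambda>a. lin (\<lambda>b. f (a \<otimes>\<^bsub>M\<^esub> b)) q) p"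
  by (simp add: monoid_alg_def lin_def[of _ p] lin_def[of _ q] sum_distrib_left mult.assoc)

lemma monoid_alg_mult_single [simp]:
  "Poly_Mapping.single a c \<otimes>\<^bsub>monoid_alg M\<^esub> Poly_Mapping.single b d
     = Poly_Mapping.single (a \<otimes>\<^bsub>M\<^esub> b) (c * d)"
  by (rule pm_eqI) simp

text \<open>A coefficient is the value of an indicator form, and \<open>lin_monoid_alg_mult\<close>
  turns it into a double sum; if no pair of keys multiplies to \<open>k\<close>, every term
  vanishes.\<close>

lemma keys_monoid_alg_mult:
  "Poly_Mapping.keys (p \<otimes>\<^bsub>monoid_alg M\<^esub> q)
     \<subseteq> (\<lambda>(a, b). a \<otimes>\<^bsub>M\<^esub> b) ` (Poly_Mapping.keys p \<times> Poly_Mapping.keys q)"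
proof
  fix k
  assume k: "k \<in> Poly_Mapping.keys (p \<otimes>\<^bsub>monoid_alg M\<^esub> q)"
  have lookup: "Poly_Mapping.lookup r k = lin (\<lambda>j. if j = k then 1 else 0) r" for r
    by (auto simp: lin_def in_keys_iff if_distrib[of "(*) _"] sum.delta cong: if_cong)
  show "k \<in> (\<lambda>(a, b). a \<otimes>\<^bsub>M\<^esub> b) ` (Poly_Mapping.keys p \<times> Poly_Mapping.keys q)"
  proof (rule ccontr)
    assume not: "\<not> ?thesis"
    have "lin (\<lambda>a. lin (\<lambda>b. if a \<otimes>\<^bsub>M\<^esub> b = k then 1 else 0) q) p = lin (\<lambda>a. lin (\<lambda>b. 0) q) p"
      using not by (intro lin_cong) force
    with k show False
      by (simp add: in_keys_iff lookup)
  qed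
qed

lemma monoid_alg_complex_algebra:
  assumes "monoid M"
  shows "complex_algebra (monoid_alg M)"
proof -
  interpret M: monoid M by fact
  show ?thesis
  proof (intro complex_algebra.intro ringI abelian_groupI monoidI complex_algebra_axioms.intro)
    fix x y
    assume "x \<in> carrier (monoid_alg M)" "y \<in> carrier (monoid_alg M)"
    then show "x \<otimes>\<^bsub>monoid_alg M\<^esub> y \<in> carrier (monoid_alg M)"
      using keys_monoid_alg_mult[of M x y] by fastforce
  next
    fix x y z
    assume "x \<in> carrier (monoid_alg M)" "y \<in> carrier (monoid_alg M)" "z \<in> carrier (monoid_alg M)"
    then show "x \<otimes>\<^bsub>monoid_alg M\<^esub> y \<otimes>\<^bsub>monoid_alg M\<^esub> z
        = x \<otimes>\<^bsub>monoid_alg M\<^esub> (y \<otimes>\<^bsub>monoid_alg M\<^esub> z)"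
      by (intro pm_eqI) (auto simp: subset_iff M.m_assoc intro!: lin_cong)
  next
    fix x assume "x \<in> carrier (monoid_alg M)"
    then show "\<exists>y \<in> carrier (monoid_alg M). y \<oplus>\<^bsub>monoid_alg M\<^esub> x = \<zero>\<^bsub>monoid_alg M\<^esub>"
      by (intro bexI[of _ "- x"]) auto
  next
    fix x y assume "x \<in> carrier (monoid_alg M)" "y \<in> carrier (monoid_alg M)"
    then show "x \<oplus>\<^bsub>monoid_alg M\<^esub> y \<in> carrier (monoid_alg M)"
      using subset_trans[OF keys_add[of x y]] by simp
  next
    fix x c assume "x \<in> carrier (monoid_alg M)"
    then show "c \<odot>\<^bsub>monoid_alg M\<^esub> x \<in> carrier (monoid_alg M)"
      using subset_trans[OF keys_pm_scale[of c x]] by simp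
  next
    fix x assume "x \<in> carrier (monoid_alg M)"
    then have *: "k \<in> carrier M" if "k \<in> Poly_Mapping.keys x" for k
      using that by auto
    show "\<one>\<^bsub>monoid_alg M\<^esub> \<otimes>\<^bsub>monoid_alg M\<^esub> x = x"
      by (rule pm_eqI) (simp, rule lin_cong, simp add: *)
    show "x \<otimes>\<^bsub>monoid_alg M\<^esub> \<one>\<^bsub>monoid_alg M\<^esub> = x"
      by (rule pm_eqI) (simp, rule lin_cong, simp add: *)
  qed (auto intro!: pm_eqI simp: algebra_simps lin_add_fun lin_mult_fun)
qed

section \<open>Quotients by ideals and maps out of them\<close>

context complex_algebra
begin

lemma coset_eq_iff:
  assumes "ideal I A" "x \<in> carrier A" "y \<in> carrier A"
  shows "I +> x = I +> y \<longleftrightarrow> x \<ominus> y \<in> I"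
proof -
  interpret ideal I A by fact
  have "x \<in> I +> y \<longleftrightarrow> x \<ominus> y \<in> I"
    using assms(2,3) a_rcos_module_minus ring_axioms by blast
  moreover have "x \<in> I +> x"
    using assms(2) a_rcos_self by blast
  moreover have "x \<in> I +> y \<Longrightarrow> I +> y = I +> x"
    using assms(3) a_repr_independence' by blast
  ultimately show ?thesis
    by auto
qed

text \<open>The definition takes a union over all representatives. The sets in this union coincide,
  because \<open>c \<odot> (y \<ominus> x)\<close> lies in the ideal with
  \<open>y \<ominus> x\<close>.\<close>

lemma quot_alg_smult:
  assumes "ideal I A" "x \<in> carrier A"
  shows "c \<odot>\<^bsub>quot_alg A I\<^esub> (I +> x) = I +> (c \<odot> x)"
proof -
  interpret ideal I A by fact
  have "I +> (c \<odot> y) = I +> (c \<odot> x)" if y: "y \<in> I +> x" for y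
  proof -
    have yc: "y \<in> carrier A"
      using y assms(2) a_elemrcos_carrier by blast
    have "y \<ominus> x \<in> I"
      using y yc assms(2) a_rcos_module_minus ring_axioms by blast
    then have "c \<odot> (y \<ominus> x) \<in> I"
      by (rule ideal_smult_closed[OF assms(1)])
    moreover have "c \<odot> (y \<ominus> x) = c \<odot> y \<ominus> c \<odot> x"
      using yc assms(2)
      by (simp add: minus_eq smult_r_distr minus_one_smult[symmetric] smult_assoc1[symmetric])
    ultimately show ?thesis
      using coset_eq_iff[OF assms(1)] yc assms(2) by simp
  qed
  moreover have "x \<in> I +> x"
    using assms(2) a_rcos_self by blast
  ultimately have "(\<Union>y \<in> I +> x. I +> (c \<odot> y)) = I +> (c \<odot> x)"
    by blast
  then show ?thesis
    by (simp add: quot_alg_def)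
qed

lemma quot_alg_carrier: "carrier (quot_alg A I) = (\<lambda>x. I +> x) ` carrier A"
  by (auto simp: quot_alg_def FactRing_simps)

lemma quot_alg_ops:
  assumes "ideal I A" "x \<in> carrier A" "y \<in> carrier A"
  shows "(I +> x) \<otimes>\<^bsub>quot_alg A I\<^esub> (I +> y) = I +> (x \<otimes> y)"
    and "(I +> x) \<oplus>\<^bsub>quot_alg A I\<^esub> (I +> y) = I +> (x \<oplus> y)"
proof -
  interpret ideal I A by fact
  show "(I +> x) \<otimes>\<^bsub>quot_alg A I\<^esub> (I +> y) = I +> (x \<otimes> y)"
    and "(I +> x) \<oplus>\<^bsub>quot_alg A I\<^esub> (I +> y) = I +> (x \<oplus> y)"
    using assms by (simp_all add: quot_alg_def FactRing_def rcoset_mult_add a_rcos_sum)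
qed

lemma quot_alg_zero: "ideal I A \<Longrightarrow> \<zero>\<^bsub>quot_alg A I\<^esub> = I +> \<zero>"
  by (simp add: quot_alg_def FactRing_def additive_subgroup.a_subset ideal.axioms(1))

lemma quot_alg_one: "\<one>\<^bsub>quot_alg A I\<^esub> = I +> \<one>"
  by (simp add: quot_alg_def FactRing_def)

lemma quot_alg_complex_algebra:
  assumes "ideal I A"
  shows "complex_algebra (quot_alg A I)"
proof -
  interpret ideal I A by fact
  let ?Q = "A Quot I"
  let ?B = "quot_alg A I"
  interpret Q: ring ?Q by (rule quotient_is_ring)
  have [simp]: "carrier ?B = carrier ?Q" "monoid.mult ?B = monoid.mult ?Q" "\<one>\<^bsub>?B\<^esub> = \<one>\<^bsub>?Q\<^esub>"
    "\<zero>\<^bsub>?B\<^esub> = \<zero>\<^bsub>?Q\<^esub>" "ring.add ?B = ring.add ?Q"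
    by (simp_all add: quot_alg_def)
  have "ring ?B"
    by (intro ringI abelian_groupI monoidI)
      (use Q.add.l_inv_ex in \<open>simp_all add: Q.m_assoc Q.l_distr Q.r_distr Q.a_ac\<close>)
  moreover have "complex_algebra_axioms ?B"
    using quot_alg_ops[OF assms] quot_alg_smult[OF assms]
    by unfold_locales
      (auto simp only: quot_alg_carrier image_iff smult_closed m_closed add.m_closed smult_l_distr
        smult_r_distr smult_assoc1 smult_one smult_mult_l smult_mult_r)
  ultimately show ?thesis
    by (rule complex_algebra.intro)
qed

lemma quot_alg_class_hom:
  assumes "ideal I A"
  shows "(\<lambda>x. I +> x) \<in> alg_hom A (quot_alg A I)"
  using quot_alg_ops[OF assms] quot_alg_smult[OF assms]
  by (auto simp: alg_hom_def ring_hom_def quot_alg_carrier quot_alg_one)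

end

text \<open>Evaluation at an arbitrary representative, meaningful only when \<open>h\<close> is
  constant on the coset; each use has to supply this.\<close>

definition quot_lift :: "('a \<Rightarrow> 'b) \<Rightarrow> 'a set \<Rightarrow> 'b"
  where "quot_lift h C = h (SOME x. x \<in> C)"

lemma (in complex_algebra) quot_lift_class:
  assumes "ideal I A" "x \<in> carrier A"
    and "\<And>y. y \<in> carrier A \<Longrightarrow> y \<ominus> x \<in> I \<Longrightarrow> h y = h x"
  shows "quot_lift h (I +> x) = h x"
proof -
  interpret ideal I A by fact
  have "x \<in> I +> x"
    using assms(2) a_rcos_self by blast
  then have y: "(SOME y. y \<in> I +> x) \<in> I +> x"
    by (rule someI)
  then have "(SOME y. y \<in> I +> x) \<in> carrier A"
    using assms(2) a_elemrcos_carrier by blast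
  with y have "(SOME y. y \<in> I +> x) \<ominus> x \<in> I"
    using assms(2) a_rcos_module_minus ring_axioms by blast
  with \<open>(SOME y. y \<in> I +> x) \<in> carrier A\<close> show ?thesis
    unfolding quot_lift_def by (rule assms(3))
qed

lemma (in complex_algebra) linear_form_quot_lift:
  assumes I: "ideal I A" and f: "f \<in> linear_forms A" and 0: "\<And>x. x \<in> I \<Longrightarrow> f x = 0"
  shows "x \<in> carrier A \<Longrightarrow> quot_lift f (I +> x) = f x"
    and "quot_lift f \<in> linear_forms (quot_alg A I)"
proof -
  have *: "quot_lift f (I +> x) = f x" if "x \<in> carrier A" for x
  proof (rule quot_lift_class[OF I that])
    fix y assume y: "y \<in> carrier A" "y \<ominus> x \<in> I"
    have "f y - f x = 0"
      using linear_forms_diff[OF f y(1) that] 0[OF y(2)] by simp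
    then show "f y = f x" by simp
  qed
  then show "x \<in> carrier A \<Longrightarrow> quot_lift f (I +> x) = f x" .
  show "quot_lift f \<in> linear_forms (quot_alg A I)"
    using f by (auto simp: linear_forms_def quot_alg_carrier quot_alg_ops[OF I] quot_alg_smult[OF I] *)
qed

lemma (in complex_algebra) alg_hom_quot_lift:
  assumes I: "ideal I A" and B: "complex_algebra B" and h: "h \<in> alg_hom A B"
    and 0: "\<And>x. x \<in> I \<Longrightarrow> h x = \<zero>\<^bsub>B\<^esub>"
  shows "x \<in> carrier A \<Longrightarrow> quot_lift h (I +> x) = h x"
    and "quot_lift h \<in> alg_hom (quot_alg A I) B"
proof -
  interpret B: complex_algebra B by fact
  interpret I: ideal I A by fact
  have *: "quot_lift h (I +> x) = h x" if x: "x \<in> carrier A" for x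
  proof (rule quot_lift_class[OF I that])
    fix y assume y: "y \<in> carrier A" "y \<ominus> x \<in> I"
    have "y = (y \<ominus> x) \<oplus> x"
      using x y(1) by algebra
    then have "h y = h (y \<ominus> x) \<oplus>\<^bsub>B\<^esub> h x"
      using alg_homD(3)[OF h, of "y \<ominus> x" x] x y by simp
    then show "h y = h x"
      using 0[OF y(2)] alg_homD(1)[OF h x] by simp
  qed
  then show "x \<in> carrier A \<Longrightarrow> quot_lift h (I +> x) = h x" .
  show "quot_lift h \<in> alg_hom (quot_alg A I) B"
    using alg_homD[OF h]
    by (auto simp: alg_hom_def ring_hom_def quot_alg_carrier quot_alg_ops[OF I]
        quot_alg_smult[OF I] quot_alg_one *)
qed

lemma linear_forms_monoid_alg: "lin f \<in> linear_forms (monoid_alg M)"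
  by (simp add: linear_forms_def)

text \<open>The ideal is a linear subspace, so a point outside it is detected by some
  \<open>lin f\<close> that kills the ideal, and this form descends to the quotient.\<close>

lemma quot_monoid_alg_separated:
  assumes "monoid M" and I: "ideal I (monoid_alg M)"
  shows "separated (quot_alg (monoid_alg M) I)"
  unfolding separated_def
proof (intro ballI impI)
  interpret M: complex_algebra "monoid_alg M"
    using assms(1) by (rule monoid_alg_complex_algebra)
  interpret I: ideal I "monoid_alg M" by fact
  let ?Q = "quot_alg (monoid_alg M) I"
  have "pm.subspace I"
    unfolding pm.subspace_def
    using I.zero_closed I.a_closed M.ideal_smult_closed[OF I] by simp
  fix z
  assume z: "z \<in> carrier ?Q" and forms: "\<forall>f \<in> linear_forms ?Q. f z = 0"
  then obtain x where x: "x \<in> carrier (monoid_alg M)" and zx: "z = I +>\<^bsub>monoid_alg M\<^esub> x"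
    by (auto simp: M.quot_alg_carrier)
  have "x \<in> I"
  proof (rule ccontr)
    assume "x \<notin> I"
    then obtain f where f: "\<And>w. w \<in> I \<Longrightarrow> lin f w = 0" "lin f x \<noteq> 0"
      using pm_subspace_separation[OF \<open>pm.subspace I\<close>] by blast
    show False
      using M.linear_form_quot_lift[OF I linear_forms_monoid_alg[of f]] f x forms zx by auto
  qed
  then have "x \<ominus>\<^bsub>monoid_alg M\<^esub> \<zero>\<^bsub>monoid_alg M\<^esub> \<in> I"
    using x by (simp add: M.minus_eq del: monoid_alg_simps)
  then show "z = \<zero>\<^bsub>?Q\<^esub>"
    unfolding M.quot_alg_zero[OF I] zx by (subst M.coset_eq_iff[OF I x]) auto
qed

section \<open>Coproducts and pairings of words\<close>

text \<open>
  With the coproduct of every letter given as a list of pairs of words, \<open>coprod_sum d w F\<close> is the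
  Sweedler sum \<open>\<Sum> F w\<^sub>1 w\<^sub>2\<close> over the multiplicative extension of the coproduct to the word \<open>w\<close>.
\<close>

primrec coprod_sum ::
  "('x \<Rightarrow> ('x list \<times> 'x list) list) \<Rightarrow> 'x list \<Rightarrow> ('x list \<Rightarrow> 'x list \<Rightarrow> complex) \<Rightarrow> complex"
  where
    "coprod_sum d [] F = F [] []"
  | "coprod_sum d (x # w) F = (\<Sum>p\<leftarrow>d x. coprod_sum d w (\<lambda>a b. F (fst p @ a) (snd p @ b)))"

lemma sum_list_swap:
  "(\<Sum>p\<leftarrow>xs. \<Sum>q\<leftarrow>ys. f p q) = (\<Sum>q\<leftarrow>ys. \<Sum>p\<leftarrow>xs. f p q :: complex)"
  by (induction xs) (auto simp: sum_list_addf)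

lemma coprod_sum_append: "coprod_sum d (u @ w) F = coprod_sum d u (\<lambda>a b. coprod_sum d w (\<lambda>a' b'. F (a @ a') (b @ b')))"
  by (induction u arbitrary: F) auto

lemma coprod_sum_sum_list: "coprod_sum d w (\<lambda>a b. \<Sum>p\<leftarrow>xs. F p a b) = (\<Sum>p\<leftarrow>xs. coprod_sum d w (F p))"
proof (induction w arbitrary: F)
  case (Cons x w)
  show ?case
    by (simp add: Cons.IH sum_list_swap[of _ "d x"])
qed simp

lemma coprod_sum_mult: "coprod_sum d w (\<lambda>a b. c * F a b) = c * coprod_sum d w F"
  by (induction w arbitrary: F) (auto simp: sum_list_const_mult)

lemma coprod_sum_mult_right: "coprod_sum d w (\<lambda>a b. F a b * c) = coprod_sum d w F * c"
  using coprod_sum_mult[of d w c F] by (simp add: mult.commute)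

lemma coprod_sum_swap:
  "coprod_sum d w (\<lambda>a b. coprod_sum e v (F a b)) = coprod_sum e v (\<lambda>a' b'. coprod_sum d w (\<lambda>a b. F a b a' b'))"
  by (induction w arbitrary: F) (simp_all add: coprod_sum_sum_list)

lemma lin_coprod_sum: "lin (\<lambda>k. coprod_sum d w (F k)) p = coprod_sum d w (\<lambda>a b. lin (\<lambda>k. F k a b) p)"
proof (induction w arbitrary: F)
  case (Cons x w)
  have "lin (\<lambda>k. \<Sum>q\<leftarrow>xs. G k q) p = (\<Sum>q\<leftarrow>xs. lin (\<lambda>k. G k q) p)"
    for G :: "'a \<Rightarrow> 'b list \<times> 'b list \<Rightarrow> complex" and xs
    by (induction xs) (auto simp: lin_add_fun)
  then show ?case
    by (simp add: Cons.IH)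
qed simp

definition coassociative :: "('x \<Rightarrow> ('x list \<times> 'x list) list) \<Rightarrow> bool"
  where "coassociative d \<longleftrightarrow> (\<forall>x F.
    (\<Sum>p\<leftarrow>d x. coprod_sum d (fst p) (\<lambda>a b. F a b (snd p))) =
    (\<Sum>p\<leftarrow>d x. coprod_sum d (snd p) (F (fst p))))"

text \<open>The coproduct is multiplicative, so the sums over the first letter and over the rest
  commute; the induction hypothesis and coassociativity on the letter then act
  independently.\<close>

lemma coprod_sum_coassoc:
  assumes "coassociative d"
  shows "coprod_sum d w (\<lambda>a b. coprod_sum d a (\<lambda>a' a''. F a' a'' b)) = coprod_sum d w (\<lambda>a b. coprod_sum d b (F a))"
proof (induction w arbitrary: F)
  case (Cons x w)
  have letter: "(\<Sum>p\<leftarrow>d x. coprod_sum d (fst p) (\<lambda>a b. G a b (snd p))) =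
      (\<Sum>p\<leftarrow>d x. coprod_sum d (snd p) (G (fst p)))" for G
    using assms by (simp add: coassociative_def)
  have "coprod_sum d (x # w) (\<lambda>a b. coprod_sum d a (\<lambda>a' a''. F a' a'' b)) =
      (\<Sum>p\<leftarrow>d x. coprod_sum d (fst p) (\<lambda>a' a''. coprod_sum d w (\<lambda>a b.
        coprod_sum d a (\<lambda>c' c''. F (a' @ c') (a'' @ c'') (snd p @ b)))))"
    by (simp add: coprod_sum_append coprod_sum_swap[of d w])
  also have "\<dots> = (\<Sum>p\<leftarrow>d x. coprod_sum d (fst p) (\<lambda>a' a''. coprod_sum d w (\<lambda>a b.
        coprod_sum d b (\<lambda>c' c''. F (a' @ a) (a'' @ c') (snd p @ c'')))))"
    by (simp add: Cons.IH)
  also have "\<dots> = (\<Sum>p\<leftarrow>d x. coprod_sum d (snd p) (\<lambda>b' b''. coprod_sum d w (\<lambda>a b.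
        coprod_sum d b (\<lambda>c' c''. F (fst p @ a) (b' @ c') (b'' @ c'')))))"
    by (rule letter[of "\<lambda>a' a'' s. coprod_sum d w (\<lambda>a b. coprod_sum d b (\<lambda>c' c''. F (a' @ a) (a'' @ c') (s @ c'')))"])
  also have "\<dots> = coprod_sum d (x # w) (\<lambda>a b. coprod_sum d b (F a))"
    by (simp add: coprod_sum_append coprod_sum_swap[of d w])
  finally show ?case .
qed simp

abbreviation eps_word :: "('x \<Rightarrow> complex) \<Rightarrow> 'x list \<Rightarrow> complex"
  where "eps_word \<epsilon> w \<equiv> prod_list (map \<epsilon> w)"

definition counital :: "('x \<Rightarrow> ('x list \<times> 'x list) list) \<Rightarrow> ('x \<Rightarrow> complex) \<Rightarrow> bool"
  where "counital d \<epsilon> \<longleftrightarrow> (\<forall>x f.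
    (\<Sum>p\<leftarrow>d x. eps_word \<epsilon> (fst p) * f (snd p)) = f [x] \<and>
    (\<Sum>p\<leftarrow>d x. f (fst p) * eps_word \<epsilon> (snd p)) = f [x])"

lemma coprod_sum_counit_left:
  assumes "counital d \<epsilon>"
  shows "coprod_sum d w (\<lambda>a b. eps_word \<epsilon> a * f b) = f w"
proof (induction w arbitrary: f)
  case (Cons x w)
  have letter: "(\<Sum>p\<leftarrow>d x. eps_word \<epsilon> (fst p) * g (snd p)) = g [x]" for g
    using assms by (simp add: counital_def)
  have "coprod_sum d (x # w) (\<lambda>a b. eps_word \<epsilon> a * f b)
      = (\<Sum>p\<leftarrow>d x. eps_word \<epsilon> (fst p) * coprod_sum d w (\<lambda>a b. eps_word \<epsilon> a * f (snd p @ b)))"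
    by (simp add: mult.assoc coprod_sum_mult)
  also have "\<dots> = (\<Sum>p\<leftarrow>d x. eps_word \<epsilon> (fst p) * f (snd p @ w))"
    by (simp only: Cons.IH)
  also have "\<dots> = f (x # w)"
    using letter[of "\<lambda>a. f (a @ w)"] by simp
  finally show ?case .
qed simp

lemma coprod_sum_counit_right:
  assumes "counital d \<epsilon>"
  shows "coprod_sum d w (\<lambda>a b. f a * eps_word \<epsilon> b) = f w"
proof (induction w arbitrary: f)
  case (Cons x w)
  have letter: "(\<Sum>p\<leftarrow>d x. g (fst p) * eps_word \<epsilon> (snd p)) = g [x]" for g
    using assms by (simp add: counital_def)
  have "coprod_sum d (x # w) (\<lambda>a b. f a * eps_word \<epsilon> b)
      = (\<Sum>p\<leftarrow>d x. coprod_sum d w (\<lambda>a b. f (fst p @ a) * eps_word \<epsilon> b) * eps_word \<epsilon> (snd p))"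
    unfolding coprod_sum_mult_right[symmetric] by (simp add: mult_ac)
  also have "\<dots> = (\<Sum>p\<leftarrow>d x. f (fst p @ w) * eps_word \<epsilon> (snd p))"
    by (simp only: Cons.IH)
  also have "\<dots> = f (x # w)"
    using letter[of "\<lambda>a. f (a @ w)"] by simp
  finally show ?case .
qed simp

lemmas coprod_sum_counit = coprod_sum_counit_left coprod_sum_counit_right

text \<open>The words of length at most one span a subcoalgebra. This is what makes it sufficient to
  test relations against such words.\<close>

definition short :: "('x \<Rightarrow> ('x list \<times> 'x list) list) \<Rightarrow> bool"
  where "short d \<longleftrightarrow> (\<forall>x. \<forall>p \<in> set (d x). length (fst p) \<le> 1 \<and> length (snd p) \<le> 1)"

lemma length_le_1_cases: "length c \<le> 1 \<Longrightarrow> c = [] \<or> (\<exists>t. c = [t])"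
  by (cases c) auto

text \<open>
  Only the values of \<open>tab x v\<close> for words \<open>v\<close> of length at most one are meaningful; on longer words it is
  arbitrary.
\<close>

locale word_pairing =
  fixes dU :: "'x \<Rightarrow> ('x list \<times> 'x list) list" and \<epsilon>U :: "'x \<Rightarrow> complex"
    and dH :: "'y \<Rightarrow> ('y list \<times> 'y list) list" and \<epsilon>H :: "'y \<Rightarrow> complex"
    and tab :: "'x \<Rightarrow> 'y list \<Rightarrow> complex"
  assumes coassocU: "coassociative dU" and coassocH: "coassociative dH"
    and counitU: "counital dU \<epsilon>U" and counitH: "counital dH \<epsilon>H"
    and shortH: "short dH"
    and tab_Nil: "tab x [] = \<epsilon>U x"
begin

text \<open>Matrix coefficients of a product of generators: when \<open>e\<close> is a letter
  standing for the entry (i, j) of a matrix whose coproduct is matrix multiplication, the recursion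
  computes the (i, j) entry of the product of the matrices of the letters.\<close>

primrec mcoeff :: "'x list \<Rightarrow> 'y list \<Rightarrow> complex"
  where
    "mcoeff [] e = eps_word \<epsilon>H e"
  | "mcoeff (x # w) e = coprod_sum dH e (\<lambda>a b. tab x a * mcoeff w b)"

text \<open>Multiplicativity in the first argument is built into the recursion, up to
  coassociativity; multiplicativity in the second has to be derived in
  \<open>pair_append_left\<close>.\<close>

primrec pair :: "'y list \<Rightarrow> 'x list \<Rightarrow> complex"
  where
    "pair [] w = eps_word \<epsilon>U w"
  | "pair (t # v) w = coprod_sum dU w (\<lambda>a b. mcoeff a [t] * pair v b)"

lemma mcoeff_append: "mcoeff (w @ w') e = coprod_sum dH e (\<lambda>a b. mcoeff w a * mcoeff w' b)"
proof (induction w arbitrary: e)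
  case Nil
  show ?case by (simp add: coprod_sum_counit[OF counitH])
next
  case (Cons x w)
  have "mcoeff ((x # w) @ w') e
      = coprod_sum dH e (\<lambda>a b. coprod_sum dH b (\<lambda>b' b''. tab x a * (mcoeff w b' * mcoeff w' b'')))"
    by (simp add: Cons.IH coprod_sum_mult)
  also have "\<dots> = coprod_sum dH e (\<lambda>a b. coprod_sum dH a (\<lambda>a' a''. tab x a' * (mcoeff w a'' * mcoeff w' b)))"
    by (rule coprod_sum_coassoc[OF coassocH, symmetric])
  also have "\<dots> = coprod_sum dH e (\<lambda>a b. mcoeff (x # w) a * mcoeff w' b)"
    by (simp add: mult.assoc[symmetric] coprod_sum_mult_right)
  finally show ?case .
qed

lemma mcoeff_Nil: "mcoeff w [] = eps_word \<epsilon>U w"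
  by (induction w) (auto simp: tab_Nil)

lemma pair_single: "pair [t] w = mcoeff w [t]"
  by (simp add: coprod_sum_counit[OF counitU])

lemma pair_short: "length c \<le> 1 \<Longrightarrow> pair c w = mcoeff w c"
  using length_le_1_cases[of c] pair_single mcoeff_Nil by auto

lemma pair_append_right: "pair (v @ v') w = coprod_sum dU w (\<lambda>a b. pair v a * pair v' b)"
proof (induction v arbitrary: w)
  case Nil
  show ?case by (simp add: coprod_sum_counit[OF counitU])
next
  case (Cons t v)
  have "pair ((t # v) @ v') w
      = coprod_sum dU w (\<lambda>a b. coprod_sum dU b (\<lambda>b' b''. mcoeff a [t] * (pair v b' * pair v' b'')))"
    by (simp add: Cons.IH coprod_sum_mult del: mcoeff.simps)
  also have "\<dots> = coprod_sum dU w (\<lambda>a b. coprod_sum dU a (\<lambda>a' a''. mcoeff a' [t] * (pair v a'' * pair v' b)))"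
    by (rule coprod_sum_coassoc[OF coassocU, symmetric])
  also have "\<dots> = coprod_sum dU w (\<lambda>a b. pair (t # v) a * pair v' b)"
    by (simp add: mult.assoc[symmetric] coprod_sum_mult_right del: mcoeff.simps)
  finally show ?case .
qed

text \<open>Once the first letter \<open>t\<close> is split off, the legs of \<open>dH t\<close> are
  evaluated by \<open>mcoeff\<close>, while the claim asks for \<open>pair\<close>. The two agree on
  words of length at most one, which is where \<open>shortH\<close> is used.\<close>

lemma pair_append_left: "pair v (w @ w') = coprod_sum dH v (\<lambda>a b. pair a w * pair b w')"
proof (induction v arbitrary: w w')
  case Nil
  show ?case by simp
next
  case (Cons t v)
  have "pair (t # v) (w @ w') = coprod_sum dU w (\<lambda>a b. coprod_sum dU w' (\<lambda>a' b'.
      (\<Sum>p\<leftarrow>dH t. mcoeff a (fst p) * mcoeff a' (snd p)) * coprod_sum dH v (\<lambda>c c'. pair c b * pair c' b')))"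
    by (simp add: coprod_sum_append mcoeff_append Cons.IH del: mcoeff.simps)
  also have "\<dots> = (\<Sum>p\<leftarrow>dH t. coprod_sum dU w (\<lambda>a b. coprod_sum dU w' (\<lambda>a' b'.
      coprod_sum dH v (\<lambda>c c'. (mcoeff a (fst p) * pair c b) * (mcoeff a' (snd p) * pair c' b')))))"
    unfolding coprod_sum_sum_list[symmetric] coprod_sum_mult[symmetric] sum_list_mult_const[symmetric]
    by (simp only: mult_ac)
  also have "\<dots> = (\<Sum>p\<leftarrow>dH t. coprod_sum dH v (\<lambda>c c'.
      coprod_sum dU w (\<lambda>a b. mcoeff a (fst p) * pair c b) * coprod_sum dU w' (\<lambda>a' b'. mcoeff a' (snd p) * pair c' b')))"
    by (simp add: coprod_sum_swap[of dU _ dH] coprod_sum_mult coprod_sum_mult_right del: mcoeff.simps)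
  also have "\<dots> = (\<Sum>p\<leftarrow>dH t. coprod_sum dH v (\<lambda>c c'. pair (fst p @ c) w * pair (snd p @ c') w'))"
  proof (intro arg_cong[where f = sum_list] map_cong refl)
    fix p assume "p \<in> set (dH t)"
    then have "length (fst p) \<le> 1" "length (snd p) \<le> 1"
      using shortH by (auto simp: short_def)
    then show "coprod_sum dH v (\<lambda>c c'. coprod_sum dU w (\<lambda>a b. mcoeff a (fst p) * pair c b) *
          coprod_sum dU w' (\<lambda>a' b'. mcoeff a' (snd p) * pair c' b')) =
        coprod_sum dH v (\<lambda>c c'. pair (fst p @ c) w * pair (snd p @ c') w')"
      by (simp add: pair_append_right pair_short del: mcoeff.simps)
  qed
  finally show ?case by simp
qed

lemma pair_Nil_right: "pair v [] = eps_word \<epsilon>H v"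
  by (induction v) (auto simp del: mcoeff.simps(2))

lemma pair_letters: "pair [t] [x] = tab x [t]"
proof -
  have "pair [t] [x] = coprod_sum dH [t] (\<lambda>a b. tab x a * eps_word \<epsilon>H b)"
    unfolding pair_single by simp
  then show ?thesis
    by (simp only: coprod_sum_counit[OF counitH])
qed

end

text \<open>
  \<open>anti_sum s w f\<close> is the linear extension of \<open>f\<close> applied to \<open>S w\<close>, where \<open>S\<close> is the
  antimultiplicative map given on letters by \<open>s\<close>.
\<close>

primrec anti_sum :: "('x \<Rightarrow> (complex \<times> 'x list) list) \<Rightarrow> 'x list \<Rightarrow> ('x list \<Rightarrow> complex) \<Rightarrow> complex"
  where
    "anti_sum s [] f = f []"
  | "anti_sum s (x # w) f = (\<Sum>q\<leftarrow>s x. fst q * anti_sum s w (\<lambda>z. f (z @ snd q)))"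

lemma anti_sum_append: "anti_sum s (u @ w) f = anti_sum s u (\<lambda>y. anti_sum s w (\<lambda>z. f (z @ y)))"
  by (induction u arbitrary: f) auto

lemma anti_sum_sum_list: "anti_sum s w (\<lambda>z. \<Sum>p\<leftarrow>xs. F p z) = (\<Sum>p\<leftarrow>xs. anti_sum s w (F p))"
proof (induction w arbitrary: F)
  case (Cons x w)
  show ?case
    by (simp add: Cons.IH sum_list_const_mult[symmetric] sum_list_swap[of _ "s x"])
qed simp

lemma anti_sum_mult: "anti_sum s w (\<lambda>z. c * f z) = c * anti_sum s w f"
  by (induction w arbitrary: f) (auto simp: sum_list_const_mult[symmetric] mult_ac)

lemma anti_sum_mult_right: "anti_sum s w (\<lambda>z. f z * c) = anti_sum s w f * c"
  using anti_sum_mult[of s w c f] by (simp add: mult.commute)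

lemma anti_sum_coprod_sum: "anti_sum s v (\<lambda>z. coprod_sum d w (F z)) = coprod_sum d w (\<lambda>a b. anti_sum s v (\<lambda>z. F z a b))"
  by (induction w arbitrary: F) (simp_all add: anti_sum_sum_list)

lemma anti_sum_swap: "anti_sum s u (\<lambda>y. anti_sum s' w (F y)) = anti_sum s' w (\<lambda>z. anti_sum s u (\<lambda>y. F y z))"
  by (induction w arbitrary: F) (simp_all add: anti_sum_sum_list anti_sum_mult)

text \<open>The rule that an antipode reverses the coproduct, imposed on letters. Since
  \<open>F\<close> is arbitrary, it is an exact identity between formal combinations of pairs of
  words, with no relations available.\<close>

definition anti_comult where
  "anti_comult s d \<longleftrightarrow> (\<forall>x F. (\<Sum>q\<leftarrow>s x. fst q * coprod_sum d (snd q) F) =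
    (\<Sum>p\<leftarrow>d x. anti_sum s (fst p) (\<lambda>y. anti_sum s (snd p) (\<lambda>z. F z y))))"

lemma anti_sum_anti_comult:
  assumes "anti_comult s d"
  shows "anti_sum s w (\<lambda>z. coprod_sum d z F) = coprod_sum d w (\<lambda>a b. anti_sum s a (\<lambda>y. anti_sum s b (\<lambda>z. F z y)))"
proof (induction w arbitrary: F)
  case (Cons x w)
  have letter: "(\<Sum>q\<leftarrow>s x. fst q * coprod_sum d (snd q) G) =
      (\<Sum>p\<leftarrow>d x. anti_sum s (fst p) (\<lambda>y. anti_sum s (snd p) (\<lambda>z. G z y)))" for G
    using assms by (simp add: anti_comult_def)
  have "anti_sum s (x # w) (\<lambda>z. coprod_sum d z F) = (\<Sum>q\<leftarrow>s x. fst q * coprod_sum d w (\<lambda>a b.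
      anti_sum s a (\<lambda>y. anti_sum s b (\<lambda>z. coprod_sum d (snd q) (\<lambda>a' b'. F (z @ a') (y @ b'))))))"
    by (simp add: coprod_sum_append Cons.IH)
  also have "\<dots> = coprod_sum d w (\<lambda>a b. anti_sum s a (\<lambda>y. anti_sum s b (\<lambda>z.
      \<Sum>q\<leftarrow>s x. fst q * coprod_sum d (snd q) (\<lambda>a' b'. F (z @ a') (y @ b')))))"
    by (simp add: coprod_sum_sum_list anti_sum_sum_list coprod_sum_mult anti_sum_mult)
  also have "\<dots> = coprod_sum d w (\<lambda>a b. anti_sum s a (\<lambda>y. anti_sum s b (\<lambda>z.
      \<Sum>p\<leftarrow>d x. anti_sum s (fst p) (\<lambda>y'. anti_sum s (snd p) (\<lambda>z'. F (z @ z') (y @ y'))))))"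
    unfolding letter ..
  also have "\<dots> = (\<Sum>p\<leftarrow>d x. coprod_sum d w (\<lambda>a b. anti_sum s a (\<lambda>y. anti_sum s b (\<lambda>z.
      anti_sum s (fst p) (\<lambda>y'. anti_sum s (snd p) (\<lambda>z'. F (z @ z') (y @ y')))))))"
    by (simp add: coprod_sum_sum_list anti_sum_sum_list)
  \<comment> \<open>The four nested sums are independent; they are brought into the order that
    \<open>anti_sum_append\<close> produces for \<open>fst p @ a\<close> and
    \<open>snd p @ b\<close>.\<close>
  also have "\<dots> = (\<Sum>p\<leftarrow>d x. coprod_sum d w (\<lambda>a b. anti_sum s (fst p) (\<lambda>y'. anti_sum s a (\<lambda>y.
      anti_sum s (snd p) (\<lambda>z'. anti_sum s b (\<lambda>z. F (z @ z') (y @ y')))))))"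
  proof (intro arg_cong[where f = sum_list] map_cong refl arg_cong[where f = "coprod_sum d w"] ext)
    fix p a b
    have "anti_sum s b (\<lambda>z. anti_sum s (fst p) (\<lambda>y'. anti_sum s (snd p) (\<lambda>z'. F (z @ z') (y @ y')))) =
        anti_sum s (fst p) (\<lambda>y'. anti_sum s (snd p) (\<lambda>z'. anti_sum s b (\<lambda>z. F (z @ z') (y @ y'))))" for y
      by (subst anti_sum_swap, rule arg_cong[where f = "anti_sum s _"], rule ext, rule anti_sum_swap)
    note eq = this
    show "anti_sum s a (\<lambda>y. anti_sum s b (\<lambda>z. anti_sum s (fst p) (\<lambda>y'. anti_sum s (snd p) (\<lambda>z'. F (z @ z') (y @ y'))))) =
        anti_sum s (fst p) (\<lambda>y'. anti_sum s a (\<lambda>y. anti_sum s (snd p) (\<lambda>z'. anti_sum s b (\<lambda>z. F (z @ z') (y @ y')))))"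
      by (rule trans[OF arg_cong[where f = "anti_sum s a"] anti_sum_swap]) (rule ext, rule eq)
  qed
  also have "\<dots> = coprod_sum d (x # w) (\<lambda>a b. anti_sum s a (\<lambda>y. anti_sum s b (\<lambda>z. F z y)))"
    by (simp add: anti_sum_append)
  finally show ?case .
qed simp

section \<open>Algebras given by generators and relations\<close>

lemma (in complex_algebra) idealI_smult:
  assumes "I \<subseteq> carrier A" "\<zero> \<in> I" "\<And>x y. x \<in> I \<Longrightarrow> y \<in> I \<Longrightarrow> x \<oplus> y \<in> I"
    and smult: "\<And>c x. x \<in> I \<Longrightarrow> c \<odot> x \<in> I"
    and "\<And>x y. x \<in> I \<Longrightarrow> y \<in> carrier A \<Longrightarrow> y \<otimes> x \<in> I"
    and "\<And>x y. x \<in> I \<Longrightarrow> y \<in> carrier A \<Longrightarrow> x \<otimes> y \<in> I"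
  shows "ideal I A"
proof (rule idealI)
  show "subgroup I (add_monoid A)"
  proof (rule add.subgroupI)
    fix x assume "x \<in> I"
    then show "\<ominus> x \<in> I"
      using assms(1) smult[of x "- 1"] minus_one_smult[of x] by auto
  qed (use assms in auto)
qed (use assms ring_axioms in auto)

lemma free_monoid: "monoid \<lparr>carrier = UNIV, monoid.mult = (@), monoid.one = []\<rparr>"
  by (rule monoidI) auto

interpretation free: complex_algebra "free_alg :: (complex, 'x list \<Rightarrow>\<^sub>0 complex) module"
  unfolding free_alg_def by (rule monoid_alg_complex_algebra[OF free_monoid])

lemma free_alg_simps [simp]:
  "carrier free_alg = UNIV"
  "\<one>\<^bsub>free_alg\<^esub> = word []"
  "\<zero>\<^bsub>free_alg\<^esub> = 0"
  "p \<oplus>\<^bsub>free_alg\<^esub> q = p + q"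
  "c \<odot>\<^bsub>free_alg\<^esub> p = pm_scale c p"
  by (simp_all add: free_alg_def)

lemma free_alg_mult_single [simp]:
  "Poly_Mapping.single u c \<otimes>\<^bsub>free_alg\<^esub> Poly_Mapping.single v d = Poly_Mapping.single (u @ v) (c * d)"
  by (simp add: free_alg_def)

lemma lin_free_alg_mult [simp]:
  "lin f (p \<otimes>\<^bsub>free_alg\<^esub> q) = lin (\<lambda>u. lin (\<lambda>v. f (u @ v)) q) p"
  by (simp add: free_alg_def)

lemma pm_scale_single [simp]:
  "pm_scale c (Poly_Mapping.single k d) = Poly_Mapping.single k (c * d)"
  by (rule pm_eqI) simp

text \<open>
  The functions on words that descend to linear forms on the algebra presented by \<open>R\<close>.
\<close>

definition annihilates :: "('x list \<Rightarrow>\<^sub>0 complex) set \<Rightarrow> ('x list \<Rightarrow> complex) \<Rightarrow> bool"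
  where "annihilates R f \<longleftrightarrow> (\<forall>r \<in> R. \<forall>u v. lin (\<lambda>w. f (u @ w @ v)) r = 0)"

abbreviation wclass :: "('x list \<Rightarrow>\<^sub>0 complex) set \<Rightarrow> 'x list \<Rightarrow> ('x list \<Rightarrow>\<^sub>0 complex) set"
  where "wclass R w \<equiv> (Idl\<^bsub>free_alg\<^esub> R) +>\<^bsub>free_alg\<^esub> word w"

lemma generator_eq_wclass: "generator R x = wclass R [x]"
  by (simp add: generator_def)

lemma ideal_relations: "ideal (Idl\<^bsub>free_alg\<^esub> R) free_alg"
  by (rule free.genideal_ideal) simp

lemma presented_alg_complex_algebra: "complex_algebra (presented_alg R)"
  unfolding presented_alg_def by (rule free.quot_alg_complex_algebra[OF ideal_relations])

lemma presented_alg_separated: "separated (presented_alg R)"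
  using quot_monoid_alg_separated[OF free_monoid] ideal_relations
  unfolding presented_alg_def free_alg_def by blast

lemma wclass_closed [simp]: "wclass R w \<in> carrier (presented_alg R)"
  by (simp add: presented_alg_def free.quot_alg_carrier)

lemma wclass_mult: "wclass R u \<otimes>\<^bsub>presented_alg R\<^esub> wclass R v = wclass R (u @ v)"
  by (simp add: presented_alg_def free.quot_alg_ops[OF ideal_relations])

lemma wclass_Nil: "wclass R [] = \<one>\<^bsub>presented_alg R\<^esub>"
  by (simp add: presented_alg_def free.quot_alg_one)

section \<open>Linear forms on a presented algebra as functions on words\<close>

lemma linear_form_class:
  assumes "f \<in> linear_forms (presented_alg R)"
  shows "f ((Idl\<^bsub>free_alg\<^esub> R) +>\<^bsub>free_alg\<^esub> p) = lin (\<lambda>w. f (wclass R w)) p"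
proof -
  have f: "(\<lambda>p. f ((Idl\<^bsub>free_alg\<^esub> R) +>\<^bsub>free_alg\<^esub> p)) \<in> linear_forms free_alg"
    using linear_forms_alg_hom[OF free.quot_alg_class_hom[OF ideal_relations]] assms
    unfolding presented_alg_def by blast
  show ?thesis
  proof (induction p rule: pm_single_induct)
    case zero
    show ?case using free.linear_forms_zero[OF f] by simp
  next
    case (add k c q)
    then show ?case
      using linear_forms_add[OF f, of "Poly_Mapping.single k c" q]
        linear_forms_smult[OF f, of "word k" c]
      by simp
  qed
qed

lemma presented_alg_carrierE:
  assumes "x \<in> carrier (presented_alg R)"
  obtains p where "x = (Idl\<^bsub>free_alg\<^esub> R) +>\<^bsub>free_alg\<^esub> p"
  using assms by (auto simp: presented_alg_def free.quot_alg_carrier)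

lemma linear_form_eqI:
  assumes "f \<in> linear_forms (presented_alg R)" "g \<in> linear_forms (presented_alg R)"
    and "\<And>w. f (wclass R w) = g (wclass R w)" and "x \<in> carrier (presented_alg R)"
  shows "f x = g x"
proof -
  obtain p where "x = (Idl\<^bsub>free_alg\<^esub> R) +>\<^bsub>free_alg\<^esub> p"
    using assms(4) by (rule presented_alg_carrierE)
  then show ?thesis
    using linear_form_class[OF assms(1), of p] linear_form_class[OF assms(2), of p] assms(3)
    by simp
qed

text \<open>For \<open>r\<close> in \<open>R\<close> the product of \<open>word u\<close>,
  \<open>r\<close> and \<open>word v\<close> lies in the ideal, so its class is zero. Together with
  \<open>form_of_linear\<close> this identifies the linear forms with the annihilating
  functions.\<close>

lemma linear_form_annihilates:
  assumes f: "f \<in> linear_forms (presented_alg R)"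
  shows "annihilates R (\<lambda>w. f (wclass R w))"
  unfolding annihilates_def
proof (intro ballI allI)
  interpret P: complex_algebra "presented_alg R" by (rule presented_alg_complex_algebra)
  interpret I: ideal "Idl\<^bsub>free_alg\<^esub> R" free_alg by (rule ideal_relations)
  fix r u v
  assume "r \<in> R"
  then have "r \<in> Idl\<^bsub>free_alg\<^esub> R"
    using free.genideal_self[of R] by auto
  then have "word u \<otimes>\<^bsub>free_alg\<^esub> r \<otimes>\<^bsub>free_alg\<^esub> word v \<in> Idl\<^bsub>free_alg\<^esub> R" (is "?x \<in> _")
    using I.I_l_closed I.I_r_closed by simp
  then have "(Idl\<^bsub>free_alg\<^esub> R) +>\<^bsub>free_alg\<^esub> ?x = \<zero>\<^bsub>presented_alg R\<^esub>"
    using free.coset_eq_iff[OF ideal_relations, of ?x 0 R]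
    by (simp add: presented_alg_def free.quot_alg_zero[OF ideal_relations] free.minus_eq
        free.minus_zero[simplified])
  then show "lin (\<lambda>w. f (wclass R (u @ w @ v))) r = 0"
    using linear_form_class[OF f, of ?x] P.linear_forms_zero[OF f] by simp
qed

text \<open>The combinations killed in all contexts form a two-sided ideal containing
  \<open>R\<close>; the contexts in \<open>annihilates\<close> are what makes this set an
  ideal.\<close>

lemma annihilates_ideal:
  assumes "annihilates R f" "x \<in> Idl\<^bsub>free_alg\<^esub> R"
  shows "lin f x = 0"
proof -
  let ?I = "{x. \<forall>u v. lin (\<lambda>w. f (u @ w @ v)) x = 0}"
  have "ideal ?I free_alg"
  proof (rule free.idealI_smult)
    fix x y assume "x \<in> ?I"
    then have 0: "lin (\<lambda>w. f (u @ w @ v)) x = 0" for u v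
      by blast
    have "lin (\<lambda>a. lin (\<lambda>b. f (u @ (a @ b) @ v)) x) y = 0" for u v
      using 0[of "u @ _" v] by (simp add: lin_def[of _ y])
    then show "y \<otimes>\<^bsub>free_alg\<^esub> x \<in> ?I" by simp
    have "lin (\<lambda>b. lin (\<lambda>a. f (u @ (a @ b) @ v)) x) y = 0" for u v
      using 0[of u "_ @ v"] by (simp add: lin_def[of _ y])
    then show "x \<otimes>\<^bsub>free_alg\<^esub> y \<in> ?I"
      by (simp add: lin_swap[of _ y x])
  qed auto
  then have "Idl\<^bsub>free_alg\<^esub> R \<subseteq> ?I"
    by (rule free.genideal_minimal) (use assms(1) in \<open>auto simp: annihilates_def\<close>)
  with assms(2) have "lin (\<lambda>w. f ([] @ w @ [])) x = 0"
    by blast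
  then show ?thesis by simp
qed

definition form_of :: "('x list \<Rightarrow> complex) \<Rightarrow> ('x list \<Rightarrow>\<^sub>0 complex) set \<Rightarrow> complex"
  where "form_of f = quot_lift (lin f)"

lemma linear_forms_free_alg: "lin f \<in> linear_forms free_alg"
  by (simp add: linear_forms_def)

lemma form_of_class:
  assumes "annihilates R f"
  shows "form_of f ((Idl\<^bsub>free_alg\<^esub> R) +>\<^bsub>free_alg\<^esub> p) = lin f p"
  using free.linear_form_quot_lift(1)[OF ideal_relations linear_forms_free_alg annihilates_ideal[OF assms]]
  by (simp add: form_of_def)

lemma form_of_wclass: "annihilates R f \<Longrightarrow> form_of f (wclass R w) = f w"
  by (simp add: form_of_class)

lemma form_of_linear:
  assumes "annihilates R f"
  shows "form_of f \<in> linear_forms (presented_alg R)"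
  using free.linear_form_quot_lift(2)[OF ideal_relations linear_forms_free_alg annihilates_ideal[OF assms]]
  by (simp add: form_of_def presented_alg_def)

section \<open>The universal property of a presented algebra\<close>

definition word_eval :: "(complex, 'a) module \<Rightarrow> ('x \<Rightarrow> 'a) \<Rightarrow> 'x list \<Rightarrow> 'a"
  where "word_eval B \<phi> w = foldr (\<lambda>x y. \<phi> x \<otimes>\<^bsub>B\<^esub> y) w \<one>\<^bsub>B\<^esub>"

lemma word_eval_simps [simp]:
  "word_eval B \<phi> [] = \<one>\<^bsub>B\<^esub>"
  "word_eval B \<phi> (x # w) = \<phi> x \<otimes>\<^bsub>B\<^esub> word_eval B \<phi> w"
  by (simp_all add: word_eval_def)

context complex_algebra
begin

lemma word_eval_closed [simp]: "(\<And>x. \<phi> x \<in> carrier A) \<Longrightarrow> word_eval A \<phi> w \<in> carrier A"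
  by (induction w) auto

lemma word_eval_append:
  "(\<And>x. \<phi> x \<in> carrier A) \<Longrightarrow> word_eval A \<phi> (u @ v) = word_eval A \<phi> u \<otimes> word_eval A \<phi> v"
  by (induction u) (auto simp: m_assoc)

lemma alg_hom_wclass:
  assumes "h \<in> alg_hom (presented_alg R) A"
  shows "h (wclass R w) = word_eval A (\<lambda>x. h (generator R x)) w"
proof (induction w)
  case Nil
  show ?case using alg_homD(4)[OF assms] by (simp add: wclass_Nil)
next
  case (Cons x w)
  then show ?case
    using alg_homD(2)[OF assms, of "wclass R [x]" "wclass R w"]
    by (simp add: wclass_mult generator_eq_wclass)
qed

definition free_eval :: "('x \<Rightarrow> 'a) \<Rightarrow> ('x list \<Rightarrow>\<^sub>0 complex) \<Rightarrow> 'a"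
  where "free_eval \<phi> p = (\<Oplus>w \<in> Poly_Mapping.keys p. Poly_Mapping.lookup p w \<odot> word_eval A \<phi> w)"

lemma free_eval_superset:
  assumes "\<And>x. \<phi> x \<in> carrier A" "finite S" "Poly_Mapping.keys p \<subseteq> S"
  shows "free_eval \<phi> p = (\<Oplus>w \<in> S. Poly_Mapping.lookup p w \<odot> word_eval A \<phi> w)"
  unfolding free_eval_def using assms
  by (intro add.finprod_mono_neutral_cong_left) (auto simp: in_keys_iff)

lemma free_eval_add:
  assumes \<phi>: "\<And>x. \<phi> x \<in> carrier A"
  shows "free_eval \<phi> (p + q) = free_eval \<phi> p \<oplus> free_eval \<phi> q"
proof -
  let ?S = "Poly_Mapping.keys p \<union> Poly_Mapping.keys q"
  have "free_eval \<phi> (p + q) = (\<Oplus>w \<in> ?S. Poly_Mapping.lookup (p + q) w \<odot> word_eval A \<phi> w)"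
    using keys_add[of p q] \<phi> by (intro free_eval_superset) auto
  also have "\<dots> = (\<Oplus>w \<in> ?S. Poly_Mapping.lookup p w \<odot> word_eval A \<phi> w
      \<oplus> Poly_Mapping.lookup q w \<odot> word_eval A \<phi> w)"
    using \<phi> by (intro add.finprod_cong') (auto simp: lookup_add smult_l_distr)
  also have "\<dots> = (\<Oplus>w \<in> ?S. Poly_Mapping.lookup p w \<odot> word_eval A \<phi> w)
      \<oplus> (\<Oplus>w \<in> ?S. Poly_Mapping.lookup q w \<odot> word_eval A \<phi> w)"
    using \<phi> by (intro finsum_addf) auto
  also have "\<dots> = free_eval \<phi> p \<oplus> free_eval \<phi> q"
    using \<phi> by (simp add: free_eval_superset[of \<phi> ?S])
  finally show ?thesis .
qed

lemma free_eval_closed [simp]: "(\<And>x. \<phi> x \<in> carrier A) \<Longrightarrow> free_eval \<phi> p \<in> carrier A"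
  unfolding free_eval_def by (rule finsum_closed) auto

lemma free_eval_single:
  assumes \<phi>: "\<And>x. \<phi> x \<in> carrier A"
  shows "free_eval \<phi> (Poly_Mapping.single w c) = c \<odot> word_eval A \<phi> w"
  using \<phi> free_eval_superset[of \<phi> "{w}" "Poly_Mapping.single w c"] by simp

lemma free_eval_zero [simp]: "free_eval \<phi> 0 = \<zero>"
  by (simp add: free_eval_def)

lemma free_eval_alg_hom:
  assumes \<phi>: "\<And>x. \<phi> x \<in> carrier A"
  shows "free_eval \<phi> \<in> alg_hom free_alg A"
proof -
  note simps = free_eval_add[OF \<phi>] free_eval_single[OF \<phi>] \<phi>
  have scale: "free_eval \<phi> (pm_scale c p) = c \<odot> free_eval \<phi> p" for c p
    by (induction p rule: pm_single_induct)
      (simp_all add: simps pm.scale_right_distrib smult_r_distr smult_assoc1)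
  have single: "free_eval \<phi> (Poly_Mapping.single u c \<otimes>\<^bsub>free_alg\<^esub> q)
      = free_eval \<phi> (Poly_Mapping.single u c) \<otimes> free_eval \<phi> q" for u c q
  proof (induction q rule: pm_single_induct)
    case zero
    show ?case
      using free.r_null[of "Poly_Mapping.single u c"] by (simp add: simps)
  next
    case (add k d q)
    then show ?case
      using free.r_distr[of "Poly_Mapping.single k d" q "Poly_Mapping.single u c"]
      by (simp add: simps r_distr word_eval_append smult_mult_l smult_mult_r smult_assoc1[symmetric] mult.commute)
  qed
  have mult: "free_eval \<phi> (p \<otimes>\<^bsub>free_alg\<^esub> q) = free_eval \<phi> p \<otimes> free_eval \<phi> q" for p q
  proof (induction p rule: pm_single_induct)
    case zero
    show ?case
      using free.l_null[of q] by (simp add: simps)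
  next
    case (add k d p)
    then show ?case
      using free.l_distr[of "Poly_Mapping.single k d" p q]
      by (simp add: single free_eval_add[OF \<phi>] \<phi> l_distr)
  qed
  show ?thesis
    using \<phi> by (simp add: alg_hom_def ring_hom_def scale mult free_eval_add free_eval_single)
qed

lemma linear_form_free_eval:
  assumes \<phi>: "\<And>x. \<phi> x \<in> carrier A" and f: "f \<in> linear_forms A"
  shows "f (free_eval \<phi> p) = lin (\<lambda>w. f (word_eval A \<phi> w)) p"
  using f by (induction p rule: pm_single_induct)
    (simp_all add: \<phi> free_eval_add free_eval_single linear_forms_zero linear_forms_add linear_forms_smult)

text \<open>The relations are checked only through a separating family \<open>\<Phi>\<close> of
  forms. It is left as a parameter because the targets differ: matrix entries serve for
  \<open>rho\<close>, the identity for the counits, and all linear forms for the coproducts and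
  antipodes.\<close>

lemma presented_alg_hom_exists:
  assumes \<phi>: "\<And>x. \<phi> x \<in> carrier A" and \<Phi>: "\<Phi> \<subseteq> linear_forms A"
    and sep: "\<And>z. z \<in> carrier A \<Longrightarrow> (\<And>f. f \<in> \<Phi> \<Longrightarrow> f z = 0) \<Longrightarrow> z = \<zero>"
    and rel: "\<And>r f. r \<in> R \<Longrightarrow> f \<in> \<Phi> \<Longrightarrow> lin (\<lambda>w. f (word_eval A \<phi> w)) r = 0"
  obtains h where "h \<in> alg_hom (presented_alg R) A" "\<And>x. h (generator R x) = \<phi> x"
proof -
  note hom = free_eval_alg_hom[of \<phi>, OF \<phi>]
  let ?K = "{p. free_eval \<phi> p = \<zero>}"
  have "ideal ?K free_alg"
    using alg_homD[OF hom] \<phi> by (intro free.idealI_smult) auto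
  moreover have "R \<subseteq> ?K"
  proof
    fix r assume r: "r \<in> R"
    have "free_eval \<phi> r = \<zero>"
    proof (rule sep)
      show "free_eval \<phi> r \<in> carrier A"
        using \<phi> by simp
      show "f (free_eval \<phi> r) = 0" if "f \<in> \<Phi>" for f
        using linear_form_free_eval[of \<phi> f r, OF \<phi>] \<Phi> rel[OF r that] that by auto
    qed
    then show "r \<in> ?K" by simp
  qed
  ultimately have "Idl\<^bsub>free_alg\<^esub> R \<subseteq> ?K"
    by (rule free.genideal_minimal)
  then have 0: "\<And>p. p \<in> Idl\<^bsub>free_alg\<^esub> R \<Longrightarrow> free_eval \<phi> p = \<zero>"
    by blast
  note lift = free.alg_hom_quot_lift[OF ideal_relations complex_algebra_axioms hom 0]
  show ?thesis
  proof (rule that)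
    show "quot_lift (free_eval \<phi>) \<in> alg_hom (presented_alg R) A"
      using lift(2)[of R] by (simp add: presented_alg_def)
    show "quot_lift (free_eval \<phi>) (generator R x) = \<phi> x" for x
      using lift(1)[of R "word [x]"] \<phi> by (simp add: generator_def free_eval_single)
  qed
qed

end

section \<open>Tensor products\<close>

lemma lin_diff_fun: "lin (\<lambda>k. f k - g k) p = lin f p - lin g p"
  by (simp add: lin_def algebra_simps sum_subtractf)

lemma monoid_alg_mult_bilinear [simp]:
  "p \<otimes>\<^bsub>monoid_alg M\<^esub> (q + r) = p \<otimes>\<^bsub>monoid_alg M\<^esub> q + p \<otimes>\<^bsub>monoid_alg M\<^esub> r"
  "(q + r) \<otimes>\<^bsub>monoid_alg M\<^esub> p = q \<otimes>\<^bsub>monoid_alg M\<^esub> p + r \<otimes>\<^bsub>monoid_alg M\<^esub> p"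
  "p \<otimes>\<^bsub>monoid_alg M\<^esub> (q - r) = p \<otimes>\<^bsub>monoid_alg M\<^esub> q - p \<otimes>\<^bsub>monoid_alg M\<^esub> r"
  "(q - r) \<otimes>\<^bsub>monoid_alg M\<^esub> p = q \<otimes>\<^bsub>monoid_alg M\<^esub> p - r \<otimes>\<^bsub>monoid_alg M\<^esub> p"
  "p \<otimes>\<^bsub>monoid_alg M\<^esub> pm_scale c q = pm_scale c (p \<otimes>\<^bsub>monoid_alg M\<^esub> q)"
  "pm_scale c q \<otimes>\<^bsub>monoid_alg M\<^esub> p = pm_scale c (q \<otimes>\<^bsub>monoid_alg M\<^esub> p)"
  "p \<otimes>\<^bsub>monoid_alg M\<^esub> 0 = 0"
  "0 \<otimes>\<^bsub>monoid_alg M\<^esub> p = 0"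
  by (rule pm_eqI, simp add: lin_add_fun lin_diff_fun lin_mult_fun)+

locale algebra_pair = A: complex_algebra A + B: complex_algebra B
  for A :: "(complex, 'a) module" and B :: "(complex, 'b) module"
begin

abbreviation "T \<equiv> tensor_alg A B"
abbreviation "tens \<equiv> pure_tensor A B"

sublocale M: complex_algebra "monoid_alg (A \<times>\<times> B)"
  by (intro monoid_alg_complex_algebra DirProd_monoid A.monoid_axioms B.monoid_axioms)

lemma single_carrier:
  "a \<in> carrier A \<Longrightarrow> b \<in> carrier B \<Longrightarrow> Poly_Mapping.single (a, b) c \<in> carrier (monoid_alg (A \<times>\<times> B))"
  by simp

lemma subspace_carrier: "pm.subspace (carrier (monoid_alg (A \<times>\<times> B)))"
  using M.zero_closed M.a_closed M.smult_closed unfolding pm.subspace_def by simp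

lemma subspace_null: "pm.subspace (tensor_null A B)"
  by (simp add: tensor_null_def)

text \<open>Scaled relators, in the shape in which they arise when a relator is multiplied by
  \<open>Poly_Mapping.single (u, v) c\<close>.\<close>

lemma tensor_null_relators:
  "a \<in> carrier A \<Longrightarrow> a' \<in> carrier A \<Longrightarrow> b \<in> carrier B \<Longrightarrow>
    Poly_Mapping.single (a \<oplus>\<^bsub>A\<^esub> a', b) c - Poly_Mapping.single (a, b) c - Poly_Mapping.single (a', b) c
      \<in> tensor_null A B"
  "a \<in> carrier A \<Longrightarrow> b \<in> carrier B \<Longrightarrow> b' \<in> carrier B \<Longrightarrow>
    Poly_Mapping.single (a, b \<oplus>\<^bsub>B\<^esub> b') c - Poly_Mapping.single (a, b) c - Poly_Mapping.single (a, b') c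
      \<in> tensor_null A B"
  "a \<in> carrier A \<Longrightarrow> b \<in> carrier B \<Longrightarrow>
    Poly_Mapping.single (d \<odot>\<^bsub>A\<^esub> a, b) c - Poly_Mapping.single (a, b) (c * d) \<in> tensor_null A B"
  "a \<in> carrier A \<Longrightarrow> b \<in> carrier B \<Longrightarrow>
    Poly_Mapping.single (a, d \<odot>\<^bsub>B\<^esub> b) c - Poly_Mapping.single (a, b) (c * d) \<in> tensor_null A B"
proof -
  have scaled: "r \<in> tensor_relators A B \<Longrightarrow> pm_scale c r \<in> tensor_null A B" for r
    using pm.span_base pm.span_scale unfolding tensor_null_def by blast
  note distrib = pm.scale_right_diff_distrib pm_scale_single mult_1_right
  show "Poly_Mapping.single (a \<oplus>\<^bsub>A\<^esub> a', b) c - Poly_Mapping.single (a, b) c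
      - Poly_Mapping.single (a', b) c \<in> tensor_null A B"
    if "a \<in> carrier A" "a' \<in> carrier A" "b \<in> carrier B"
    by (rule scaled[of "Poly_Mapping.single (a \<oplus>\<^bsub>A\<^esub> a', b) 1 - Poly_Mapping.single (a, b) 1
      - Poly_Mapping.single (a', b) 1", unfolded distrib]) (use that in \<open>auto simp: tensor_relators_def\<close>)
  show "Poly_Mapping.single (a, b \<oplus>\<^bsub>B\<^esub> b') c - Poly_Mapping.single (a, b) c
      - Poly_Mapping.single (a, b') c \<in> tensor_null A B"
    if "a \<in> carrier A" "b \<in> carrier B" "b' \<in> carrier B"
    by (rule scaled[of "Poly_Mapping.single (a, b \<oplus>\<^bsub>B\<^esub> b') 1 - Poly_Mapping.single (a, b) 1
      - Poly_Mapping.single (a, b') 1", unfolded distrib]) (use that in \<open>auto simp: tensor_relators_def\<close>)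
  show "Poly_Mapping.single (d \<odot>\<^bsub>A\<^esub> a, b) c - Poly_Mapping.single (a, b) (c * d) \<in> tensor_null A B"
    if "a \<in> carrier A" "b \<in> carrier B"
    by (rule scaled[of "Poly_Mapping.single (d \<odot>\<^bsub>A\<^esub> a, b) 1 - Poly_Mapping.single (a, b) d",
          unfolded distrib]) (use that in \<open>auto simp: tensor_relators_def\<close>)
  show "Poly_Mapping.single (a, d \<odot>\<^bsub>B\<^esub> b) c - Poly_Mapping.single (a, b) (c * d) \<in> tensor_null A B"
    if "a \<in> carrier A" "b \<in> carrier B"
    by (rule scaled[of "Poly_Mapping.single (a, d \<odot>\<^bsub>B\<^esub> b) 1 - Poly_Mapping.single (a, b) d",
          unfolded distrib]) (use that in \<open>auto simp: tensor_relators_def\<close>)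
qed

lemma tensor_relators_carrier: "tensor_relators A B \<subseteq> carrier (monoid_alg (A \<times>\<times> B))"
  unfolding tensor_relators_def
  by (intro Un_least subsetI; elim CollectE exE conjE; hypsubst;
      intro pm.subspace_diff[OF subspace_carrier] single_carrier) auto

lemma single_mult_relators:
  assumes "u \<in> carrier A" "v \<in> carrier B" "r \<in> tensor_relators A B"
  shows "Poly_Mapping.single (u, v) c \<otimes>\<^bsub>monoid_alg (A \<times>\<times> B)\<^esub> r \<in> tensor_null A B"
    and "r \<otimes>\<^bsub>monoid_alg (A \<times>\<times> B)\<^esub> Poly_Mapping.single (u, v) c \<in> tensor_null A B"
  using assms(3) unfolding tensor_relators_def
  by (elim UnE CollectE exE conjE; hypsubst;
      simp add: assms(1,2) A.r_distr B.r_distr A.l_distr B.l_distr A.smult_mult_l A.smult_mult_r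
        B.smult_mult_l B.smult_mult_r tensor_null_relators mult.commute[of _ c])+

text \<open>\<open>tensor_null\<close> is a priori only a subspace. By linearity in both factors it
  suffices to multiply a relator by a single basis element, and bilinearity of the two
  multiplications makes the result a scaled relator again.\<close>

lemma tensor_null_mult:
  assumes y: "y \<in> carrier (monoid_alg (A \<times>\<times> B))" and x: "x \<in> tensor_null A B"
  shows "y \<otimes>\<^bsub>monoid_alg (A \<times>\<times> B)\<^esub> x \<in> tensor_null A B"
    and "x \<otimes>\<^bsub>monoid_alg (A \<times>\<times> B)\<^esub> y \<in> tensor_null A B"
proof -
  let ?N = "tensor_null A B" and ?M = "monoid_alg (A \<times>\<times> B)"
  note sub = pm.subspace_0[OF subspace_null] pm.subspace_add[OF subspace_null]
    pm.subspace_scale[OF subspace_null]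
  have rel: "y \<otimes>\<^bsub>?M\<^esub> r \<in> ?N \<and> r \<otimes>\<^bsub>?M\<^esub> y \<in> ?N" if r: "r \<in> tensor_relators A B" for r
  proof (induction y rule: pm_single_induct)
    case zero
    show ?case by (simp add: sub)
  next
    case (add k c q)
    then have "fst k \<in> carrier A" "snd k \<in> carrier B"
      using y by auto
    then show ?case
      using add single_mult_relators[OF _ _ r, of "fst k" "snd k" c] by (simp add: sub)
  qed
  have "?N \<subseteq> {x. y \<otimes>\<^bsub>?M\<^esub> x \<in> ?N \<and> x \<otimes>\<^bsub>?M\<^esub> y \<in> ?N}"
    unfolding tensor_null_def[of A B]
    by (rule pm.span_minimal) (use rel sub in \<open>auto simp: pm.subspace_def tensor_null_def[symmetric]\<close>)
  with x show "y \<otimes>\<^bsub>?M\<^esub> x \<in> ?N" "x \<otimes>\<^bsub>?M\<^esub> y \<in> ?N"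
    by blast+
qed

lemma tensor_null_ideal: "ideal (tensor_null A B) (monoid_alg (A \<times>\<times> B))"
proof (rule M.idealI_smult)
  show "tensor_null A B \<subseteq> carrier (monoid_alg (A \<times>\<times> B))"
    unfolding tensor_null_def by (rule pm.span_minimal[OF tensor_relators_carrier subspace_carrier])
qed (use pm.subspace_0[OF subspace_null] pm.subspace_add[OF subspace_null]
    pm.subspace_scale[OF subspace_null] tensor_null_mult in simp_all)

sublocale T: complex_algebra T
  unfolding tensor_alg_def by (rule M.quot_alg_complex_algebra[OF tensor_null_ideal])

lemma tensor_separated: "separated T"
  unfolding tensor_alg_def
  by (intro quot_monoid_alg_separated tensor_null_ideal DirProd_monoid A.monoid_axioms B.monoid_axioms)

lemma class_eqI:
  assumes "x \<in> carrier (monoid_alg (A \<times>\<times> B))" "y \<in> carrier (monoid_alg (A \<times>\<times> B))"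
    and "x - y \<in> tensor_null A B"
  shows "tensor_null A B +>\<^bsub>monoid_alg (A \<times>\<times> B)\<^esub> x = tensor_null A B +>\<^bsub>monoid_alg (A \<times>\<times> B)\<^esub> y"
proof -
  have "\<ominus>\<^bsub>monoid_alg (A \<times>\<times> B)\<^esub> y = - y"
    using M.minus_one_smult[OF assms(2)] by (simp add: pm.scale_minus_left[of 1, simplified])
  then have "x \<ominus>\<^bsub>monoid_alg (A \<times>\<times> B)\<^esub> y = x - y"
    by (simp add: M.minus_eq)
  then show ?thesis
    using M.coset_eq_iff[OF tensor_null_ideal assms(1,2)] assms(3) by simp
qed

lemma tens_closed [simp]: "a \<in> carrier A \<Longrightarrow> b \<in> carrier B \<Longrightarrow> tens a b \<in> carrier T"
  by (auto simp: pure_tensor_def tensor_alg_def M.quot_alg_carrier)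

lemma tens_mult:
  "a \<in> carrier A \<Longrightarrow> b \<in> carrier B \<Longrightarrow> a' \<in> carrier A \<Longrightarrow> b' \<in> carrier B \<Longrightarrow>
    tens a b \<otimes>\<^bsub>T\<^esub> tens a' b' = tens (a \<otimes>\<^bsub>A\<^esub> a') (b \<otimes>\<^bsub>B\<^esub> b')"
  by (simp add: pure_tensor_def tensor_alg_def M.quot_alg_ops[OF tensor_null_ideal])

lemma tens_one: "\<one>\<^bsub>T\<^esub> = tens \<one>\<^bsub>A\<^esub> \<one>\<^bsub>B\<^esub>"
  by (simp add: pure_tensor_def tensor_alg_def M.quot_alg_one)

lemma tens_add_left:
  assumes "a \<in> carrier A" "a' \<in> carrier A" "b \<in> carrier B"
  shows "tens (a \<oplus>\<^bsub>A\<^esub> a') b = tens a b \<oplus>\<^bsub>T\<^esub> tens a' b"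
proof -
  let ?x = "Poly_Mapping.single (a, b) (1::complex)" and ?y = "Poly_Mapping.single (a', b) (1::complex)"
  have "?x + ?y \<in> carrier (monoid_alg (A \<times>\<times> B))"
    using assms pm.subspace_add[OF subspace_carrier single_carrier single_carrier] by blast
  then have "tensor_null A B +>\<^bsub>monoid_alg (A \<times>\<times> B)\<^esub> Poly_Mapping.single (a \<oplus>\<^bsub>A\<^esub> a', b) 1
      = tensor_null A B +>\<^bsub>monoid_alg (A \<times>\<times> B)\<^esub> (?x + ?y)"
    using assms tensor_null_relators(1)[OF assms, of 1]
    by (intro class_eqI) (simp_all add: diff_diff_eq)
  then show ?thesis
    using assms M.quot_alg_ops(2)[OF tensor_null_ideal, of ?x ?y]
    by (simp add: pure_tensor_def tensor_alg_def)
qed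

lemma tens_add_right:
  assumes "a \<in> carrier A" "b \<in> carrier B" "b' \<in> carrier B"
  shows "tens a (b \<oplus>\<^bsub>B\<^esub> b') = tens a b \<oplus>\<^bsub>T\<^esub> tens a b'"
proof -
  let ?x = "Poly_Mapping.single (a, b) (1::complex)" and ?y = "Poly_Mapping.single (a, b') (1::complex)"
  have "?x + ?y \<in> carrier (monoid_alg (A \<times>\<times> B))"
    using assms pm.subspace_add[OF subspace_carrier single_carrier single_carrier] by blast
  then have "tensor_null A B +>\<^bsub>monoid_alg (A \<times>\<times> B)\<^esub> Poly_Mapping.single (a, b \<oplus>\<^bsub>B\<^esub> b') 1
      = tensor_null A B +>\<^bsub>monoid_alg (A \<times>\<times> B)\<^esub> (?x + ?y)"
    using assms tensor_null_relators(2)[OF assms, of 1]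
    by (intro class_eqI) (simp_all add: diff_diff_eq)
  then show ?thesis
    using assms M.quot_alg_ops(2)[OF tensor_null_ideal, of ?x ?y]
    by (simp add: pure_tensor_def tensor_alg_def)
qed

lemma tens_smult_left:
  assumes "a \<in> carrier A" "b \<in> carrier B"
  shows "tens (c \<odot>\<^bsub>A\<^esub> a) b = c \<odot>\<^bsub>T\<^esub> tens a b"
proof -
  have "tensor_null A B +>\<^bsub>monoid_alg (A \<times>\<times> B)\<^esub> Poly_Mapping.single (c \<odot>\<^bsub>A\<^esub> a, b) 1
      = tensor_null A B +>\<^bsub>monoid_alg (A \<times>\<times> B)\<^esub> Poly_Mapping.single (a, b) c"
    using assms tensor_null_relators(3)[OF assms, of c 1]
    by (intro class_eqI) simp_all
  then show ?thesis
    using assms M.quot_alg_smult[OF tensor_null_ideal, of "Poly_Mapping.single (a, b) 1" c]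
    by (simp add: pure_tensor_def tensor_alg_def)
qed

lemma tens_smult_right:
  assumes "a \<in> carrier A" "b \<in> carrier B"
  shows "tens a (c \<odot>\<^bsub>B\<^esub> b) = c \<odot>\<^bsub>T\<^esub> tens a b"
proof -
  have "tensor_null A B +>\<^bsub>monoid_alg (A \<times>\<times> B)\<^esub> Poly_Mapping.single (a, c \<odot>\<^bsub>B\<^esub> b) 1
      = tensor_null A B +>\<^bsub>monoid_alg (A \<times>\<times> B)\<^esub> Poly_Mapping.single (a, b) c"
    using assms tensor_null_relators(4)[OF assms, of c 1]
    by (intro class_eqI) simp_all
  then show ?thesis
    using assms M.quot_alg_smult[OF tensor_null_ideal, of "Poly_Mapping.single (a, b) 1" c]
    by (simp add: pure_tensor_def tensor_alg_def)
qed

lemma tens_zero: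
  "b \<in> carrier B \<Longrightarrow> tens \<zero>\<^bsub>A\<^esub> b = \<zero>\<^bsub>T\<^esub>"
  "a \<in> carrier A \<Longrightarrow> tens a \<zero>\<^bsub>B\<^esub> = \<zero>\<^bsub>T\<^esub>"
  using tens_smult_left[of "\<zero>\<^bsub>A\<^esub>" b 0] tens_smult_right[of a "\<zero>\<^bsub>B\<^esub>" 0] by simp_all

lemma linear_form_tens:
  assumes f: "f \<in> linear_forms T"
  shows "b \<in> carrier B \<Longrightarrow> (\<lambda>a. f (tens a b)) \<in> linear_forms A"
    and "a \<in> carrier A \<Longrightarrow> (\<lambda>b. f (tens a b)) \<in> linear_forms B"
  using linear_forms_add[OF f] linear_forms_smult[OF f]
  by (simp_all add: linear_forms_def[of A] linear_forms_def[of B]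
      tens_add_left tens_add_right tens_smult_left tens_smult_right)

definition tens_form :: "('a \<Rightarrow> 'b \<Rightarrow> complex) \<Rightarrow> ('a \<times> 'b \<Rightarrow>\<^sub>0 complex) set \<Rightarrow> complex"
  where "tens_form K = quot_lift (lin (\<lambda>(a, b). K a b))"

context
  fixes K
  assumes K: "bilinear_form A B K"
begin

lemma tens_form_null:
  assumes "x \<in> tensor_null A B"
  shows "lin (\<lambda>(a, b). K a b) x = 0"
proof -
  have "tensor_null A B \<subseteq> {x. lin (\<lambda>(a, b). K a b) x = 0}"
    unfolding tensor_null_def
  proof (rule pm.span_minimal)
    show "tensor_relators A B \<subseteq> {x. lin (\<lambda>(a, b). K a b) x = 0}"
      using K unfolding tensor_relators_def bilinear_form_def by auto
  qed (simp add: pm.subspace_def)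
  with assms show ?thesis by blast
qed

lemma tens_form_class:
  "x \<in> carrier (monoid_alg (A \<times>\<times> B)) \<Longrightarrow>
    tens_form K (tensor_null A B +>\<^bsub>monoid_alg (A \<times>\<times> B)\<^esub> x) = lin (\<lambda>(a, b). K a b) x"
  unfolding tens_form_def
  by (rule M.linear_form_quot_lift(1)[OF tensor_null_ideal linear_forms_monoid_alg tens_form_null])

lemma tens_form_linear: "tens_form K \<in> linear_forms T"
  unfolding tens_form_def tensor_alg_def
  by (rule M.linear_form_quot_lift(2)[OF tensor_null_ideal linear_forms_monoid_alg tens_form_null])

lemma tens_form_tens: "a \<in> carrier A \<Longrightarrow> b \<in> carrier B \<Longrightarrow> tens_form K (tens a b) = K a b"
  by (simp add: pure_tensor_def tens_form_class)

end

lemma tensor_carrierE: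
  assumes "z \<in> carrier T"
  obtains x where "x \<in> carrier (monoid_alg (A \<times>\<times> B))"
    "z = tensor_null A B +>\<^bsub>monoid_alg (A \<times>\<times> B)\<^esub> x"
  using assms unfolding tensor_alg_def M.quot_alg_carrier by blast

end

lemma algebra_pairI: "complex_algebra A \<Longrightarrow> complex_algebra B \<Longrightarrow> algebra_pair A B"
  by (simp add: algebra_pair_def)

lemma bilinear_formI:
  assumes "\<And>b. b \<in> carrier B \<Longrightarrow> (\<lambda>a. P a b) \<in> linear_forms A"
    and "\<And>a. a \<in> carrier A \<Longrightarrow> P a \<in> linear_forms B"
  shows "bilinear_form A B P"
  using assms by (auto simp: bilinear_form_def linear_forms_def)

lemma bilinear_formD:
  assumes "bilinear_form A B P"
  shows "b \<in> carrier B \<Longrightarrow> (\<lambda>a. P a b) \<in> linear_forms A"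
    and "a \<in> carrier A \<Longrightarrow> P a \<in> linear_forms B"
  using assms by (auto simp: bilinear_form_def linear_forms_def)

lemma linear_forms_cmult: "f \<in> linear_forms A \<Longrightarrow> (\<lambda>x. c * f x) \<in> linear_forms A"
  by (auto simp: linear_forms_def algebra_simps)

lemma linear_forms_multc: "f \<in> linear_forms A \<Longrightarrow> (\<lambda>x. f x * c) \<in> linear_forms A"
  by (auto simp: linear_forms_def algebra_simps)

lemma linear_forms_lin:
  assumes "\<And>k. k \<in> Poly_Mapping.keys q \<Longrightarrow> f k \<in> linear_forms A"
  shows "(\<lambda>x. lin (\<lambda>k. f k x) q) \<in> linear_forms A"
  unfolding linear_forms_def
proof (intro CollectI conjI ballI allI)
  fix x y assume "x \<in> carrier A" "y \<in> carrier A"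
  then show "lin (\<lambda>k. f k (x \<oplus>\<^bsub>A\<^esub> y)) q = lin (\<lambda>k. f k x) q + lin (\<lambda>k. f k y) q"
    unfolding lin_add_fun[symmetric] using assms by (intro lin_cong) (simp add: linear_forms_add)
next
  fix c x assume "x \<in> carrier A"
  then show "lin (\<lambda>k. f k (c \<odot>\<^bsub>A\<^esub> x)) q = c * lin (\<lambda>k. f k x) q"
    unfolding lin_mult_fun[symmetric] using assms by (intro lin_cong) (simp add: linear_forms_smult)
qed

text \<open>The universal property is used twice. For fixed \<open>\<phi>\<close> and
  \<open>\<psi>\<close>, the form \<open>K \<phi> \<psi>\<close> descends to the tensor square of
  \<open>B\<close>; for fixed \<open>z'\<close> its value is, on a representative of
  \<open>z'\<close>, a finite sum of products, hence bilinear in \<open>\<phi>\<close> and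
  \<open>\<psi>\<close>, and descends to the tensor square of \<open>A\<close>.\<close>

lemma tensor_form_spec:
  assumes A: "complex_algebra A" and B: "complex_algebra B" and P: "bilinear_form A B P"
  shows "bilinear_form (tensor_alg A A) (tensor_alg B B) (tensor_form A B P)"
    and "\<lbrakk>\<phi> \<in> carrier A; \<psi> \<in> carrier A; a \<in> carrier B; b \<in> carrier B\<rbrakk> \<Longrightarrow>
      tensor_form A B P (pure_tensor A A \<phi> \<psi>) (pure_tensor B B a b) = P \<phi> a * P \<psi> b"
proof -
  interpret AA: algebra_pair A A using A by (rule algebra_pairI[OF _ A])
  interpret BB: algebra_pair B B using B by (rule algebra_pairI[OF _ B])
  define K where "K \<phi> \<psi> = (\<lambda>a b. P \<phi> a * P \<psi> b)" for \<phi> \<psi>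
  define L where "L z' = (\<lambda>\<phi> \<psi>. BB.tens_form (K \<phi> \<psi>) z')" for z'
  define Q where "Q z z' = AA.tens_form (L z') z" for z z'
  have K: "bilinear_form B B (K \<phi> \<psi>)" if "\<phi> \<in> carrier A" "\<psi> \<in> carrier A" for \<phi> \<psi>
    using that bilinear_formD(2)[OF P] unfolding K_def
    by (intro bilinear_formI linear_forms_cmult linear_forms_multc) auto
  have L: "bilinear_form A A (L z')" if z': "z' \<in> carrier (tensor_alg B B)" for z'
  proof -
    obtain x where x: "x \<in> carrier (monoid_alg (B \<times>\<times> B))"
      and z'x: "z' = tensor_null B B +>\<^bsub>monoid_alg (B \<times>\<times> B)\<^esub> x"
      using z' by (rule BB.tensor_carrierE)
    have eq: "L z' \<phi> \<psi> = lin (\<lambda>k. P \<phi> (fst k) * P \<psi> (snd k)) x"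
      if "\<phi> \<in> carrier A" "\<psi> \<in> carrier A" for \<phi> \<psi>
      unfolding L_def z'x BB.tens_form_class[OF K[OF that] x] by (simp add: K_def case_prod_unfold)
    have keys: "fst k \<in> carrier B" "snd k \<in> carrier B" if "k \<in> Poly_Mapping.keys x" for k
      using that x by (cases k; auto)+
    have "bilinear_form A A (\<lambda>\<phi> \<psi>. lin (\<lambda>k. P \<phi> (fst k) * P \<psi> (snd k)) x)"
      by (intro bilinear_formI linear_forms_lin linear_forms_multc linear_forms_cmult
          bilinear_formD(1)[OF P] keys)
    then show ?thesis
      using eq by (simp add: bilinear_form_def)
  qed
  have "bilinear_form (tensor_alg A A) (tensor_alg B B) Q"
  proof (rule bilinear_formI)
    show "(\<lambda>z. Q z z') \<in> linear_forms (tensor_alg A A)" if "z' \<in> carrier (tensor_alg B B)" for z'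
      unfolding Q_def by (rule AA.tens_form_linear[OF L[OF that]])
    show "Q z \<in> linear_forms (tensor_alg B B)" if z: "z \<in> carrier (tensor_alg A A)" for z
    proof -
      obtain x where x: "x \<in> carrier (monoid_alg (A \<times>\<times> A))"
        and zx: "z = tensor_null A A +>\<^bsub>monoid_alg (A \<times>\<times> A)\<^esub> x"
        using z by (rule AA.tensor_carrierE)
      have eq: "Q z z' = lin (\<lambda>k. L z' (fst k) (snd k)) x" if "z' \<in> carrier (tensor_alg B B)" for z'
        unfolding Q_def zx AA.tens_form_class[OF L[OF that] x] by (simp add: case_prod_unfold)
      have "(\<lambda>z'. lin (\<lambda>k. L z' (fst k) (snd k)) x) \<in> linear_forms (tensor_alg B B)"
      proof (rule linear_forms_lin)
        fix k assume "k \<in> Poly_Mapping.keys x"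
        then have "fst k \<in> carrier A" "snd k \<in> carrier A"
          using x by (cases k; auto)+
        then show "(\<lambda>z'. L z' (fst k) (snd k)) \<in> linear_forms (tensor_alg B B)"
          unfolding L_def by (rule BB.tens_form_linear[OF K])
      qed
      then show ?thesis
        using eq by (simp add: linear_forms_def)
    qed
  qed
  moreover have "Q (pure_tensor A A \<phi> \<psi>) (pure_tensor B B a b) = P \<phi> a * P \<psi> b"
    if "\<phi> \<in> carrier A" "\<psi> \<in> carrier A" "a \<in> carrier B" "b \<in> carrier B" for \<phi> \<psi> a b
  proof -
    have "Q (pure_tensor A A \<phi> \<psi>) (pure_tensor B B a b) = L (pure_tensor B B a b) \<phi> \<psi>"
      unfolding Q_def using that by (intro AA.tens_form_tens L BB.tens_closed)
    also have "\<dots> = K \<phi> \<psi> a b"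
      unfolding L_def using that by (intro BB.tens_form_tens K)
    finally show ?thesis by (simp add: K_def)
  qed
  ultimately have "\<exists>Q. bilinear_form (tensor_alg A A) (tensor_alg B B) Q \<and>
    (\<forall>\<phi> \<in> carrier A. \<forall>\<psi> \<in> carrier A. \<forall>a \<in> carrier B. \<forall>b \<in> carrier B.
      Q (pure_tensor A A \<phi> \<psi>) (pure_tensor B B a b) = P \<phi> a * P \<psi> b)"
    by blast
  note spec = someI_ex[OF this, folded tensor_form_def]
  show "bilinear_form (tensor_alg A A) (tensor_alg B B) (tensor_form A B P)"
    using spec by blast
  show "\<lbrakk>\<phi> \<in> carrier A; \<psi> \<in> carrier A; a \<in> carrier B; b \<in> carrier B\<rbrakk> \<Longrightarrow>
      tensor_form A B P (pure_tensor A A \<phi> \<psi>) (pure_tensor B B a b) = P \<phi> a * P \<psi> b"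
    using spec by blast
qed

section \<open>Coideals of relations and structure maps\<close>

text \<open>These are the functions on pairs of words that come from linear forms on the tensor
  square of the presented algebra.\<close>

definition biannihilates :: "('x list \<Rightarrow>\<^sub>0 complex) set \<Rightarrow> ('x list \<Rightarrow> 'x list \<Rightarrow> complex) \<Rightarrow> bool"
  where "biannihilates R F \<longleftrightarrow> (\<forall>y. annihilates R (\<lambda>x. F x y)) \<and> (\<forall>x. annihilates R (F x))"

text \<open>With I the ideal generated by \<open>R\<close> and F the free algebra, this is the dual
  formulation of \<Delta>(R) \<subseteq> I \<otimes> F + F \<otimes> I: the right-hand side consists
  of what all biannihilating functions kill.\<close>

definition coideal :: "('x \<Rightarrow> ('x list \<times> 'x list) list) \<Rightarrow> ('x list \<Rightarrow>\<^sub>0 complex) set \<Rightarrow> bool"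
  where "coideal d R \<longleftrightarrow> (\<forall>F. biannihilates R F \<longrightarrow> (\<forall>r \<in> R. lin (\<lambda>w. coprod_sum d w F) r = 0))"

lemma annihilates_shift: "annihilates R f \<Longrightarrow> annihilates R (\<lambda>w. f (u @ w @ v))"
  unfolding annihilates_def by (metis (mono_tags, lifting) append_assoc lin_cong)

lemma coprod_sum_zero [simp]: "coprod_sum d w (\<lambda>a b. 0) = 0"
  using coprod_sum_mult[of d w 0 "\<lambda>a b. 0"] by simp

lemma annihilates_coprod_sum:
  assumes "\<And>a b. annihilates R (\<lambda>x. F x a b)"
  shows "annihilates R (\<lambda>x. coprod_sum d w (F x))"
  using assms by (simp add: annihilates_def lin_coprod_sum)

lemma annihilates_mult_left: "annihilates R f \<Longrightarrow> annihilates R (\<lambda>x. c * f x)"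
  by (simp add: annihilates_def lin_mult_fun)

lemma annihilates_mult_right: "annihilates R f \<Longrightarrow> annihilates R (\<lambda>x. f x * c)"
  using annihilates_mult_left[of R f c] by (simp add: mult.commute)

text \<open>By multiplicativity of the coproduct the context \<open>u\<close>, \<open>v\<close> only
  contributes shifts of the arguments of \<open>F\<close>, and the shifted and summed function
  \<open>?G\<close> is again biannihilating.\<close>

lemma coideal_annihilates:
  assumes d: "coideal d R" and F: "biannihilates R F"
  shows "annihilates R (\<lambda>w. coprod_sum d w F)"
  unfolding annihilates_def
proof (intro ballI allI)
  fix r u v assume r: "r \<in> R"
  let ?G = "\<lambda>x y. coprod_sum d u (\<lambda>a b. coprod_sum d v (\<lambda>a' b'. F (a @ x @ a') (b @ y @ b')))"
  have "coprod_sum d (u @ w @ v) F = coprod_sum d w ?G" for w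
    by (simp add: coprod_sum_append coprod_sum_swap[of d w])
  moreover have "biannihilates R ?G"
    using F unfolding biannihilates_def
    by (intro conjI allI annihilates_coprod_sum annihilates_shift[of R "\<lambda>x. F x _"] annihilates_shift[of R "F _"]) auto
  ultimately show "lin (\<lambda>w. coprod_sum d (u @ w @ v) F) r = 0"
    using d r by (simp add: coideal_def)
qed

text \<open>Stated for an abstract \<open>q\<close>, so that it serves both sides of the pairing
  with their roles exchanged. For short \<open>c\<close> the context of a relation splits off along
  \<open>dH\<close>, whose legs are short again, so \<open>base\<close> applies to them. For longer
  words the coideal property carries the induction.\<close>

lemma annihilates_pairing:
  fixes q :: "'y list \<Rightarrow> 'x list \<Rightarrow> complex"
  assumes left: "\<And>v w w'. q v (w @ w') = coprod_sum dH v (\<lambda>a b. q a w * q b w')"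
    and right: "\<And>t v w. q (t # v) w = coprod_sum dU w (\<lambda>a b. q [t] a * q v b)"
    and short: "short dH" and coideal: "coideal dU R"
    and base: "\<And>c r. length c \<le> 1 \<Longrightarrow> r \<in> R \<Longrightarrow> lin (q c) r = 0"
  shows "annihilates R (q v)"
proof -
  have left_letter: "q [t] (w @ w') = (\<Sum>p\<leftarrow>dH t. q (fst p) w * q (snd p) w')" for t w w'
    by (simp add: left)
  have lin_sum_list: "lin (\<lambda>k. \<Sum>p\<leftarrow>xs. G p k) r = (\<Sum>p\<leftarrow>xs. lin (G p) r)"
    for G :: "'y list \<times> 'y list \<Rightarrow> 'x list \<Rightarrow> complex" and xs r
    by (induction xs) (auto simp: lin_add_fun)
  \<comment> \<open>Only the right context is removed here; \<open>letter\<close> then removes the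
    left one in the same way.\<close>
  have base1: "lin (\<lambda>w. q c (w @ w')) r = 0" if c: "length c \<le> 1" and r: "r \<in> R" for c w' r
  proof (cases c)
    case Nil
    then show ?thesis
      using base[OF c r] by (simp add: left lin_mult_fun mult.commute[of _ "q [] w'"])
  next
    case (Cons t v)
    with c have "c = [t]" by simp
    moreover have "(\<Sum>p\<leftarrow>dH t. lin (\<lambda>w. q (fst p) w * q (snd p) w') r) = (\<Sum>p\<leftarrow>dH t. 0)"
      using short base r unfolding short_def
      by (intro arg_cong[where f = sum_list] map_cong refl)
        (simp add: lin_mult_fun mult.commute[of _ "q _ w'"])
    ultimately show ?thesis
      by (simp add: left_letter lin_sum_list)
  qed
  have letter: "annihilates R (q c)" if c: "length c \<le> 1" for c
    unfolding annihilates_def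
  proof (intro ballI allI)
    fix r u w' assume r: "r \<in> R"
    show "lin (\<lambda>w. q c (u @ w @ w')) r = 0"
    proof (cases c)
      case Nil
      then show ?thesis
        using base1[OF c r, of w'] by (simp add: left[of _ u] lin_mult_fun)
    next
      case (Cons t v)
      with c have "c = [t]" by simp
      moreover have "(\<Sum>p\<leftarrow>dH t. lin (\<lambda>w. q (fst p) u * q (snd p) (w @ w')) r) = (\<Sum>p\<leftarrow>dH t. 0)"
        using short base1 r unfolding short_def
        by (intro arg_cong[where f = sum_list] map_cong refl) (simp add: lin_mult_fun)
      ultimately show ?thesis
        by (simp add: left_letter lin_sum_list)
    qed
  qed
  show ?thesis
  proof (induction v)
    case Nil
    show ?case by (rule letter) simp
  next
    case (Cons t v)
    \<comment> \<open>Each factor annihilates separately, the first as a letter and the second by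
      induction, so their Sweedler sum does.\<close>
    have "biannihilates R (\<lambda>a b. q [t] a * q v b)"
      unfolding biannihilates_def
      by (intro conjI allI annihilates_mult_left annihilates_mult_right letter Cons.IH) simp
    then have "annihilates R (\<lambda>w. coprod_sum dU w (\<lambda>a b. q [t] a * q v b))"
      by (rule coideal_annihilates[OF coideal])
    moreover have "q (t # v) = (\<lambda>w. coprod_sum dU w (\<lambda>a b. q [t] a * q v b))"
      by (rule ext) (rule right)
    ultimately show ?case by simp
  qed
qed

section \<open>Structure maps on a presented algebra\<close>

definition (in complex_algebra) lsum :: "('i \<Rightarrow> 'a) \<Rightarrow> 'i list \<Rightarrow> 'a"
  where "lsum g xs = foldr (\<lambda>p z. g p \<oplus> z) xs \<zero>"

context complex_algebra
begin

lemma lsum_simps [simp]: "lsum g [] = \<zero>" "lsum g (p # xs) = g p \<oplus> lsum g xs"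
  by (simp_all add: lsum_def)

lemma lsum_closed [simp]: "(\<And>p. g p \<in> carrier A) \<Longrightarrow> lsum g xs \<in> carrier A"
  by (induction xs) auto

lemma linear_form_lsum:
  "f \<in> linear_forms A \<Longrightarrow> (\<And>p. g p \<in> carrier A) \<Longrightarrow> f (lsum g xs) = (\<Sum>p\<leftarrow>xs. f (g p))"
  by (induction xs) (auto simp: linear_forms_zero linear_forms_add)

end

lemma opposite_simps [simp]:
  "carrier (opposite A) = carrier A" "x \<otimes>\<^bsub>opposite A\<^esub> y = y \<otimes>\<^bsub>A\<^esub> x"
  "\<one>\<^bsub>opposite A\<^esub> = \<one>\<^bsub>A\<^esub>" "\<zero>\<^bsub>opposite A\<^esub> = \<zero>\<^bsub>A\<^esub>"
  "x \<oplus>\<^bsub>opposite A\<^esub> y = x \<oplus>\<^bsub>A\<^esub> y" "c \<odot>\<^bsub>opposite A\<^esub> x = c \<odot>\<^bsub>A\<^esub> x"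
  by (simp_all add: opposite_def)

lemma linear_forms_opposite [simp]: "linear_forms (opposite A) = linear_forms A"
  by (simp add: linear_forms_def)

lemma separated_opposite [simp]: "separated (opposite A) = separated A"
  by (simp add: separated_def)

lemma opposite_complex_algebra:
  assumes "complex_algebra A"
  shows "complex_algebra (opposite A)"
proof -
  interpret complex_algebra A by fact
  show ?thesis
    by (intro complex_algebra.intro ringI abelian_groupI monoidI complex_algebra_axioms.intro)
      (use add.l_inv_ex in \<open>simp_all add: a_ac m_assoc l_distr r_distr smult_l_distr smult_r_distr
        smult_assoc1 smult_mult_l smult_mult_r\<close>)
qed

locale presented =
  fixes R :: "('x list \<Rightarrow>\<^sub>0 complex) set"
begin

abbreviation "P \<equiv> presented_alg R"
abbreviation "cls \<equiv> wclass R"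

sublocale PP: algebra_pair P P
  by (intro algebra_pairI presented_alg_complex_algebra)

sublocale Op: complex_algebra "opposite P"
  by (intro opposite_complex_algebra presented_alg_complex_algebra)

definition coprod_elem where
  "coprod_elem d x = PP.T.lsum (\<lambda>p. PP.tens (cls (fst p)) (cls (snd p))) (d x)"

lemma coprod_elem_closed [simp]: "coprod_elem d x \<in> carrier PP.T"
  by (simp add: coprod_elem_def)

text \<open>The induction varies the form: right multiplication by the rest of the word, and then
  left multiplication by the image of the first letter, are absorbed into \<open>f\<close>.\<close>

lemma linear_form_coprod:
  "f \<in> linear_forms PP.T \<Longrightarrow>
    f (word_eval PP.T (coprod_elem d) w) = coprod_sum d w (\<lambda>a b. f (PP.tens (cls a) (cls b)))"
proof (induction w arbitrary: f)
  case Nil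
  show ?case by (simp add: wclass_Nil PP.tens_one)
next
  case (Cons x w)
  let ?rest = "word_eval PP.T (coprod_elem d) w"
  have "f (coprod_elem d x \<otimes>\<^bsub>PP.T\<^esub> ?rest)
      = (\<Sum>p\<leftarrow>d x. f (PP.tens (cls (fst p)) (cls (snd p)) \<otimes>\<^bsub>PP.T\<^esub> ?rest))"
    unfolding coprod_elem_def[of d x]
    by (rule PP.T.linear_form_lsum[OF PP.T.linear_forms_mult_right[OF Cons.prems]]) simp_all
  also have "\<dots> = (\<Sum>p\<leftarrow>d x. coprod_sum d w (\<lambda>a b.
      f (PP.tens (cls (fst p)) (cls (snd p)) \<otimes>\<^bsub>PP.T\<^esub> PP.tens (cls a) (cls b))))"
    by (subst Cons.IH[OF PP.T.linear_forms_mult_left[OF Cons.prems]]) simp_all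
  finally show ?case
    by (simp add: PP.tens_mult wclass_mult)
qed

text \<open>A form on the tensor square, read on pure tensors of word classes, is a biannihilating
  function. Hence \<open>coideal\<close> says precisely that the proposed images satisfy the
  relations under every form.\<close>

lemma comult_exists:
  assumes "coideal d R"
  obtains D where "D \<in> alg_hom P PP.T" "\<And>x. D (generator R x) = coprod_elem d x"
proof (rule PP.T.presented_alg_hom_exists[of "coprod_elem d" "linear_forms PP.T" R])
  show "z = \<zero>\<^bsub>PP.T\<^esub>" if "z \<in> carrier PP.T" "\<And>f. f \<in> linear_forms PP.T \<Longrightarrow> f z = 0" for z
    using PP.tensor_separated that by (auto simp: separated_def)
  fix r f assume r: "r \<in> R" and f: "f \<in> linear_forms PP.T"
  have "biannihilates R (\<lambda>a b. f (PP.tens (cls a) (cls b)))"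
    unfolding biannihilates_def
    by (intro conjI allI linear_form_annihilates[OF PP.linear_form_tens(1)[OF f]]
        linear_form_annihilates[OF PP.linear_form_tens(2)[OF f]]) simp_all
  with assms r show "lin (\<lambda>w. f (word_eval PP.T (coprod_elem d) w)) r = 0"
    unfolding linear_form_coprod[OF f] by (simp add: coideal_def)
qed (use that in auto)

lemma comult_value:
  assumes "D \<in> alg_hom P PP.T" "\<And>x. D (generator R x) = coprod_elem d x" "f \<in> linear_forms PP.T"
  shows "f (D (cls w)) = coprod_sum d w (\<lambda>a b. f (PP.tens (cls a) (cls b)))"
  using PP.T.alg_hom_wclass[OF assms(1), of w] linear_form_coprod[OF assms(3)] assms(2) by simp

definition anti_elem where
  "anti_elem s x = PP.A.lsum (\<lambda>q. fst q \<odot>\<^bsub>P\<^esub> cls (snd q)) (s x)"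

lemma anti_elem_closed [simp]: "anti_elem s x \<in> carrier P"
  by (simp add: anti_elem_def)

lemma linear_form_anti:
  "f \<in> linear_forms P \<Longrightarrow>
    f (word_eval (opposite P) (anti_elem s) w) = anti_sum s w (\<lambda>u. f (cls u))"
proof (induction w arbitrary: f)
  case Nil
  show ?case by (simp add: wclass_Nil)
next
  case (Cons x w)
  let ?rest = "word_eval (opposite P) (anti_elem s) w"
  have rest: "?rest \<in> carrier P"
    using Op.word_eval_closed[of "anti_elem s" w] by simp
  have "f (?rest \<otimes>\<^bsub>P\<^esub> anti_elem s x) = (\<Sum>q\<leftarrow>s x. f (?rest \<otimes>\<^bsub>P\<^esub> (fst q \<odot>\<^bsub>P\<^esub> cls (snd q))))"
    unfolding anti_elem_def[of s x]
    by (rule PP.A.linear_form_lsum[OF PP.A.linear_forms_mult_left[OF Cons.prems rest]]) simp_all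
  also have "\<dots> = (\<Sum>q\<leftarrow>s x. fst q * f (?rest \<otimes>\<^bsub>P\<^esub> cls (snd q)))"
    using rest by (simp add: PP.A.smult_mult_r linear_forms_smult[OF Cons.prems])
  also have "\<dots> = (\<Sum>q\<leftarrow>s x. fst q * anti_sum s w (\<lambda>u. f (cls u \<otimes>\<^bsub>P\<^esub> cls (snd q))))"
    by (subst Cons.IH[OF PP.A.linear_forms_mult_right[OF Cons.prems]]) simp_all
  finally show ?case
    by (simp add: wclass_mult)
qed

lemma antipode_exists:
  assumes "\<And>f r. annihilates R f \<Longrightarrow> r \<in> R \<Longrightarrow> lin (\<lambda>w. anti_sum s w f) r = 0"
  obtains S where "S \<in> alg_hom P (opposite P)" "\<And>x. S (generator R x) = anti_elem s x"
proof (rule Op.presented_alg_hom_exists[of "anti_elem s" "linear_forms P" R])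
  show "z = \<zero>\<^bsub>opposite P\<^esub>" if "z \<in> carrier (opposite P)" "\<And>f. f \<in> linear_forms P \<Longrightarrow> f z = 0" for z
    using presented_alg_separated[of R] that by (auto simp: separated_def)
  fix r f assume r: "r \<in> R" and f: "f \<in> linear_forms P"
  show "lin (\<lambda>w. f (word_eval (opposite P) (anti_elem s) w)) r = 0"
    unfolding linear_form_anti[OF f] by (rule assms[OF linear_form_annihilates[OF f] r])
qed (use that in auto)

lemma antipode_value:
  assumes "S \<in> alg_hom P (opposite P)" "\<And>x. S (generator R x) = anti_elem s x" "f \<in> linear_forms P"
  shows "f (S (cls w)) = anti_sum s w (\<lambda>u. f (cls u))"
  using Op.alg_hom_wclass[OF assms(1), of w] linear_form_anti[OF assms(3)] assms(2) by simp

lemma wclass_relation: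
  assumes "word u - word v \<in> R"
  shows "cls u = cls v"
proof -
  have "f (cls u \<ominus>\<^bsub>P\<^esub> cls v) = 0" if f: "f \<in> linear_forms P" for f
    using linear_form_annihilates[OF f] assms unfolding annihilates_def
    by (auto simp: PP.A.linear_forms_diff[OF f] dest!: bspec[of _ _ "word u - word v"] spec[of _ "[]"])
  then have "cls u \<ominus>\<^bsub>P\<^esub> cls v = \<zero>\<^bsub>P\<^esub>"
    using presented_alg_separated[of R] by (simp add: separated_def)
  then show ?thesis by simp
qed

text \<open>
  The structure maps are not prescribed on the inverse generators \<open>g\<^sup>-\<^sup>1\<close> and \<open>\<gamma>\<^sup>-\<^sup>1\<close>; their values there
  are forced.
\<close>

lemma alg_hom_inverse_generator:
  assumes B: "complex_algebra B" and h: "h \<in> alg_hom P B" and inv: "cls [y, x] = cls []"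
    and z: "z \<in> carrier B" "h (generator R x) \<otimes>\<^bsub>B\<^esub> z = \<one>\<^bsub>B\<^esub>"
  shows "h (generator R y) = z"
proof -
  interpret B: complex_algebra B by fact
  have "h (generator R y) \<otimes>\<^bsub>B\<^esub> h (generator R x) = \<one>\<^bsub>B\<^esub>"
    using alg_homD(2)[OF h, of "cls [y]" "cls [x]"] alg_homD(4)[OF h] inv
    by (simp add: wclass_mult generator_eq_wclass wclass_Nil)
  then show ?thesis
    using B.inv_unique[of "h (generator R y)" "h (generator R x)" z]
      z alg_homD(1)[OF h, of "cls [x]"] alg_homD(1)[OF h, of "cls [y]"]
    by (simp add: generator_eq_wclass)
qed

end

section \<open>The coproducts, antipodes and relations on words\<close>

primrec uq_coprod :: "uq_gen \<Rightarrow> (uq_gen list \<times> uq_gen list) list" where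
  "uq_coprod U_A = [([U_ginv], [U_A]), ([U_A], [U_g])]"
| "uq_coprod U_Adag = [([U_ginv], [U_Adag]), ([U_Adag], [U_g])]"
| "uq_coprod U_N = [([U_N], []), ([], [U_N])]"
| "uq_coprod U_H = [([U_H], []), ([], [U_H])]"
| "uq_coprod U_g = [([U_g], [U_g])]"
| "uq_coprod U_ginv = [([U_ginv], [U_ginv])]"

primrec uq_eps :: "uq_gen \<Rightarrow> complex" where
  "uq_eps U_A = 0" | "uq_eps U_Adag = 0" | "uq_eps U_N = 0" | "uq_eps U_H = 0" | "uq_eps U_g = 1" | "uq_eps U_ginv = 1"

primrec uq_anti :: "uq_gen \<Rightarrow> (complex \<times> uq_gen list) list" where
  "uq_anti U_A = [(- 1, [U_A])]"
| "uq_anti U_Adag = [(- 1, [U_Adag])]"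
| "uq_anti U_N = [(- 1, [U_N])]"
| "uq_anti U_H = [(- 1, [U_H])]"
| "uq_anti U_g = [(1, [U_ginv])]"
| "uq_anti U_ginv = [(1, [U_g])]"

primrec hq_coprod :: "hq_gen \<Rightarrow> (hq_gen list \<times> hq_gen list) list" where
  "hq_coprod H_alpha = [([], [H_alpha]), ([H_alpha], [H_gamma])]"
| "hq_coprod H_beta = [([], [H_beta]), ([H_alpha], [H_delta]), ([H_beta], [])]"
| "hq_coprod H_gamma = [([H_gamma], [H_gamma])]"
| "hq_coprod H_gammainv = [([H_gammainv], [H_gammainv])]"
| "hq_coprod H_delta = [([H_gamma], [H_delta]), ([H_delta], [])]"

primrec hq_eps :: "hq_gen \<Rightarrow> complex" where
  "hq_eps H_alpha = 0" | "hq_eps H_beta = 0" | "hq_eps H_gamma = 1" | "hq_eps H_gammainv = 1" | "hq_eps H_delta = 0"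

primrec hq_anti :: "hq_gen \<Rightarrow> (complex \<times> hq_gen list) list" where
  "hq_anti H_alpha = [(- 1, [H_gammainv, H_alpha])]"
| "hq_anti H_beta = [(- 1, [H_beta]), (1, [H_gammainv, H_alpha, H_delta])]"
| "hq_anti H_gamma = [(1, [H_gammainv])]"
| "hq_anti H_gammainv = [(1, [H_gamma])]"
| "hq_anti H_delta = [(- 1, [H_gammainv, H_delta])]"

text \<open>Except in the column of \<open>H_gammainv\<close>, the entries are those of the matrices
  of \<open>rho\<close>, with exp(-\<omega> e_13/4) for \<open>U_ginv\<close>. On the group-like
  \<gamma>^(-1) the generators act through a character; N has value -1 because it is primitive and
  has value 1 on \<gamma>.\<close>

primrec uq_tab_letter :: "complex \<Rightarrow> uq_gen \<Rightarrow> hq_gen \<Rightarrow> complex" where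
  "uq_tab_letter \<omega> U_A = (\<lambda>t. if t = H_alpha then 1 else 0)"
| "uq_tab_letter \<omega> U_Adag = (\<lambda>t. if t = H_delta then 1 else 0)"
| "uq_tab_letter \<omega> U_N = (\<lambda>t. if t = H_gamma then 1 else if t = H_gammainv then - 1 else 0)"
| "uq_tab_letter \<omega> U_H = (\<lambda>t. if t = H_beta then 1 else 0)"
| "uq_tab_letter \<omega> U_g = (\<lambda>t. if t = H_beta then \<omega> / 4 else if t = H_gamma \<or> t = H_gammainv then 1 else 0)"
| "uq_tab_letter \<omega> U_ginv = (\<lambda>t. if t = H_beta then - (\<omega> / 4) else if t = H_gamma \<or> t = H_gammainv then 1 else 0)"

definition uq_tab :: "complex \<Rightarrow> uq_gen \<Rightarrow> hq_gen list \<Rightarrow> complex"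
  where "uq_tab \<omega> x v = (case v of [] \<Rightarrow> uq_eps x | t # _ \<Rightarrow> uq_tab_letter \<omega> x t)"

lemma uq_tab_simps [simp]: "uq_tab \<omega> x [] = uq_eps x" "uq_tab \<omega> x (t # v) = uq_tab_letter \<omega> x t"
  by (simp_all add: uq_tab_def)

text \<open>Coassociativity and the counit laws are finite identities on letters that hold before
  any relation is imposed.\<close>

interpretation W: word_pairing uq_coprod uq_eps hq_coprod hq_eps "uq_tab \<omega>" for \<omega>
proof
  show "coassociative uq_coprod"
    unfolding coassociative_def
  proof (intro allI)
    show "(\<Sum>p\<leftarrow>uq_coprod x. coprod_sum uq_coprod (fst p) (\<lambda>a b. F a b (snd p))) = (\<Sum>p\<leftarrow>uq_coprod x. coprod_sum uq_coprod (snd p) (F (fst p)))" for x F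
      by (cases x) simp_all
  qed
  show "coassociative hq_coprod"
    unfolding coassociative_def
  proof (intro allI)
    show "(\<Sum>p\<leftarrow>hq_coprod x. coprod_sum hq_coprod (fst p) (\<lambda>a b. F a b (snd p))) = (\<Sum>p\<leftarrow>hq_coprod x. coprod_sum hq_coprod (snd p) (F (fst p)))" for x F
      by (cases x) simp_all
  qed
  show "counital uq_coprod uq_eps"
    unfolding counital_def by (intro allI, rename_tac x f, case_tac x) simp_all
  show "counital hq_coprod hq_eps"
    unfolding counital_def by (intro allI, rename_tac x f, case_tac x) simp_all
  show "short hq_coprod"
    unfolding short_def by (intro allI, rename_tac x, case_tac x) simp_all
qed simp

lemma short_uq_coprod: "short uq_coprod"
  unfolding short_def by (intro allI, rename_tac x, case_tac x) simp_all

abbreviation "pairing \<equiv> W.pair"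

section \<open>The relations as rewriting rules on words\<close>

lemma uq_relations_ballI:
  assumes "P (word [U_A, U_Adag] - word [U_Adag, U_A]
       - pm_scale (1 / \<omega>) (word [U_g, U_g] - word [U_ginv, U_ginv]))"
    "P (word [U_N, U_A] - word [U_A, U_N] + word [U_A])"
    "P (word [U_N, U_Adag] - word [U_Adag, U_N] - word [U_Adag])"
    "P (word [U_g, U_ginv] - word [])"
    "P (word [U_ginv, U_g] - word [])"
    "\<And>x. P (word [U_H, x] - word [x, U_H])"
    "\<And>x. P (word [U_g, x] - word [x, U_g])"
  shows "\<forall>r \<in> uq_relations \<omega>. P r"
  using assms unfolding uq_relations_def by blast

lemma hq_relations_ballI:
  assumes "P (word [H_gamma, H_gammainv] - word [])"
    "P (word [H_gammainv, H_gamma] - word [])"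
    "P (word [H_alpha, H_beta] - word [H_beta, H_alpha] - pm_scale (\<omega> / 2) (word [H_alpha]))"
    "P (word [H_alpha, H_delta] - word [H_delta, H_alpha])"
    "P (word [H_beta, H_delta] - word [H_delta, H_beta] + pm_scale (\<omega> / 2) (word [H_delta]))"
    "\<And>x. P (word [H_gamma, x] - word [x, H_gamma])"
  shows "\<forall>r \<in> hq_relations \<omega>. P r"
  using assms unfolding hq_relations_def by blast

lemma uq_relations_mem:
  "word [U_A, U_Adag] - word [U_Adag, U_A] - pm_scale (1 / \<omega>) (word [U_g, U_g] - word [U_ginv, U_ginv])
    \<in> uq_relations \<omega>"
  "word [U_N, U_A] - word [U_A, U_N] + word [U_A] \<in> uq_relations \<omega>"
  "word [U_N, U_Adag] - word [U_Adag, U_N] - word [U_Adag] \<in> uq_relations \<omega>"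
  "word [U_g, U_ginv] - word [] \<in> uq_relations \<omega>"
  "word [U_ginv, U_g] - word [] \<in> uq_relations \<omega>"
  "word [U_H, x] - word [x, U_H] \<in> uq_relations \<omega>"
  "word [U_g, x] - word [x, U_g] \<in> uq_relations \<omega>"
  unfolding uq_relations_def by blast+

lemma hq_relations_mem:
  "word [H_gamma, H_gammainv] - word [] \<in> hq_relations \<omega>"
  "word [H_gammainv, H_gamma] - word [] \<in> hq_relations \<omega>"
  "word [H_alpha, H_beta] - word [H_beta, H_alpha] - pm_scale (\<omega> / 2) (word [H_alpha]) \<in> hq_relations \<omega>"
  "word [H_alpha, H_delta] - word [H_delta, H_alpha] \<in> hq_relations \<omega>"
  "word [H_beta, H_delta] - word [H_delta, H_beta] + pm_scale (\<omega> / 2) (word [H_delta]) \<in> hq_relations \<omega>"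
  "word [H_gamma, x] - word [x, H_gamma] \<in> hq_relations \<omega>"
  unfolding hq_relations_def by blast+

lemma annihilatesD:
  "annihilates R f \<Longrightarrow> r \<in> R \<Longrightarrow> lin (\<lambda>w. f (u @ w @ v)) r = 0"
  by (simp add: annihilates_def)

text \<open>Under an annihilating function the relations may be applied inside any context.
  Centrality of \<open>U_ginv\<close> is not among the relations in general and is derived from that
  of \<open>U_g\<close>.\<close>

lemma uq_rules:
  assumes f: "annihilates (uq_relations \<omega>) f"
  shows "f (u @ U_A # U_Adag # v) = f (u @ U_Adag # U_A # v)
      + (f (u @ U_g # U_g # v) - f (u @ U_ginv # U_ginv # v)) / \<omega>"
    and "f (u @ U_N # U_A # v) = f (u @ U_A # U_N # v) - f (u @ U_A # v)"
    and "f (u @ U_N # U_Adag # v) = f (u @ U_Adag # U_N # v) + f (u @ U_Adag # v)"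
    and "f (u @ U_g # U_ginv # v) = f (u @ v)"
    and "f (u @ U_ginv # U_g # v) = f (u @ v)"
    and "f (u @ x # U_H # v) = f (u @ U_H # x # v)"
    and "f (u @ x # U_g # v) = f (u @ U_g # x # v)"
    and "f (u @ x # U_ginv # v) = f (u @ U_ginv # x # v)"
proof -
  note rel = uq_relations_mem[THEN annihilatesD[OF f]]
  show "f (u @ U_A # U_Adag # v) = f (u @ U_Adag # U_A # v)
      + (f (u @ U_g # U_g # v) - f (u @ U_ginv # U_ginv # v)) / \<omega>"
    "f (u @ U_N # U_A # v) = f (u @ U_A # U_N # v) - f (u @ U_A # v)"
    "f (u @ U_N # U_Adag # v) = f (u @ U_Adag # U_N # v) + f (u @ U_Adag # v)"
    using rel(1-3)[of u v] by (simp_all add: algebra_simps diff_divide_distrib)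
  have gg: "f (u @ U_g # U_ginv # v) = f (u @ v)" "f (u @ U_ginv # U_g # v) = f (u @ v)" for u v
    using rel(4,5)[of u v] by simp_all
  have cg: "f (u @ x # U_g # v) = f (u @ U_g # x # v)" for x u v
    using rel(7)[of u v x] by simp
  show "f (u @ U_g # U_ginv # v) = f (u @ v)" "f (u @ U_ginv # U_g # v) = f (u @ v)"
    "f (u @ x # U_g # v) = f (u @ U_g # x # v)"
    by (fact gg cg)+
  show "f (u @ x # U_H # v) = f (u @ U_H # x # v)"
    using rel(6)[of u v x] by simp
  \<comment> \<open>\<open>x g\<^sup>-\<^sup>1 = g\<^sup>-\<^sup>1 g x g\<^sup>-\<^sup>1 = g\<^sup>-\<^sup>1 x\<close>\<close>
  have "f (u @ x # U_ginv # v) = f ((u @ [U_ginv]) @ U_g # x # U_ginv # v)"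
    using gg(2)[of u "x # U_ginv # v"] by simp
  also have "\<dots> = f ((u @ [U_ginv, x]) @ U_g # U_ginv # v)"
    using cg[of "u @ [U_ginv]" x "U_ginv # v"] by simp
  also have "\<dots> = f (u @ U_ginv # x # v)"
    by (subst gg) simp
  finally show "f (u @ x # U_ginv # v) = f (u @ U_ginv # x # v)" .
qed

lemma hq_rules:
  assumes f: "annihilates (hq_relations \<omega>) f"
  shows "f (u @ H_gamma # H_gammainv # v) = f (u @ v)"
    and "f (u @ H_gammainv # H_gamma # v) = f (u @ v)"
    and "f (u @ H_alpha # H_beta # v) = f (u @ H_beta # H_alpha # v) + \<omega> / 2 * f (u @ H_alpha # v)"
    and "f (u @ H_alpha # H_delta # v) = f (u @ H_delta # H_alpha # v)"
    and "f (u @ H_beta # H_delta # v) = f (u @ H_delta # H_beta # v) - \<omega> / 2 * f (u @ H_delta # v)"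
    and "f (u @ x # H_gamma # v) = f (u @ H_gamma # x # v)"
    and "f (u @ x # H_gammainv # v) = f (u @ H_gammainv # x # v)"
proof -
  note rel = hq_relations_mem[THEN annihilatesD[OF f]]
  show "f (u @ H_alpha # H_beta # v) = f (u @ H_beta # H_alpha # v) + \<omega> / 2 * f (u @ H_alpha # v)"
    "f (u @ H_alpha # H_delta # v) = f (u @ H_delta # H_alpha # v)"
    "f (u @ H_beta # H_delta # v) = f (u @ H_delta # H_beta # v) - \<omega> / 2 * f (u @ H_delta # v)"
    using rel(3-5)[of u v] by (simp_all add: algebra_simps)
  have gg: "f (u @ H_gamma # H_gammainv # v) = f (u @ v)" "f (u @ H_gammainv # H_gamma # v) = f (u @ v)" for u v
    using rel(1,2)[of u v] by simp_all
  have cg: "f (u @ x # H_gamma # v) = f (u @ H_gamma # x # v)" for x u v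
    using rel(6)[of u v x] by simp
  show "f (u @ H_gamma # H_gammainv # v) = f (u @ v)" "f (u @ H_gammainv # H_gamma # v) = f (u @ v)"
    "f (u @ x # H_gamma # v) = f (u @ H_gamma # x # v)"
    by (fact gg cg)+
  \<comment> \<open>As for g: \<gamma>^(-1)\<gamma> is inserted on the left, \<gamma> is moved past
    \<open>x\<close>, and it cancels against the \<gamma>^(-1) behind \<open>x\<close>.\<close>
  have "f (u @ x # H_gammainv # v) = f ((u @ [H_gammainv]) @ H_gamma # x # H_gammainv # v)"
    using gg(2)[of u "x # H_gammainv # v"] by simp
  also have "\<dots> = f ((u @ [H_gammainv, x]) @ H_gamma # H_gammainv # v)"
    using cg[of "u @ [H_gammainv]" x "H_gammainv # v"] by simp
  also have "\<dots> = f (u @ H_gammainv # x # v)"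
    by (subst gg) simp
  finally show "f (u @ x # H_gammainv # v) = f (u @ H_gammainv # x # v)" .
qed

text \<open>
  The instances that form a terminating rewrite system: rules that exchange two letters are only kept
  in one direction.
\<close>

lemmas uq_rules_oriented = uq_rules(1-5) uq_rules(6)[where x = U_A] uq_rules(6)[where x = U_Adag]
  uq_rules(6)[where x = U_N] uq_rules(6)[where x = U_g] uq_rules(6)[where x = U_ginv]
  uq_rules(7)[where x = U_A] uq_rules(7)[where x = U_Adag] uq_rules(7)[where x = U_N]
  uq_rules(8)[where x = U_A] uq_rules(8)[where x = U_Adag] uq_rules(8)[where x = U_N]

lemmas hq_rules_oriented = hq_rules(1-5) hq_rules(6)[where x = H_alpha] hq_rules(6)[where x = H_beta]
  hq_rules(6)[where x = H_delta] hq_rules(7)[where x = H_alpha] hq_rules(7)[where x = H_beta]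
  hq_rules(7)[where x = H_delta]

lemmas uq_rules_0 = uq_rules_oriented[where u = "[]", unfolded append_Nil]

text \<open>A pattern \<open>u @ x # v\<close> does not match a concrete list, so the prefixes are
  spelled out. Long ones occur because the antipode of \<open>H_beta\<close> has a term of three
  letters; the image of the word \<beta>\<delta>, for instance, contains a word of five
  letters.\<close>

lemmas hq_rules_context =
  hq_rules_oriented[where u = "[]", unfolded append_Nil]
  hq_rules_oriented[where u = "[a]" for a, unfolded append_Cons append_Nil]
  hq_rules_oriented[where u = "[a, b]" for a b, unfolded append_Cons append_Nil]
  hq_rules_oriented[where u = "[a, b, c]" for a b c, unfolded append_Cons append_Nil]
  hq_rules_oriented[where u = "[a, b, c, d]" for a b c d, unfolded append_Cons append_Nil]

text \<open>In \<Delta>[A, A^dagger] the mixed terms cancel since g is central. What remains, g^(-2)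
  \<otimes> (g^2 - g^(-2)) + (g^2 - g^(-2)) \<otimes> g^2 divided by \<omega>, telescopes to (g^2
  \<otimes> g^2 - g^(-2) \<otimes> g^(-2))/\<omega>.\<close>

lemma coideal_uq: "coideal uq_coprod (uq_relations \<omega>)"
  unfolding coideal_def
proof (intro allI impI)
  fix F assume F: "biannihilates (uq_relations \<omega>) F"
  then have l: "annihilates (uq_relations \<omega>) (\<lambda>x. F x y)" and r: "annihilates (uq_relations \<omega>) (F x)" for x y
    by (auto simp: biannihilates_def)
  note rules = uq_rules_0[OF l] uq_rules_0[OF r]
  show "\<forall>r \<in> uq_relations \<omega>. lin (\<lambda>w. coprod_sum uq_coprod w F) r = 0"
  proof (rule uq_relations_ballI)
    show "lin (\<lambda>w. coprod_sum uq_coprod w F) (word [U_H, x] - word [x, U_H]) = 0" for x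
      by (cases x) (simp_all add: rules)
    show "lin (\<lambda>w. coprod_sum uq_coprod w F) (word [U_g, x] - word [x, U_g]) = 0" for x
      by (cases x) (simp_all add: rules)
  qed (simp_all add: rules algebra_simps add_divide_distrib diff_divide_distrib)
qed

text \<open>The term \<alpha> \<otimes> \<delta> of \<Delta>\<beta> contributes nothing to the
  commutators with \<Delta>\<alpha> and \<Delta>\<delta>, because \<alpha> and \<delta> commute and
  \<gamma> is central.\<close>

lemma coideal_hq: "coideal hq_coprod (hq_relations \<omega>)"
  unfolding coideal_def
proof (intro allI impI)
  fix F assume F: "biannihilates (hq_relations \<omega>) F"
  then have l: "annihilates (hq_relations \<omega>) (\<lambda>x. F x y)" and r: "annihilates (hq_relations \<omega>) (F x)" for x y
    by (auto simp: biannihilates_def)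
  note rules = hq_rules_oriented[where u = "[]", unfolded append_Nil, OF l]
    hq_rules_oriented[where u = "[]", unfolded append_Nil, OF r]
  show "\<forall>r \<in> hq_relations \<omega>. lin (\<lambda>w. coprod_sum hq_coprod w F) r = 0"
  proof (rule hq_relations_ballI)
    show "lin (\<lambda>w. coprod_sum hq_coprod w F) (word [H_gamma, x] - word [x, H_gamma]) = 0" for x
      by (cases x) (simp_all add: rules)
  qed (simp_all add: rules algebra_simps)
qed

text \<open>In the first relation reversal changes the sign of the commutator, and exchanging
  \<open>U_g\<close> with \<open>U_ginv\<close> changes the sign of the other term.\<close>

lemma anti_relations_uq:
  assumes f: "annihilates (uq_relations \<omega>) f" and r: "r \<in> uq_relations \<omega>"
  shows "lin (\<lambda>w. anti_sum uq_anti w f) r = 0"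
proof -
  note rules = uq_rules_0[OF f]
  have "\<forall>r \<in> uq_relations \<omega>. lin (\<lambda>w. anti_sum uq_anti w f) r = 0"
  proof (rule uq_relations_ballI)
    show "lin (\<lambda>w. anti_sum uq_anti w f) (word [U_H, x] - word [x, U_H]) = 0" for x
      by (cases x) (simp_all add: rules)
    show "lin (\<lambda>w. anti_sum uq_anti w f) (word [U_g, x] - word [x, U_g]) = 0" for x
      by (cases x) (simp_all add: rules)
  qed (simp_all add: rules algebra_simps add_divide_distrib diff_divide_distrib)
  with r show ?thesis by blast
qed

lemma anti_relations_hq:
  assumes f: "annihilates (hq_relations \<omega>) f" and r: "r \<in> hq_relations \<omega>"
  shows "lin (\<lambda>w. anti_sum hq_anti w f) r = 0"
proof -
  note rules = hq_rules_context[OF f]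
  have "\<forall>r \<in> hq_relations \<omega>. lin (\<lambda>w. anti_sum hq_anti w f) r = 0"
  proof (rule hq_relations_ballI)
    show "lin (\<lambda>w. anti_sum hq_anti w f) (word [H_gamma, x] - word [x, H_gamma]) = 0" for x
      by (cases x) (simp_all add: rules)
  qed (simp_all add: rules algebra_simps)
  with r show ?thesis by blast
qed

section \<open>The pairing of words vanishes on both sets of relations\<close>

lemma pairing_append_right: "pairing \<omega> (v @ v') w = coprod_sum uq_coprod w (\<lambda>a b. pairing \<omega> v a * pairing \<omega> v' b)"
  by (rule W.pair_append_right)

lemma pairing_append_left: "pairing \<omega> v (w @ w') = coprod_sum hq_coprod v (\<lambda>a b. pairing \<omega> a w * pairing \<omega> b w')"
  by (rule W.pair_append_left)

text \<open>For a letter \<open>t\<close> this says that the matrices of \<open>rho\<close>, and the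
  character belonging to \<gamma>^(-1), satisfy the relations. At \<beta> the commutator of A and
  A^dagger gives 1, while g^2 and g^(-2) give \<omega>/2 and -\<omega>/2; division by \<omega>
  restores 1.\<close>

lemma pairing_short_relations_uq:
  assumes \<omega>: "\<omega> \<noteq> 0" and c: "length c \<le> 1" and r: "r \<in> uq_relations \<omega>"
  shows "lin (pairing \<omega> c) r = 0"
proof -
  have nil: "\<forall>r \<in> uq_relations \<omega>. lin (pairing \<omega> []) r = 0"
  proof (rule uq_relations_ballI)
    show "lin (pairing \<omega> []) (word [U_H, x] - word [x, U_H]) = 0"
      "lin (pairing \<omega> []) (word [U_g, x] - word [x, U_g]) = 0" for x
      by simp_all
  qed simp_all
  have letter: "\<forall>r \<in> uq_relations \<omega>. lin (pairing \<omega> [t]) r = 0" for t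
  proof (rule uq_relations_ballI)
    show "lin (pairing \<omega> [t]) (word [U_H, x] - word [x, U_H]) = 0"
      "lin (pairing \<omega> [t]) (word [U_g, x] - word [x, U_g]) = 0" for x
      by (cases t; cases x; simp add: W.pair_single del: W.pair.simps)+
  qed (cases t; simp add: W.pair_single \<omega> del: W.pair.simps)+
  show ?thesis
    using length_le_1_cases[OF c] nil letter r by blast
qed

text \<open>Here the twisted coproducts matter: the pairing of A with \<alpha>\<beta> is \<omega>/4,
  from g on \<beta>, and with \<beta>\<alpha> it is -\<omega>/4, from the inverse of g on \<beta>.
  Their difference is the constant \<omega>/2 of the relation; A^dagger and \<delta> behave
  likewise.\<close>

lemma pairing_short_relations_hq:
  assumes \<omega>: "\<omega> \<noteq> 0" and c: "length c \<le> 1" and r: "r \<in> hq_relations \<omega>"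
  shows "lin (\<lambda>v. pairing \<omega> v c) r = 0"
proof -
  have nil: "\<forall>r \<in> hq_relations \<omega>. lin (\<lambda>v. pairing \<omega> v []) r = 0"
  proof (rule hq_relations_ballI)
    show "lin (\<lambda>v. pairing \<omega> v []) (word [H_gamma, x] - word [x, H_gamma]) = 0" for x
      by simp
  qed simp_all
  have letter: "\<forall>r \<in> hq_relations \<omega>. lin (\<lambda>v. pairing \<omega> v [x]) r = 0" for x
  proof (rule hq_relations_ballI)
    show "lin (\<lambda>v. pairing \<omega> v [x]) (word [H_gamma, t] - word [t, H_gamma]) = 0" for t
      by (cases x; cases t; simp)
  qed (cases x; simp)+
  show ?thesis
    using length_le_1_cases[OF c] nil letter r by blast
qed

lemma pairing_annihilates_uq:
  assumes "\<omega> \<noteq> 0"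
  shows "annihilates (uq_relations \<omega>) (pairing \<omega> v)"
proof (rule annihilates_pairing[where dH = hq_coprod and dU = uq_coprod])
  show "pairing \<omega> (t # v) w = coprod_sum uq_coprod w (\<lambda>a b. pairing \<omega> [t] a * pairing \<omega> v b)" for t v w
    using pairing_append_right[of \<omega> "[t]" v w] by (simp only: append_Cons append_Nil)
qed (use W.shortH coideal_uq pairing_short_relations_uq[OF assms] in \<open>auto simp only: pairing_append_left\<close>)

lemma pairing_annihilates_hq:
  assumes "\<omega> \<noteq> 0"
  shows "annihilates (hq_relations \<omega>) (\<lambda>v. pairing \<omega> v w)"
proof (rule annihilates_pairing[where dH = uq_coprod and dU = hq_coprod and q = "\<lambda>w v. pairing \<omega> v w"])
  show "pairing \<omega> v (x # w) = coprod_sum hq_coprod v (\<lambda>a b. pairing \<omega> a [x] * pairing \<omega> b w)" for x v w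
    using pairing_append_left[of \<omega> v "[x]" w] by (simp only: append_Cons append_Nil)
qed (use short_uq_coprod coideal_hq pairing_short_relations_hq[OF assms] in \<open>auto simp only: pairing_append_right\<close>)

section \<open>The antipode axiom for the pairing of words\<close>

lemma anti_comult_uq: "anti_comult uq_anti uq_coprod"
  unfolding anti_comult_def by (intro allI, rename_tac x F, case_tac x) simp_all

lemma pairing_antipode_Nil: "anti_sum uq_anti w (pairing \<omega> []) = pairing \<omega> [] w"
proof (induction w)
  case (Cons x w)
  have "anti_sum uq_anti w (\<lambda>z. prod_list (map uq_eps z) * c) = prod_list (map uq_eps w) * c" for c
    using Cons by (simp add: anti_sum_mult_right)
  then show ?case by (cases x) simp_all
qed simp

text \<open>At least two letters are required on the left, so that the rule does not apply to its
  own factors with a single letter and rewriting terminates.\<close>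

lemma pairing_cons_letter:
  "pairing \<omega> (t # s # v) [x] = (\<Sum>p\<leftarrow>uq_coprod x. pairing \<omega> [t] (fst p) * pairing \<omega> (s # v) (snd p))"
  using pairing_append_right[of \<omega> "[t]" "s # v" "[x]"] by (simp del: W.pair.simps)

lemma pairing_Nil_letter: "pairing \<omega> [] [x] = uq_eps x"
  by simp

text \<open>By induction on \<open>w\<close> the antipode of \<open>x # w\<close> is split along the
  coproduct of \<open>t\<close>, which leaves one identity for each pair of a letter
  \<open>t\<close> and a generator \<open>x\<close>. It expresses that the antipode of
  \<open>Hq\<close> reverses the coproduct of \<open>t\<close>, and therefore needs the relations,
  here applied to the function \<open>\<lambda>v. pairing \<omega> v w\<close>.\<close>

lemma pairing_antipode_letter:
  assumes "\<omega> \<noteq> 0"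
  shows "anti_sum uq_anti w (pairing \<omega> [t]) = anti_sum hq_anti [t] (\<lambda>v. pairing \<omega> v w)"
proof (induction w arbitrary: t)
  case Nil
  show ?case by (cases t) (simp_all add: W.pair_Nil_right del: W.pair.simps)
next
  case (Cons x w)
  note rules = hq_rules_context[OF pairing_annihilates_hq[OF assms]]
  have split: "pairing \<omega> v (x # w) = coprod_sum hq_coprod v (\<lambda>a b. pairing \<omega> a [x] * pairing \<omega> b w)" for v x
    using pairing_append_left[of \<omega> v "[x]" w] by (simp only: append_Cons append_Nil)
  \<comment> \<open>The antipode reverses products, so the image \<open>u\<close> of the first
    letter stands on the right and its pairing leaves the sum as a factor.\<close>
  have left: "anti_sum uq_anti w (\<lambda>z. pairing \<omega> [t] (z @ u)) =
      (\<Sum>p\<leftarrow>hq_coprod t. anti_sum uq_anti w (pairing \<omega> (fst p)) * pairing \<omega> (snd p) u)" for u t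
    by (simp add: pairing_append_left anti_sum_sum_list anti_sum_mult_right del: W.pair.simps)
  show ?case
    by (cases t; cases x; simp add: left split Cons.IH pairing_antipode_Nil W.pair_letters W.pair_Nil_right
        pairing_cons_letter pairing_Nil_letter rules del: W.pair.simps)
qed

text \<open>Splitting off the letter \<open>t\<close> produces the coproduct of the antipode of
  \<open>w\<close>, which \<open>anti_comult_uq\<close> turns into antipodes of the legs in reversed
  order. This reversal is the one by which the antipode of \<open>t # v\<close> places the image of
  \<open>t\<close> last.\<close>

lemma pairing_antipode:
  assumes "\<omega> \<noteq> 0"
  shows "anti_sum uq_anti w (pairing \<omega> v) = anti_sum hq_anti v (\<lambda>v. pairing \<omega> v w)"
proof (induction v arbitrary: w)
  case Nil
  show ?case by (simp add: pairing_antipode_Nil del: W.pair.simps)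
next
  case (Cons t v)
  have "anti_sum uq_anti w (pairing \<omega> (t # v)) = anti_sum uq_anti w (\<lambda>z. coprod_sum uq_coprod z (\<lambda>a b. pairing \<omega> [t] a * pairing \<omega> v b))"
  proof -
    have "pairing \<omega> (t # v) = (\<lambda>z. coprod_sum uq_coprod z (\<lambda>a b. pairing \<omega> [t] a * pairing \<omega> v b))"
      using pairing_append_right[of \<omega> "[t]" v] by (intro ext) (simp only: append_Cons append_Nil)
    then show ?thesis by simp
  qed
  also have "\<dots> = coprod_sum uq_coprod w (\<lambda>a b. anti_sum uq_anti a (pairing \<omega> v) * anti_sum uq_anti b (pairing \<omega> [t]))"
    by (simp add: anti_sum_anti_comult[OF anti_comult_uq] anti_sum_mult anti_sum_mult_right mult.commute
        del: W.pair.simps)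
  also have "\<dots> = coprod_sum uq_coprod w (\<lambda>a b. anti_sum hq_anti v (\<lambda>v. pairing \<omega> v a) *
      (\<Sum>q\<leftarrow>hq_anti t. fst q * pairing \<omega> (snd q) b))"
    by (simp add: Cons.IH pairing_antipode_letter[OF assms] del: W.pair.simps)
  also have "\<dots> = (\<Sum>q\<leftarrow>hq_anti t. fst q * coprod_sum uq_coprod w (\<lambda>a b. anti_sum hq_anti v (\<lambda>v. pairing \<omega> v a) *
      pairing \<omega> (snd q) b))"
    unfolding coprod_sum_mult[symmetric] coprod_sum_sum_list[symmetric] sum_list_const_mult[symmetric]
    by (simp only: mult_ac)
  also have "\<dots> = anti_sum hq_anti (t # v) (\<lambda>v. pairing \<omega> v w)"
    by (simp add: pairing_append_right anti_sum_coprod_sum anti_sum_mult_right del: W.pair.simps)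
  finally show ?case .
qed

section \<open>The structure maps of the two Hopf algebras\<close>

interpretation U: presented "uq_relations \<omega>" for \<omega> .
interpretation H: presented "hq_relations \<omega>" for \<omega> .

section \<open>The target algebras of the counits and of the matrix representation\<close>

lemma complex_alg_simps [simp]:
  "carrier complex_alg = UNIV" "x \<otimes>\<^bsub>complex_alg\<^esub> y = x * y" "\<one>\<^bsub>complex_alg\<^esub> = 1"
  "\<zero>\<^bsub>complex_alg\<^esub> = 0" "x \<oplus>\<^bsub>complex_alg\<^esub> y = x + y" "c \<odot>\<^bsub>complex_alg\<^esub> x = c * x"
  by (simp_all add: complex_alg_def)

lemma complex_alg_complex_algebra: "complex_algebra complex_alg"
proof (intro complex_algebra.intro ringI abelian_groupI monoidI complex_algebra_axioms.intro)
  show "\<exists>y \<in> carrier complex_alg. y \<oplus>\<^bsub>complex_alg\<^esub> x = \<zero>\<^bsub>complex_alg\<^esub>" for x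
    by (intro bexI[of _ "- x"]) simp_all
qed (simp_all add: algebra_simps)

interpretation C: complex_algebra complex_alg
  by (rule complex_alg_complex_algebra)

lemma word_eval_complex_alg: "word_eval complex_alg \<epsilon> w = eps_word \<epsilon> w"
  by (induction w) auto

lemma mat3_alg_simps [simp]:
  "carrier mat3_alg = UNIV" "x \<otimes>\<^bsub>mat3_alg\<^esub> y = x ** y" "\<one>\<^bsub>mat3_alg\<^esub> = mat 1"
  "\<zero>\<^bsub>mat3_alg\<^esub> = 0" "x \<oplus>\<^bsub>mat3_alg\<^esub> y = x + y"
  "c \<odot>\<^bsub>mat3_alg\<^esub> x = (\<chi> i j. c * x $ i $ j)"
  by (simp_all add: mat3_alg_def)

lemma mat3_alg_complex_algebra: "complex_algebra mat3_alg"
proof (intro complex_algebra.intro ringI abelian_groupI monoidI complex_algebra_axioms.intro)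
  show "\<exists>y \<in> carrier mat3_alg. y \<oplus>\<^bsub>mat3_alg\<^esub> x = \<zero>\<^bsub>mat3_alg\<^esub>" for x
    by (intro bexI[of _ "- x"]) auto
  show "(x \<oplus>\<^bsub>mat3_alg\<^esub> y) \<otimes>\<^bsub>mat3_alg\<^esub> z = x \<otimes>\<^bsub>mat3_alg\<^esub> z \<oplus>\<^bsub>mat3_alg\<^esub> y \<otimes>\<^bsub>mat3_alg\<^esub> z"
    "z \<otimes>\<^bsub>mat3_alg\<^esub> (x \<oplus>\<^bsub>mat3_alg\<^esub> y) = z \<otimes>\<^bsub>mat3_alg\<^esub> x \<oplus>\<^bsub>mat3_alg\<^esub> z \<otimes>\<^bsub>mat3_alg\<^esub> y"
    "(c \<odot>\<^bsub>mat3_alg\<^esub> x) \<otimes>\<^bsub>mat3_alg\<^esub> y = c \<odot>\<^bsub>mat3_alg\<^esub> (x \<otimes>\<^bsub>mat3_alg\<^esub> y)"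
    "x \<otimes>\<^bsub>mat3_alg\<^esub> (c \<odot>\<^bsub>mat3_alg\<^esub> y) = c \<odot>\<^bsub>mat3_alg\<^esub> (x \<otimes>\<^bsub>mat3_alg\<^esub> y)" for x y z c
    by (simp_all add: vec_eq_iff matrix_matrix_mult_def sum_3 algebra_simps)
qed (simp_all add: matrix_mul_assoc algebra_simps vec_eq_iff)

interpretation M3: complex_algebra mat3_alg
  by (rule mat3_alg_complex_algebra)

definition mat_scale :: "complex \<Rightarrow> complex ^ 3 ^ 3 \<Rightarrow> complex ^ 3 ^ 3"
  where "mat_scale c A = (\<chi> i j. c * A $ i $ j)"

text \<open>The value at \<open>U_ginv\<close> is the inverse of the value at \<open>U_g\<close>
  because e_13 squares to zero.\<close>

primrec rho_gen :: "complex \<Rightarrow> uq_gen \<Rightarrow> complex ^ 3 ^ 3" where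
  "rho_gen \<omega> U_A = mat_unit 1 2"
| "rho_gen \<omega> U_Adag = mat_unit 2 3"
| "rho_gen \<omega> U_N = mat_unit 2 2"
| "rho_gen \<omega> U_H = mat_unit 1 3"
| "rho_gen \<omega> U_g = mat 1 + mat_scale (\<omega> / 4) (mat_unit 1 3)"
| "rho_gen \<omega> U_ginv = mat 1 + mat_scale (- \<omega> / 4) (mat_unit 1 3)"

lemma mat_unit_mult: "mat_unit i j ** mat_unit k l = (if j = k then mat_unit i l else 0)"
  by (simp add: mat_unit_def matrix_matrix_mult_def vec_eq_iff if_distrib[of "\<lambda>x. x * _"]
      sum.delta cong: if_cong)

lemma matrix_add_rdistrib3: "((A :: complex ^ 3 ^ 3) + B) ** C = A ** C + B ** C"
  by (simp add: matrix_matrix_mult_def vec_eq_iff sum_3 algebra_simps)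

lemma mat_scale_simps:
  "mat_scale c A ** B = mat_scale c (A ** B)" "A ** mat_scale c B = mat_scale c (A ** B)"
  "mat_scale c 0 = 0" "mat_scale c A $ i $ j = c * A $ i $ j"
  by (simp_all add: mat_scale_def matrix_matrix_mult_def vec_eq_iff sum_3 algebra_simps)

text \<open>Relations are checked entrywise, the matrix entries being a separating family. For the
  commutator, e_12 e_23 = e_13 must equal 1/\<omega> times the difference \<omega> e_13 of the
  squares of g and its inverse.\<close>

lemma rho_generators:
  assumes \<omega>: "\<omega> \<noteq> 0"
  shows "rho \<omega> (ugen \<omega> U_A) = mat_unit 1 2 \<and> rho \<omega> (ugen \<omega> U_Adag) = mat_unit 2 3 \<and>
    rho \<omega> (ugen \<omega> U_H) = mat_unit 1 3 \<and> rho \<omega> (ugen \<omega> U_N) = mat_unit 2 2"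
proof -
  note matrix = mat_unit_mult matrix_add_ldistrib matrix_add_rdistrib3 mat_scale_simps
  have rel: "\<forall>r \<in> uq_relations \<omega>. lin (\<lambda>w. word_eval mat3_alg (rho_gen \<omega>) w $ i $ j) r = 0" for i j
  proof (rule uq_relations_ballI)
    show "lin (\<lambda>w. word_eval mat3_alg (rho_gen \<omega>) w $ i $ j) (word [U_H, x] - word [x, U_H]) = 0"
      "lin (\<lambda>w. word_eval mat3_alg (rho_gen \<omega>) w $ i $ j) (word [U_g, x] - word [x, U_g]) = 0" for x
      by (cases x; simp add: matrix algebra_simps)+
  qed (use \<omega> in \<open>simp_all add: matrix algebra_simps\<close>)
  obtain h where "h \<in> alg_hom (presented_alg (uq_relations \<omega>)) mat3_alg"
    "\<And>x. h (generator (uq_relations \<omega>) x) = rho_gen \<omega> x"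
  proof (rule M3.presented_alg_hom_exists[of "rho_gen \<omega>" "{\<lambda>M. M $ i $ j | i j. True}" "uq_relations \<omega>"])
    show "{\<lambda>M. M $ i $ j | i j. True} \<subseteq> linear_forms mat3_alg"
      by (auto simp: linear_forms_def)
    show "z = \<zero>\<^bsub>mat3_alg\<^esub>" if "\<And>f. f \<in> {\<lambda>M. M $ i $ j | i j. True} \<Longrightarrow> f z = 0" for z
      using that by (force simp: vec_eq_iff)
  qed (use rel in auto)
  then have "h \<in> alg_hom (Uq \<omega>) mat3_alg \<and> h (ugen \<omega> U_A) = mat_unit 1 2 \<and>
    h (ugen \<omega> U_Adag) = mat_unit 2 3 \<and> h (ugen \<omega> U_H) = mat_unit 1 3 \<and>
    h (ugen \<omega> U_N) = mat_unit 2 2 \<and>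
    h (ugen \<omega> U_g) = mat 1 \<oplus>\<^bsub>mat3_alg\<^esub> (\<omega> / 4) \<odot>\<^bsub>mat3_alg\<^esub> mat_unit 1 3"
    by (simp add: Uq_def ugen_def mat_scale_def)
  from someI[of "\<lambda>r. r \<in> alg_hom (Uq \<omega>) mat3_alg \<and> r (ugen \<omega> U_A) = mat_unit 1 2 \<and>
    r (ugen \<omega> U_Adag) = mat_unit 2 3 \<and> r (ugen \<omega> U_H) = mat_unit 1 3 \<and>
    r (ugen \<omega> U_N) = mat_unit 2 2 \<and>
    r (ugen \<omega> U_g) = mat 1 \<oplus>\<^bsub>mat3_alg\<^esub> (\<omega> / 4) \<odot>\<^bsub>mat3_alg\<^esub> mat_unit 1 3", OF this, folded rho_def]
  show ?thesis by blast
qed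

section \<open>Counits, coproducts and antipodes on generators\<close>

lemma tmat_simps:
  "tmat \<omega> 1 1 = wclass (hq_relations \<omega>) []" "tmat \<omega> 1 2 = wclass (hq_relations \<omega>) [H_alpha]"
  "tmat \<omega> 1 3 = wclass (hq_relations \<omega>) [H_beta]" "tmat \<omega> 2 1 = \<zero>\<^bsub>presented_alg (hq_relations \<omega>)\<^esub>"
  "tmat \<omega> 2 2 = wclass (hq_relations \<omega>) [H_gamma]" "tmat \<omega> 2 3 = wclass (hq_relations \<omega>) [H_delta]"
  "tmat \<omega> 3 1 = \<zero>\<^bsub>presented_alg (hq_relations \<omega>)\<^esub>" "tmat \<omega> 3 2 = \<zero>\<^bsub>presented_alg (hq_relations \<omega>)\<^esub>"
  "tmat \<omega> 3 3 = wclass (hq_relations \<omega>) []"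
  by (simp_all add: tmat_def Hq_def hgen_def generator_eq_wclass wclass_Nil)

lemma uq_inverse:
  "wclass (uq_relations \<omega>) [U_ginv, U_g] = wclass (uq_relations \<omega>) []"
  "wclass (uq_relations \<omega>) [U_g, U_ginv] = wclass (uq_relations \<omega>) []"
  by (intro U.wclass_relation uq_relations_mem)+

lemma hq_inverse:
  "wclass (hq_relations \<omega>) [H_gammainv, H_gamma] = wclass (hq_relations \<omega>) []"
  "wclass (hq_relations \<omega>) [H_gamma, H_gammainv] = wclass (hq_relations \<omega>) []"
  by (intro H.wclass_relation hq_relations_mem)+

text \<open>The pattern for counits, coproducts and antipodes alike: the presentation provides some
  map with the prescribed values, so the one chosen by \<open>SOME\<close> has them too; its value
  at the inverse generator is then forced. Multiplicativity extends the values to words.\<close>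

lemma counit_uq: "Uq_counit \<omega> (wclass (uq_relations \<omega>) w) = eps_word uq_eps w"
  and counit_uq_hom: "Uq_counit \<omega> \<in> alg_hom (presented_alg (uq_relations \<omega>)) complex_alg"
proof -
  let ?Q = "\<lambda>E. E \<in> alg_hom (Uq \<omega>) complex_alg \<and>
    (\<forall>y \<in> {U_A, U_Adag, U_N, U_H}. E (ugen \<omega> y) = 0) \<and> E (ugen \<omega> U_g) = 1"
  have rel: "\<forall>r \<in> uq_relations \<omega>. lin (eps_word uq_eps) r = 0"
    by (rule uq_relations_ballI) simp_all
  obtain h where "h \<in> alg_hom (presented_alg (uq_relations \<omega>)) complex_alg"
    "\<And>x. h (generator (uq_relations \<omega>) x) = uq_eps x"
    by (rule C.presented_alg_hom_exists[of uq_eps "{\<lambda>z. z}" "uq_relations \<omega>"])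
      (use rel in \<open>auto simp: linear_forms_def word_eval_complex_alg\<close>)
  then have "?Q h"
    by (simp add: Uq_def ugen_def)
  from someI[of ?Q, OF this, folded Uq_counit_def]
  have E: "?Q (Uq_counit \<omega>)" .
  then show hom: "Uq_counit \<omega> \<in> alg_hom (presented_alg (uq_relations \<omega>)) complex_alg"
    by (simp add: Uq_def)
  have "Uq_counit \<omega> (generator (uq_relations \<omega>) U_ginv) = 1"
    by (rule U.alg_hom_inverse_generator[OF C.complex_algebra_axioms hom uq_inverse(1)])
      (use E in \<open>simp_all add: ugen_def\<close>)
  then have "Uq_counit \<omega> (generator (uq_relations \<omega>) x) = uq_eps x" for x
    using E by (cases x) (simp_all add: ugen_def)
  then show "Uq_counit \<omega> (wclass (uq_relations \<omega>) w) = eps_word uq_eps w"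
    using C.alg_hom_wclass[OF hom, of w] by (simp add: word_eval_complex_alg)
qed

lemma counit_hq: "Hq_counit \<omega> (wclass (hq_relations \<omega>) w) = eps_word hq_eps w"
  and counit_hq_hom: "Hq_counit \<omega> \<in> alg_hom (presented_alg (hq_relations \<omega>)) complex_alg"
proof -
  let ?Q = "\<lambda>E. E \<in> alg_hom (Hq \<omega>) complex_alg \<and> (\<forall>i j. E (tmat \<omega> i j) = (if i = j then 1 else 0))"
  have rel: "\<forall>r \<in> hq_relations \<omega>. lin (eps_word hq_eps) r = 0"
    by (rule hq_relations_ballI) simp_all
  obtain h where h: "h \<in> alg_hom (presented_alg (hq_relations \<omega>)) complex_alg"
    and gen: "\<And>x. h (generator (hq_relations \<omega>) x) = hq_eps x"
    by (rule C.presented_alg_hom_exists[of hq_eps "{\<lambda>z. z}" "hq_relations \<omega>"])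
      (use rel in \<open>auto simp: linear_forms_def word_eval_complex_alg\<close>)
  \<comment> \<open>Linearity supplies the value 0 at the zero entries of \<open>tmat\<close> below
    the diagonal.\<close>
  have "h \<in> linear_forms (presented_alg (hq_relations \<omega>))"
    using linear_forms_alg_hom[OF h, of "\<lambda>z. z"] by (simp add: linear_forms_def)
  then have "h (tmat \<omega> i j) = (if i = j then 1 else 0)" for i j
    using exhaust_3[of i] exhaust_3[of j] gen alg_homD(4)[OF h]
    by (elim disjE; simp add: tmat_simps generator_eq_wclass wclass_Nil H.PP.A.linear_forms_zero)
  with h have "?Q h"
    by (simp add: Hq_def)
  from someI[of ?Q, OF this, folded Hq_counit_def]
  have E: "?Q (Hq_counit \<omega>)" .
  then show hom: "Hq_counit \<omega> \<in> alg_hom (presented_alg (hq_relations \<omega>)) complex_alg"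
    by (simp add: Hq_def)
  have t: "Hq_counit \<omega> (tmat \<omega> i j) = (if i = j then 1 else 0)" for i j
    using E by blast
  note vals = t[of 1 2] t[of 1 3] t[of 2 2] t[of 2 3]
  have "Hq_counit \<omega> (generator (hq_relations \<omega>) H_gammainv) = 1"
    by (rule H.alg_hom_inverse_generator[OF C.complex_algebra_axioms hom hq_inverse(1)])
      (use vals in \<open>simp_all add: tmat_simps generator_eq_wclass\<close>)
  then have "Hq_counit \<omega> (generator (hq_relations \<omega>) x) = hq_eps x" for x
    using vals by (cases x) (simp_all add: tmat_simps generator_eq_wclass)
  then show "Hq_counit \<omega> (wclass (hq_relations \<omega>) w) = eps_word hq_eps w"
    using C.alg_hom_wclass[OF hom, of w] by (simp add: word_eval_complex_alg)
qed

lemma comult_uq: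
  "Uq_comult \<omega> \<in> alg_hom (presented_alg (uq_relations \<omega>)) (U.PP.T \<omega>)" (is ?hom)
  "Uq_comult \<omega> (generator (uq_relations \<omega>) x) = U.coprod_elem \<omega> uq_coprod x"
proof -
  let ?R = "uq_relations \<omega>"
  let ?x = "generator ?R" and ?T = "U.PP.T \<omega>" and ?t = "U.PP.tens \<omega>" and ?e = "\<one>\<^bsub>presented_alg ?R\<^esub>"
  let ?Q = "\<lambda>D. D \<in> alg_hom (presented_alg ?R) ?T \<and>
       D (?x U_A) = ?t (?x U_ginv) (?x U_A) \<oplus>\<^bsub>?T\<^esub> ?t (?x U_A) (?x U_g) \<and>
       D (?x U_Adag) = ?t (?x U_ginv) (?x U_Adag) \<oplus>\<^bsub>?T\<^esub> ?t (?x U_Adag) (?x U_g) \<and>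
       D (?x U_N) = ?t (?x U_N) ?e \<oplus>\<^bsub>?T\<^esub> ?t ?e (?x U_N) \<and>
       D (?x U_H) = ?t (?x U_H) ?e \<oplus>\<^bsub>?T\<^esub> ?t ?e (?x U_H) \<and>
       D (?x U_g) = ?t (?x U_g) (?x U_g)"
  have elem: "?Q D \<longleftrightarrow> D \<in> alg_hom (presented_alg ?R) (U.PP.T \<omega>) \<and>
      (\<forall>x \<in> {U_A, U_Adag, U_N, U_H, U_g}. D (generator ?R x) = U.coprod_elem \<omega> uq_coprod x)" for D
    by (simp add: U.coprod_elem_def generator_eq_wclass wclass_Nil[symmetric])
  obtain h where "h \<in> alg_hom (presented_alg ?R) (U.PP.T \<omega>)"
    "\<And>x. h (generator ?R x) = U.coprod_elem \<omega> uq_coprod x"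
    by (rule U.comult_exists[OF coideal_uq]) blast
  then have "?Q h"
    unfolding elem by blast
  from someI[of ?Q, OF this]
  have "?Q (Uq_comult \<omega>)"
    by (simp add: Uq_comult_def Let_def Uq_def ugen_def)
  then have D: "Uq_comult \<omega> \<in> alg_hom (presented_alg ?R) (U.PP.T \<omega>)"
    "\<forall>x \<in> {U_A, U_Adag, U_N, U_H, U_g}. Uq_comult \<omega> (generator ?R x) = U.coprod_elem \<omega> uq_coprod x"
    unfolding elem by blast+
  then show ?hom by blast
  have "Uq_comult \<omega> (generator ?R U_ginv) = U.coprod_elem \<omega> uq_coprod U_ginv"
    by (rule U.alg_hom_inverse_generator[OF U.PP.T.complex_algebra_axioms D(1) uq_inverse(1)])
      (use D(2) in \<open>simp_all add: U.coprod_elem_def U.PP.tens_mult wclass_mult uq_inverse U.PP.tens_one wclass_Nil\<close>)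
  then show "Uq_comult \<omega> (generator ?R x) = U.coprod_elem \<omega> uq_coprod x"
    using D(2) by (cases x) auto
qed

lemma comult_hq:
  "Hq_comult \<omega> \<in> alg_hom (presented_alg (hq_relations \<omega>)) (H.PP.T \<omega>)" (is ?hom)
  "Hq_comult \<omega> (generator (hq_relations \<omega>) x) = H.coprod_elem \<omega> hq_coprod x"
proof -
  let ?R = "hq_relations \<omega>"
  let ?Q = "\<lambda>D. D \<in> alg_hom (presented_alg ?R) (H.PP.T \<omega>) \<and>
     (\<forall>i j. D (tmat \<omega> i j) = (\<Oplus>\<^bsub>H.PP.T \<omega>\<^esub> k \<in> UNIV. H.PP.tens \<omega> (tmat \<omega> i k) (tmat \<omega> k j)))"
  have t: "tmat \<omega> i j \<in> carrier (presented_alg ?R)" for i j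
    using exhaust_3[of i] exhaust_3[of j] by (elim disjE; simp add: tmat_simps)
  \<comment> \<open>Written out over the three indices, for comparison with
    \<open>hq_coprod\<close>, whose lists omit the terms containing a zero entry of
    \<open>tmat\<close>.\<close>
  have sum: "(\<Oplus>\<^bsub>H.PP.T \<omega>\<^esub> k \<in> UNIV. H.PP.tens \<omega> (tmat \<omega> i k) (tmat \<omega> k j)) =
      H.PP.tens \<omega> (tmat \<omega> i 1) (tmat \<omega> 1 j) \<oplus>\<^bsub>H.PP.T \<omega>\<^esub> (H.PP.tens \<omega> (tmat \<omega> i 2) (tmat \<omega> 2 j)
        \<oplus>\<^bsub>H.PP.T \<omega>\<^esub> H.PP.tens \<omega> (tmat \<omega> i 3) (tmat \<omega> 3 j))" for i j
    unfolding UNIV_3 by (subst H.PP.T.finsum_insert; simp add: t)+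
  note tsimps = tmat_simps H.PP.tens_zero generator_eq_wclass H.coprod_elem_def
  obtain h where h: "h \<in> alg_hom (presented_alg ?R) (H.PP.T \<omega>)"
    and gen: "\<And>x. h (generator ?R x) = H.coprod_elem \<omega> hq_coprod x"
    by (rule H.comult_exists[OF coideal_hq]) blast
  have h0: "h \<zero>\<^bsub>presented_alg ?R\<^esub> = \<zero>\<^bsub>H.PP.T \<omega>\<^esub>"
    using alg_homD(5)[OF h, of "\<zero>\<^bsub>presented_alg ?R\<^esub>" 0] alg_homD(1)[OF h, of "\<zero>\<^bsub>presented_alg ?R\<^esub>"]
    by simp
  have h1: "h (wclass ?R []) = H.PP.tens \<omega> (wclass ?R []) (wclass ?R [])"
    using alg_homD(4)[OF h] by (simp add: wclass_Nil H.PP.tens_one)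
  have "h (tmat \<omega> i j) = (\<Oplus>\<^bsub>H.PP.T \<omega>\<^esub> k \<in> UNIV. H.PP.tens \<omega> (tmat \<omega> i k) (tmat \<omega> k j))" for i j
    unfolding sum using exhaust_3[of i] exhaust_3[of j] gen[unfolded tsimps]
    by (elim disjE; simp add: tmat_simps H.PP.tens_zero h0 h1)
  with h have "?Q h" by blast
  from someI[of ?Q, OF this]
  have D: "?Q (Hq_comult \<omega>)"
    by (simp add: Hq_comult_def Let_def Hq_def)
  then show hom: ?hom by blast
  have val: "Hq_comult \<omega> (tmat \<omega> i j) = H.PP.tens \<omega> (tmat \<omega> i 1) (tmat \<omega> 1 j) \<oplus>\<^bsub>H.PP.T \<omega>\<^esub>
      (H.PP.tens \<omega> (tmat \<omega> i 2) (tmat \<omega> 2 j) \<oplus>\<^bsub>H.PP.T \<omega>\<^esub> H.PP.tens \<omega> (tmat \<omega> i 3) (tmat \<omega> 3 j))" for i j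
    using D sum by simp
  note vals = val[of 1 2] val[of 1 3] val[of 2 2] val[of 2 3]
  have "Hq_comult \<omega> (generator ?R H_gammainv) = H.coprod_elem \<omega> hq_coprod H_gammainv"
    by (rule H.alg_hom_inverse_generator[OF H.PP.T.complex_algebra_axioms hom hq_inverse(1)])
      (use vals in \<open>simp_all add: tsimps H.PP.tens_mult wclass_mult hq_inverse H.PP.tens_one wclass_Nil\<close>)
  then show "Hq_comult \<omega> (generator ?R x) = H.coprod_elem \<omega> hq_coprod x"
    using vals by (cases x) (simp_all add: tsimps)
qed

lemma antipode_uq:
  "Uq_antipode \<omega> \<in> alg_hom (presented_alg (uq_relations \<omega>)) (opposite (presented_alg (uq_relations \<omega>)))" (is ?hom)
  "Uq_antipode \<omega> (generator (uq_relations \<omega>) x) = U.anti_elem \<omega> uq_anti x"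
proof -
  let ?R = "uq_relations \<omega>"
  let ?P = "presented_alg ?R"
  let ?Q = "\<lambda>S. S \<in> alg_hom ?P (opposite ?P) \<and>
    (\<forall>y \<in> {U_A, U_Adag, U_N, U_H}. S (generator ?R y) = \<ominus>\<^bsub>?P\<^esub> generator ?R y) \<and>
    S (generator ?R U_g) = generator ?R U_ginv"
  have elem: "?Q S \<longleftrightarrow> S \<in> alg_hom ?P (opposite ?P) \<and>
      (\<forall>x \<in> {U_A, U_Adag, U_N, U_H, U_g}. S (generator ?R x) = U.anti_elem \<omega> uq_anti x)" for S
    by (simp add: U.anti_elem_def generator_eq_wclass U.PP.A.minus_one_smult)
  obtain h where "h \<in> alg_hom ?P (opposite ?P)" "\<And>x. h (generator ?R x) = U.anti_elem \<omega> uq_anti x"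
    by (rule U.antipode_exists[where \<omega> = \<omega>, OF anti_relations_uq]) blast+
  then have "?Q h"
    unfolding elem by blast
  from someI[of ?Q, OF this]
  have "?Q (Uq_antipode \<omega>)"
    by (simp add: Uq_antipode_def Uq_def ugen_def)
  then have S: "Uq_antipode \<omega> \<in> alg_hom ?P (opposite ?P)"
    "\<forall>x \<in> {U_A, U_Adag, U_N, U_H, U_g}. Uq_antipode \<omega> (generator ?R x) = U.anti_elem \<omega> uq_anti x"
    unfolding elem by blast+
  then show ?hom by blast
  have "Uq_antipode \<omega> (generator ?R U_ginv) = U.anti_elem \<omega> uq_anti U_ginv"
    by (rule U.alg_hom_inverse_generator[OF U.Op.complex_algebra_axioms S(1) uq_inverse(1)])
      (use S(2) in \<open>simp_all add: U.anti_elem_def wclass_mult uq_inverse wclass_Nil\<close>)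
  then show "Uq_antipode \<omega> (generator ?R x) = U.anti_elem \<omega> uq_anti x"
    using S(2) by (cases x) auto
qed

lemma antipode_hq:
  "Hq_antipode \<omega> \<in> alg_hom (presented_alg (hq_relations \<omega>)) (opposite (presented_alg (hq_relations \<omega>)))" (is ?hom)
  "Hq_antipode \<omega> (generator (hq_relations \<omega>) x) = H.anti_elem \<omega> hq_anti x"
proof -
  let ?R = "hq_relations \<omega>"
  let ?P = "presented_alg ?R"
  let ?x = "generator ?R"
  let ?Q = "\<lambda>S. S \<in> alg_hom ?P (opposite ?P) \<and>
       S (?x H_alpha) = \<ominus>\<^bsub>?P\<^esub> (?x H_gammainv \<otimes>\<^bsub>?P\<^esub> ?x H_alpha) \<and>
       S (?x H_beta) = (\<ominus>\<^bsub>?P\<^esub> ?x H_beta) \<oplus>\<^bsub>?P\<^esub> ?x H_gammainv \<otimes>\<^bsub>?P\<^esub> ?x H_alpha \<otimes>\<^bsub>?P\<^esub> ?x H_delta \<and>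
       S (?x H_delta) = \<ominus>\<^bsub>?P\<^esub> (?x H_gammainv \<otimes>\<^bsub>?P\<^esub> ?x H_delta) \<and>
       S (?x H_gamma) = ?x H_gammainv"
  have elem: "?Q S \<longleftrightarrow> S \<in> alg_hom ?P (opposite ?P) \<and>
      (\<forall>x \<in> {H_alpha, H_beta, H_delta, H_gamma}. S (generator ?R x) = H.anti_elem \<omega> hq_anti x)" for S
    by (simp add: H.anti_elem_def generator_eq_wclass H.PP.A.minus_one_smult wclass_mult)
  obtain h where "h \<in> alg_hom ?P (opposite ?P)" "\<And>x. h (generator ?R x) = H.anti_elem \<omega> hq_anti x"
    by (rule H.antipode_exists[where \<omega> = \<omega>, OF anti_relations_hq]) blast+
  then have "?Q h"
    unfolding elem by blast
  from someI[of ?Q, OF this]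
  have "?Q (Hq_antipode \<omega>)"
    by (simp add: Hq_antipode_def Let_def Hq_def hgen_def)
  then have S: "Hq_antipode \<omega> \<in> alg_hom ?P (opposite ?P)"
    "\<forall>x \<in> {H_alpha, H_beta, H_delta, H_gamma}. Hq_antipode \<omega> (generator ?R x) = H.anti_elem \<omega> hq_anti x"
    unfolding elem by blast+
  then show ?hom by blast
  have "Hq_antipode \<omega> (generator ?R H_gammainv) = H.anti_elem \<omega> hq_anti H_gammainv"
    by (rule H.alg_hom_inverse_generator[OF H.Op.complex_algebra_axioms S(1) hq_inverse(1)])
      (use S(2) in \<open>simp_all add: H.anti_elem_def wclass_mult hq_inverse wclass_Nil\<close>)
  then show "Hq_antipode \<omega> (generator ?R x) = H.anti_elem \<omega> hq_anti x"
    using S(2) by (cases x) auto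
qed

section \<open>The Hopf pairing\<close>

text \<open>Descent in two stages: for each word \<open>w\<close> the function of \<open>v\<close>
  descends to the quantum group, and the resulting function of \<open>w\<close> then descends to
  \<open>Uq\<close>.\<close>

definition hopf_pairing where
  "hopf_pairing \<omega> \<phi> a = form_of (\<lambda>w. form_of (\<lambda>v. pairing \<omega> v w) a) \<phi>"

context
  fixes \<omega> :: complex
  assumes \<omega>: "\<omega> \<noteq> 0"
begin

abbreviation "UU \<equiv> presented_alg (uq_relations \<omega>)"
abbreviation "HH \<equiv> presented_alg (hq_relations \<omega>)"
abbreviation "ucls \<equiv> wclass (uq_relations \<omega>)"
abbreviation "hcls \<equiv> wclass (hq_relations \<omega>)"

text \<open>On a representative \<open>q\<close> of \<open>a\<close> the function is a finite
  combination of the functions \<open>pairing \<omega> v\<close>, each of which annihilates;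
  \<open>lin_swap\<close> exchanges the two sums.\<close>

lemma hopf_pairing_inner_annihilates:
  assumes "a \<in> carrier HH"
  shows "annihilates (uq_relations \<omega>) (\<lambda>w. form_of (\<lambda>v. pairing \<omega> v w) a)"
proof -
  obtain q where q: "a = (Idl\<^bsub>free_alg\<^esub> (hq_relations \<omega>)) +>\<^bsub>free_alg\<^esub> q"
    using assms by (rule presented_alg_carrierE)
  have "lin (\<lambda>w. lin (\<lambda>v. pairing \<omega> v (x @ w @ y)) q) r = 0" if "r \<in> uq_relations \<omega>" for r x y
  proof -
    have "lin (\<lambda>w. lin (\<lambda>v. pairing \<omega> v (x @ w @ y)) q) r = lin (\<lambda>v. lin (\<lambda>w. pairing \<omega> v (x @ w @ y)) r) q"
      by (rule lin_swap)
    also have "\<dots> = lin (\<lambda>v. 0) q"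
      using annihilatesD[OF pairing_annihilates_uq[OF \<omega>] that] by (intro lin_cong)
    finally show ?thesis by simp
  qed
  then show ?thesis
    unfolding q annihilates_def by (simp only: form_of_class[OF pairing_annihilates_hq[OF \<omega>]]) blast
qed

lemma hopf_pairing_bilinear:
  "bilinear_form UU HH (hopf_pairing \<omega>)"
proof (rule bilinear_formI)
  show "(\<lambda>\<phi>. hopf_pairing \<omega> \<phi> a) \<in> linear_forms UU"
    if "a \<in> carrier HH" for a
    unfolding hopf_pairing_def by (rule form_of_linear[OF hopf_pairing_inner_annihilates[OF that]])
  show "hopf_pairing \<omega> \<phi> \<in> linear_forms HH"
    if \<phi>: "\<phi> \<in> carrier UU" for \<phi>
  proof -
    obtain p where p: "\<phi> = (Idl\<^bsub>free_alg\<^esub> (uq_relations \<omega>)) +>\<^bsub>free_alg\<^esub> p"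
      using \<phi> by (rule presented_alg_carrierE)
    have "(\<lambda>a. lin (\<lambda>w. form_of (\<lambda>v. pairing \<omega> v w) a) p) \<in> linear_forms HH"
      by (intro linear_forms_lin form_of_linear pairing_annihilates_hq[OF \<omega>])
    moreover have "hopf_pairing \<omega> \<phi> a = lin (\<lambda>w. form_of (\<lambda>v. pairing \<omega> v w) a) p"
      if "a \<in> carrier HH" for a
      unfolding hopf_pairing_def p by (rule form_of_class[OF hopf_pairing_inner_annihilates[OF that]])
    ultimately show ?thesis
      by (simp add: linear_forms_def H.PP.A.add.m_closed)
  qed
qed

lemma hopf_pairing_words:
  "hopf_pairing \<omega> (ucls w) (hcls v) = pairing \<omega> v w"
  unfolding hopf_pairing_def
  by (simp only: form_of_wclass[OF pairing_annihilates_hq[OF \<omega>]]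
      form_of_wclass[OF pairing_annihilates_uq[OF \<omega>]])

lemma hopf_pairing_generators:
  assumes "x \<in> {U_A, U_Adag, U_H, U_N}"
  shows "hopf_pairing \<omega> (generator (uq_relations \<omega>) x) (tmat \<omega> i j) = rho \<omega> (generator (uq_relations \<omega>) x) $ i $ j"
proof -
  have zero: "hopf_pairing \<omega> (ucls w) \<zero>\<^bsub>HH\<^esub> = 0" for w
    by (rule H.PP.A.linear_forms_zero[OF bilinear_formD(2)[OF hopf_pairing_bilinear]]) simp
  note rho = rho_generators[OF \<omega>, unfolded ugen_def generator_eq_wclass]
  show ?thesis
    using assms exhaust_3[of i] exhaust_3[of j] rho unfolding generator_eq_wclass
    by (elim insertE disjE emptyE; hypsubst;
        simp add: tmat_simps hopf_pairing_words zero mat_unit_def W.pair_letters pairing_Nil_letter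
          del: W.pair.simps)
qed

section \<open>The Hopf axioms for the descended pairing\<close>

lemma linear_form_eqI2:
  assumes "bilinear_form (presented_alg R) (presented_alg R') F"
    "bilinear_form (presented_alg R) (presented_alg R') G"
    and "\<And>w v. F (wclass R w) (wclass R' v) = G (wclass R w) (wclass R' v)"
    and "x \<in> carrier (presented_alg R)" "y \<in> carrier (presented_alg R')"
  shows "F x y = G x y"
proof (rule linear_form_eqI[OF bilinear_formD(1)[OF assms(1)] bilinear_formD(1)[OF assms(2)]])
  fix w
  show "F (wclass R w) y = G (wclass R w) y"
    by (rule linear_form_eqI[OF bilinear_formD(2)[OF assms(1)] bilinear_formD(2)[OF assms(2)]])
      (use assms in simp_all)
qed (use assms in simp_all)

abbreviation "TF \<equiv> tensor_form UU HH (hopf_pairing \<omega>)"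

lemma TF_bilinear: "bilinear_form (U.PP.T \<omega>) (H.PP.T \<omega>) TF"
  by (intro tensor_form_spec presented_alg_complex_algebra hopf_pairing_bilinear)

lemma TF_tens:
  "\<lbrakk>\<phi> \<in> carrier UU; \<psi> \<in> carrier UU; a \<in> carrier HH; b \<in> carrier HH\<rbrakk> \<Longrightarrow>
    TF (U.PP.tens \<omega> \<phi> \<psi>) (H.PP.tens \<omega> a b) = hopf_pairing \<omega> \<phi> a * hopf_pairing \<omega> \<psi> b"
  by (intro tensor_form_spec presented_alg_complex_algebra hopf_pairing_bilinear)

text \<open>On word classes this is \<open>pairing_append_left\<close>. It extends first linearly in
  \<open>a\<close> for fixed words and then bilinearly in \<open>\<phi>\<close> and
  \<open>\<psi>\<close>; since the coproduct is only seen through a linear form, it is never written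
  out as a sum of tensors.\<close>

lemma hopf_pairing_mult_left:
  assumes \<phi>: "\<phi> \<in> carrier UU" and \<psi>: "\<psi> \<in> carrier UU" and a: "a \<in> carrier HH"
  shows "hopf_pairing \<omega> (\<phi> \<otimes>\<^bsub>UU\<^esub> \<psi>) a = TF (U.PP.tens \<omega> \<phi> \<psi>) (Hq_comult \<omega> a)"
proof -
  note D = comult_hq[of \<omega>]
  have Da: "Hq_comult \<omega> a \<in> carrier (H.PP.T \<omega>)"
    by (rule alg_homD(1)[OF D(1) a])
  have word: "hopf_pairing \<omega> (ucls w \<otimes>\<^bsub>UU\<^esub> ucls w') a =
      TF (U.PP.tens \<omega> (ucls w) (ucls w')) (Hq_comult \<omega> a)" for w w'
  proof (rule linear_form_eqI[OF _ _ _ a])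
    show "(\<lambda>a. hopf_pairing \<omega> (ucls w \<otimes>\<^bsub>UU\<^esub> ucls w') a) \<in> linear_forms HH"
      by (rule bilinear_formD(2)[OF hopf_pairing_bilinear]) simp
    have lin: "TF (U.PP.tens \<omega> (ucls w) (ucls w')) \<in> linear_forms (H.PP.T \<omega>)"
      by (rule bilinear_formD(2)[OF TF_bilinear]) simp
    show "(\<lambda>a. TF (U.PP.tens \<omega> (ucls w) (ucls w')) (Hq_comult \<omega> a))
        \<in> linear_forms HH"
      by (rule linear_forms_alg_hom[OF D(1) lin])
    show "hopf_pairing \<omega> (ucls w \<otimes>\<^bsub>UU\<^esub> ucls w') (hcls v) =
        TF (U.PP.tens \<omega> (ucls w) (ucls w'))
          (Hq_comult \<omega> (hcls v))" for v
      by (simp add: H.comult_value[OF D lin] wclass_mult hopf_pairing_words TF_tens pairing_append_left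
          del: W.pair.simps)
  qed
  show ?thesis
  proof (rule linear_form_eqI2[where F = "\<lambda>\<phi> \<psi>. hopf_pairing \<omega> (\<phi> \<otimes>\<^bsub>UU\<^esub> \<psi>) a", OF _ _ word \<phi> \<psi>])
    show "bilinear_form UU UU (\<lambda>\<phi> \<psi>. hopf_pairing \<omega> (\<phi> \<otimes>\<^bsub>UU\<^esub> \<psi>) a)"
      by (intro bilinear_formI U.PP.A.linear_forms_mult_right[where f = "\<lambda>\<phi>. hopf_pairing \<omega> \<phi> a"]
          U.PP.A.linear_forms_mult_left[where f = "\<lambda>\<phi>. hopf_pairing \<omega> \<phi> a"] bilinear_formD(1)[OF hopf_pairing_bilinear] a)
    show "bilinear_form UU UU (\<lambda>\<phi> \<psi>. TF (U.PP.tens \<omega> \<phi> \<psi>) (Hq_comult \<omega> a))"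
      by (intro bilinear_formI U.PP.linear_form_tens[where f = "\<lambda>z. TF z (Hq_comult \<omega> a)"]
          bilinear_formD(1)[OF TF_bilinear] Da)
  qed
qed

lemma hopf_pairing_mult_right:
  assumes \<phi>: "\<phi> \<in> carrier UU" and a: "a \<in> carrier HH" and b: "b \<in> carrier HH"
  shows "TF (Uq_comult \<omega> \<phi>) (H.PP.tens \<omega> a b) = hopf_pairing \<omega> \<phi> (a \<otimes>\<^bsub>HH\<^esub> b)"
proof -
  note D = comult_uq[of \<omega>]
  have D\<phi>: "Uq_comult \<omega> \<phi> \<in> carrier (U.PP.T \<omega>)"
    by (rule alg_homD(1)[OF D(1) \<phi>])
  have word: "TF (Uq_comult \<omega> \<phi>) (H.PP.tens \<omega> (hcls v) (hcls v')) =
      hopf_pairing \<omega> \<phi> (hcls v \<otimes>\<^bsub>HH\<^esub> hcls v')" for v v'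
  proof (rule linear_form_eqI[OF _ _ _ \<phi>])
    show "(\<lambda>\<phi>. hopf_pairing \<omega> \<phi> (hcls v \<otimes>\<^bsub>HH\<^esub> hcls v')) \<in> linear_forms UU"
      by (rule bilinear_formD(1)[OF hopf_pairing_bilinear]) simp
    have lin: "(\<lambda>z. TF z (H.PP.tens \<omega> (hcls v) (hcls v'))) \<in> linear_forms (U.PP.T \<omega>)"
      by (rule bilinear_formD(1)[OF TF_bilinear]) simp
    show "(\<lambda>\<phi>. TF (Uq_comult \<omega> \<phi>) (H.PP.tens \<omega> (hcls v) (hcls v')))
        \<in> linear_forms UU"
      by (rule linear_forms_alg_hom[OF D(1) lin])
    show "TF (Uq_comult \<omega> (ucls w)) (H.PP.tens \<omega> (hcls v) (hcls v')) =
        hopf_pairing \<omega> (ucls w) (hcls v \<otimes>\<^bsub>HH\<^esub> hcls v')" for w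
      by (simp add: U.comult_value[OF D lin] wclass_mult hopf_pairing_words TF_tens pairing_append_right
          del: W.pair.simps)
  qed
  show ?thesis
  proof (rule linear_form_eqI2[where G = "\<lambda>a b. hopf_pairing \<omega> \<phi> (a \<otimes>\<^bsub>HH\<^esub> b)", OF _ _ word a b])
    show "bilinear_form HH HH (\<lambda>a b. hopf_pairing \<omega> \<phi> (a \<otimes>\<^bsub>HH\<^esub> b))"
      by (intro bilinear_formI H.PP.A.linear_forms_mult_right[where f = "hopf_pairing \<omega> \<phi>"]
          H.PP.A.linear_forms_mult_left[where f = "hopf_pairing \<omega> \<phi>"] bilinear_formD(2)[OF hopf_pairing_bilinear] \<phi>)
    show "bilinear_form HH HH (\<lambda>a b. TF (Uq_comult \<omega> \<phi>) (H.PP.tens \<omega> a b))"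
      by (intro bilinear_formI H.PP.linear_form_tens[where f = "TF (Uq_comult \<omega> \<phi>)"]
          bilinear_formD(2)[OF TF_bilinear] D\<phi>)
  qed
qed

lemma linear_form_counit: "h \<in> alg_hom A complex_alg \<Longrightarrow> h \<in> linear_forms A"
  using linear_forms_alg_hom[of h A complex_alg "\<lambda>z. z"] by (simp add: linear_forms_def)

lemma hopf_pairing_one_left:
  assumes a: "a \<in> carrier HH"
  shows "hopf_pairing \<omega> \<one>\<^bsub>UU\<^esub> a = Hq_counit \<omega> a"
proof (rule linear_form_eqI[OF _ linear_form_counit[OF counit_hq_hom] _ a])
  show "hopf_pairing \<omega> \<one>\<^bsub>UU\<^esub> \<in> linear_forms HH"
    by (rule bilinear_formD(2)[OF hopf_pairing_bilinear]) simp
  show "hopf_pairing \<omega> \<one>\<^bsub>UU\<^esub> (hcls v) = Hq_counit \<omega> (hcls v)" for v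
    by (simp only: wclass_Nil[symmetric] hopf_pairing_words counit_hq W.pair_Nil_right)
qed

lemma hopf_pairing_one_right:
  assumes \<phi>: "\<phi> \<in> carrier UU"
  shows "hopf_pairing \<omega> \<phi> \<one>\<^bsub>HH\<^esub> = Uq_counit \<omega> \<phi>"
proof (rule linear_form_eqI[OF _ linear_form_counit[OF counit_uq_hom] _ \<phi>])
  show "(\<lambda>\<phi>. hopf_pairing \<omega> \<phi> \<one>\<^bsub>HH\<^esub>) \<in> linear_forms UU"
    by (rule bilinear_formD(1)[OF hopf_pairing_bilinear]) simp
  show "hopf_pairing \<omega> (ucls w) \<one>\<^bsub>HH\<^esub> = Uq_counit \<omega> (ucls w)" for w
    by (simp only: wclass_Nil[symmetric] hopf_pairing_words counit_uq W.pair.simps)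
qed

text \<open>An antipode is a linear map into the opposite algebra, which has the same linear forms.
  Both sides are therefore bilinear, and \<open>pairing_antipode\<close> settles them on word
  classes.\<close>

lemma hopf_pairing_antipode:
  assumes \<phi>: "\<phi> \<in> carrier UU" and a: "a \<in> carrier HH"
  shows "hopf_pairing \<omega> (Uq_antipode \<omega> \<phi>) a = hopf_pairing \<omega> \<phi> (Hq_antipode \<omega> a)"
proof (rule linear_form_eqI2[where F = "\<lambda>\<phi> a. hopf_pairing \<omega> (Uq_antipode \<omega> \<phi>) a", OF _ _ _ \<phi> a])
  note SU = antipode_uq[of \<omega>] and SH = antipode_hq[of \<omega>]
  have SUc: "Uq_antipode \<omega> \<phi> \<in> carrier UU" if "\<phi> \<in> carrier UU" for \<phi>
    using alg_homD(1)[OF SU(1) that] by simp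
  have SHc: "Hq_antipode \<omega> a \<in> carrier HH" if "a \<in> carrier HH" for a
    using alg_homD(1)[OF SH(1) that] by simp
  note left = bilinear_formD(1)[OF hopf_pairing_bilinear] and right = bilinear_formD(2)[OF hopf_pairing_bilinear]
  show "bilinear_form UU HH (\<lambda>\<phi> a. hopf_pairing \<omega> (Uq_antipode \<omega> \<phi>) a)"
  proof (rule bilinear_formI)
    show "(\<lambda>\<phi>. hopf_pairing \<omega> (Uq_antipode \<omega> \<phi>) a) \<in> linear_forms UU" if "a \<in> carrier HH" for a
      by (rule linear_forms_alg_hom[OF SU(1), of "\<lambda>\<phi>. hopf_pairing \<omega> \<phi> a"]) (simp add: left that)
  qed (intro right SUc)
  show "bilinear_form UU HH (\<lambda>\<phi> a. hopf_pairing \<omega> \<phi> (Hq_antipode \<omega> a))"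
  proof (rule bilinear_formI)
    show "(\<lambda>a. hopf_pairing \<omega> \<phi> (Hq_antipode \<omega> a)) \<in> linear_forms HH" if "\<phi> \<in> carrier UU" for \<phi>
      by (rule linear_forms_alg_hom[OF SH(1), of "hopf_pairing \<omega> \<phi>"]) (simp add: right that)
  qed (intro left SHc)
  show "hopf_pairing \<omega> (Uq_antipode \<omega> (ucls w)) (hcls v) =
      hopf_pairing \<omega> (ucls w) (Hq_antipode \<omega> (hcls v))" for w v
    using U.antipode_value[OF SU left[OF wclass_closed], where w = w]
      H.antipode_value[OF SH right[OF wclass_closed], where w = v] pairing_antipode[OF \<omega>, of w v]
    by (simp only: hopf_pairing_words)
qed

end

theorem proposition4p1:
  fixes \<omega> :: complex
  assumes "\<omega> \<noteq> 0"
  shows "\<exists>P. bilinear_form (Uq \<omega>) (Hq \<omega>) P \<and>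
    (\<forall>x \<in> {U_A, U_Adag, U_H, U_N}. \<forall>i j.
       P (ugen \<omega> x) (tmat \<omega> i j) = rho \<omega> (ugen \<omega> x) $ i $ j) \<and>
    (\<forall>\<phi> \<in> carrier (Uq \<omega>). \<forall>\<psi> \<in> carrier (Uq \<omega>). \<forall>a \<in> carrier (Hq \<omega>). \<forall>b \<in> carrier (Hq \<omega>).
       P (\<phi> \<otimes>\<^bsub>Uq \<omega>\<^esub> \<psi>) a =
         tensor_form (Uq \<omega>) (Hq \<omega>) P (pure_tensor (Uq \<omega>) (Uq \<omega>) \<phi> \<psi>) (Hq_comult \<omega> a) \<and>
       P \<one>\<^bsub>Uq \<omega>\<^esub> a = Hq_counit \<omega> a \<and>
       tensor_form (Uq \<omega>) (Hq \<omega>) P (Uq_comult \<omega> \<phi>) (pure_tensor (Hq \<omega>) (Hq \<omega>) a b) =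
         P \<phi> (a \<otimes>\<^bsub>Hq \<omega>\<^esub> b) \<and>
       P \<phi> \<one>\<^bsub>Hq \<omega>\<^esub> = Uq_counit \<omega> \<phi> \<and>
       P (Uq_antipode \<omega> \<phi>) a = P \<phi> (Hq_antipode \<omega> a))"
  unfolding Uq_def Hq_def ugen_def
  by (intro exI[of _ "hopf_pairing \<omega>"] conjI ballI allI hopf_pairing_bilinear hopf_pairing_generators hopf_pairing_mult_left
      hopf_pairing_one_left hopf_pairing_mult_right hopf_pairing_one_right hopf_pairing_antipode assms) assumption+

end
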